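(* Let $v\ge 1$ and let $Y\subset \mathbb{P}^{n+v}$ be an integral and non-degenerate variety of dimension $m$. For a $(v-1)$-dimensional linear subspace $V\subset \mathbb{P}^{n+v}$ with $V\cap Y=\emptyset$, let $X_V:=\ell_V(Y)\subset \mathbb{P}^n$ be the image of $Y$ under the linear projection $\ell_V:\mathbb{P}^{n+v}\setminus V\to \mathbb{P}^n$ from $V$. (a) If $V$ contains a general point of $\mathbb{P}^{n+v}$, then $$R_{X_V}(P)\le \alpha_Y \quad \text{for all } P\in \mathbb{P}^n.$$ (b) Assume that $V$ is general. Let $b(Y,v)$ be the minimal integer $s$ such that $\dim(\sigma_s(Y))\ge n+1$. Then $$\left\lceil \frac{n+1}{m+1}\right\rceil \le b(Y,v)\le \alpha_Y-\left\lceil \frac{v-m-1}{m+1}\right\rceil$$ and $$R_{X_V}(P)\le b(Y,v)\quad \text{for all } P\in \mathbb{P}^n.$$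
   Context: All projective spaces are over an algebraically closed field $K$ of characteristic $0$. $\langle\cdot\rangle$ denotes linear span. For an integral non-degenerate projective variety $X\subset\mathbb{P}^r$ and $P\in\mathbb{P}^r$, the $X$-rank $R_X(P)$ is the minimum number of distinct points of $X$ whose linear span contains $P$. The $s$-th secant variety $\sigma_s(X)$ is the Zariski closure of $\bigcup_{P_1,\dots,P_s\in X}\langle P_1,\dots,P_s\rangle$. The $X$-generic rank $\alpha_X$ is the minimum integer $s$ such that $\sigma_s(X)=\mathbb{P}^r$. Genericity: in (a), "$V$ contains a general point of $\mathbb{P}^{n+v}$" means that there is a non-empty Zariski open subset $U\subset\mathbb{P}^{n+v}$, depending only on $Y$, such that the conclusion holds for every such $V$ (disjoint from $Y$) with $V\cap U\neq\emptyset$. In (b), "$V$ is general" means that $V$ lies in a suitable non-empty Zariski open subset, depending only on $Y$ and not on $P$, of the Grassmannian $G(v-1,n+v)$ of $(v-1)$-dimensional linear subspaces of $\mathbb{P}^{n+v}$ (still with $V\cap Y=\emptyset$). *)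

theory Defs
  imports
    "HOL-Analysis.Analysis"
    "HOL-Computational_Algebra.Polynomial"
begin

text \<open>
  With \<open>CARD('n) = r + 1\<close>, the projective space of dimension \<open>r\<close> is the set of lines
  through the origin of the coordinate space \<open>'a ^ 'n\<close>: a point is a one-dimensional subspace,
  a subset of projective space is a set of such subspaces.  A linear subspace of projective
  dimension \<open>k - 1\<close> is given by a vector subspace of dimension \<open>k\<close>.
\<close>

definition proj_space :: "('a::field ^ 'n) set set" where
  "proj_space = {L. vec.subspace L \<and> vec.dim L = 1}"

definition proj_points :: "('a::field ^ 'n) set \<Rightarrow> ('a ^ 'n) set set" where
  "proj_points W = {L \<in> proj_space. L \<subseteq> W}"

definition proj_span :: "('a::field ^ 'n) set set \<Rightarrow> ('a ^ 'n) set set" where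
  "proj_span S = proj_points (vec.span (\<Union>S))"

definition homogeneous_poly :: "nat \<Rightarrow> ('a::field ^ 'n \<Rightarrow> 'a) \<Rightarrow> bool" where
  "homogeneous_poly d f \<longleftrightarrow>
     (\<exists>c. f = (\<lambda>x. \<Sum>a | sum a UNIV = d. c a * (\<Prod>i\<in>UNIV. (x $ i) ^ a i)))"

definition nonvanishing :: "('a::field ^ 'n \<Rightarrow> 'a) set \<Rightarrow> ('a ^ 'n) set set" where
  "nonvanishing F = {L \<in> proj_space. \<not> (\<forall>f\<in>F. \<forall>x\<in>L. f x = 0)}"

definition zariski :: "('a::field ^ 'n) set topology" where
  "zariski = topology (\<lambda>U. \<exists>F. (\<forall>f\<in>F. \<exists>d. homogeneous_poly d f) \<and> U = nonvanishing F)"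

text \<open>
  The lemmas below guard against the totality of \<open>sum\<close> and \<open>topology\<close>: the sum defining a
  homogeneous polynomial ranges over a finite set, and the sets \<open>nonvanishing F\<close> do form a
  topology.
\<close>

lemma finite_exponents: "finite {a :: 'n::finite \<Rightarrow> nat. sum a UNIV = d}"
proof (rule finite_subset)
  show "{a :: 'n \<Rightarrow> nat. sum a UNIV = d} \<subseteq> UNIV \<rightarrow>\<^sub>E {..d}"
    by (auto intro: member_le_sum)
  show "finite (UNIV \<rightarrow>\<^sub>E {..d} :: ('n \<Rightarrow> nat) set)"
    by (rule finite_PiE) auto
qed

lemma homogeneous_poly_mult:
  fixes f g :: "'a::field ^ 'n \<Rightarrow> 'a"
  assumes "homogeneous_poly d f" "homogeneous_poly e g"
  shows "homogeneous_poly (d + e) (\<lambda>x. f x * g x)"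
proof -
  define E where "E k = {a :: 'n \<Rightarrow> nat. sum a UNIV = k}" for k
  define M where "M x a = (\<Prod>i\<in>UNIV. (x $ i) ^ a i)" for x :: "'a ^ 'n" and a :: "'n \<Rightarrow> nat"
  have fin: "finite (E k)" for k
    unfolding E_def by (rule finite_exponents)
  obtain c where c: "\<And>x. f x = (\<Sum>a\<in>E d. c a * M x a)"
    using assms(1) unfolding homogeneous_poly_def E_def M_def by auto
  obtain c' where c': "\<And>x. g x = (\<Sum>b\<in>E e. c' b * M x b)"
    using assms(2) unfolding homogeneous_poly_def E_def M_def by auto
  define p where "p = (\<lambda>(a, b). (\<lambda>i. a i + b i) :: 'n \<Rightarrow> nat)"
  define C where "C s = (\<Sum>z \<in> {z \<in> E d \<times> E e. p z = s}. c (fst z) * c' (snd z))" for s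
  have "f x * g x = (\<Sum>s\<in>E (d + e). C s * M x s)" for x
  proof -
    have "f x * g x = (\<Sum>z\<in>E d \<times> E e. (c (fst z) * c' (snd z)) * M x (p z))"
      unfolding c c' sum_product sum.cartesian_product
      by (intro sum.cong)
        (auto simp: p_def M_def power_add prod.distrib mult_ac)
    also have "\<dots> = (\<Sum>s\<in>E (d + e). \<Sum>z\<in>{z \<in> E d \<times> E e. p z = s}.
        (c (fst z) * c' (snd z)) * M x (p z))"
      by (rule sum.group[symmetric]) (auto simp: fin, auto simp: E_def p_def sum.distrib)
    also have "\<dots> = (\<Sum>s\<in>E (d + e). C s * M x s)"
      unfolding C_def sum_distrib_right by (intro sum.cong) auto
    finally show ?thesis .
  qed
  then have "(\<lambda>x. f x * g x) = (\<lambda>x. \<Sum>s | sum s UNIV = d + e. C s * (\<Prod>i\<in>UNIV. (x $ i) ^ s i))"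
    unfolding E_def M_def by auto
  then show ?thesis
    unfolding homogeneous_poly_def by blast
qed

lemma homogeneous_poly_scale:
  assumes "homogeneous_poly d f"
  shows "f (k *s x) = k ^ d * f x"
proof -
  obtain c where c: "f = (\<lambda>x. \<Sum>a | sum a UNIV = d. c a * (\<Prod>i\<in>UNIV. (x $ i) ^ a i))"
    using assms unfolding homogeneous_poly_def by auto
  show ?thesis
    unfolding c sum_distrib_left
    by (intro sum.cong) (auto simp: power_mult_distrib prod.distrib power_sum mult_ac)
qed

lemma proj_space_iff:
  fixes L :: "('a::field ^ 'n) set"
  shows "L \<in> proj_space \<longleftrightarrow> (\<exists>w. w \<noteq> 0 \<and> L = range (\<lambda>k. k *s w))"
proof
  assume "L \<in> proj_space"
  then have L: "vec.subspace L" "vec.dim L = 1"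
    by (simp_all add: proj_space_def)
  obtain B where B: "B \<subseteq> L" "vec.independent B" "L \<subseteq> vec.span B" "card B = vec.dim L"
    by (rule vec.basis_exists)
  have "card B = 1"
    using B(4) L(2) by simp
  then obtain w where w: "B = {w}"
    by (rule card_1_singletonE)
  have "w \<noteq> 0"
    using B(2) w vec.dependent_zero[of B] by auto
  moreover have "L = vec.span {w}"
    using B(1,3) L(1) w vec.span_minimal[of B L] by auto
  ultimately show "\<exists>w. w \<noteq> 0 \<and> L = range (\<lambda>k. k *s w)"
    unfolding vec.span_singleton by (intro exI[of _ w] conjI)
next
  assume "\<exists>w. w \<noteq> 0 \<and> L = range (\<lambda>k. k *s w)"
  then obtain w where w: "w \<noteq> 0" "L = vec.span {w}"
    unfolding vec.span_singleton by (elim exE conjE)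
  then have "vec.dim L = 1"
    using vec.dim_eq_card_independent[of "{w}"] by simp
  then show "L \<in> proj_space"
    unfolding proj_space_def using w(2) by simp
qed

lemma nonvanishing_Int:
  fixes F G :: "('a::field ^ 'n \<Rightarrow> 'a) set"
  assumes "\<And>f. f \<in> F \<Longrightarrow> \<exists>d. homogeneous_poly d f" "\<And>f. f \<in> G \<Longrightarrow> \<exists>d. homogeneous_poly d f"
  shows "nonvanishing F \<inter> nonvanishing G = nonvanishing {\<lambda>x. f x * g x | f g. f \<in> F \<and> g \<in> G}"
    (is "_ = nonvanishing ?H")
proof (intro equalityI subsetI)
  fix L assume "L \<in> nonvanishing F \<inter> nonvanishing G"
  then have L: "L \<in> proj_space" "\<exists>f\<in>F. \<exists>x\<in>L. f x \<noteq> 0" "\<exists>g\<in>G. \<exists>x\<in>L. g x \<noteq> 0"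
    unfolding nonvanishing_def by simp_all
  obtain w where w: "L = range (\<lambda>k. k *s w)"
    using L(1) unfolding proj_space_iff by blast
  obtain f a where f: "f \<in> F" "f (a *s w) \<noteq> 0"
    using L(2) unfolding w by blast
  obtain g b where g: "g \<in> G" "g (b *s w) \<noteq> 0"
    using L(3) unfolding w by blast
  obtain d e where "homogeneous_poly d f" "homogeneous_poly e g"
    using f(1) g(1) assms by blast
  then have "f w \<noteq> 0" "g w \<noteq> 0"
    using f(2) g(2) by (simp_all add: homogeneous_poly_scale)
  then have "f w * g w \<noteq> 0"
    by simp
  moreover have "(\<lambda>x. f x * g x) \<in> ?H"
    using f(1) g(1) by blast
  moreover have "w \<in> L"
    unfolding w by (rule range_eqI[of _ _ 1]) simp
  ultimately have "\<exists>h\<in>?H. \<exists>x\<in>L. h x \<noteq> 0"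
    by (intro bexI[of _ "\<lambda>x. f x * g x"] bexI[of _ w])
  then show "L \<in> nonvanishing ?H"
    using L(1) unfolding nonvanishing_def by simp
next
  fix L assume "L \<in> nonvanishing ?H"
  then obtain f g x where "L \<in> proj_space" "f \<in> F" "g \<in> G" "x \<in> L" "f x * g x \<noteq> 0"
    unfolding nonvanishing_def by blast
  then show "L \<in> nonvanishing F \<inter> nonvanishing G"
    unfolding nonvanishing_def by auto
qed

lemma istopology_zariski:
  "istopology (\<lambda>U. \<exists>F. (\<forall>f\<in>F. \<exists>d. homogeneous_poly d f) \<and> U = nonvanishing F)"
  unfolding istopology_def
proof (intro conjI allI impI)
  fix S T :: "('a ^ 'n) set set"
  assume "\<exists>F. (\<forall>f\<in>F. \<exists>d. homogeneous_poly d f) \<and> S = nonvanishing F"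
    and "\<exists>F. (\<forall>f\<in>F. \<exists>d. homogeneous_poly d f) \<and> T = nonvanishing F"
  then obtain F G where F: "\<forall>f\<in>F. \<exists>d. homogeneous_poly d f" "S = nonvanishing F"
    and G: "\<forall>f\<in>G. \<exists>d. homogeneous_poly d f" "T = nonvanishing G"
    by auto
  have "S \<inter> T = nonvanishing {\<lambda>x. f x * g x | f g. f \<in> F \<and> g \<in> G}"
    unfolding F(2) G(2) by (rule nonvanishing_Int) (use F(1) G(1) in auto)
  moreover have "\<forall>h\<in>{\<lambda>x. f x * g x | f g. f \<in> F \<and> g \<in> G}. \<exists>d. homogeneous_poly d h"
  proof
    fix h assume "h \<in> {\<lambda>x. f x * g x | f g. f \<in> F \<and> g \<in> G}"
    then obtain f g where fg: "h = (\<lambda>x. f x * g x)" "f \<in> F" "g \<in> G"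
      by auto
    then obtain d e where "homogeneous_poly d f" "homogeneous_poly e g"
      using F(1) G(1) by blast
    then show "\<exists>d. homogeneous_poly d h"
      unfolding fg(1) using homogeneous_poly_mult by blast
  qed
  ultimately show "\<exists>F. (\<forall>f\<in>F. \<exists>d. homogeneous_poly d f) \<and> S \<inter> T = nonvanishing F"
    by (intro exI[of _ "{\<lambda>x. f x * g x | f g. f \<in> F \<and> g \<in> G}"] conjI)
next
  fix \<K> :: "('a ^ 'n) set set set"
  assume "\<forall>K\<in>\<K>. \<exists>F. (\<forall>f\<in>F. \<exists>d. homogeneous_poly d f) \<and> K = nonvanishing F"
  then obtain F where F: "\<And>K. K \<in> \<K> \<Longrightarrow> (\<forall>f\<in>F K. \<exists>d. homogeneous_poly d f) \<and> K = nonvanishing (F K)"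
    by metis
  have "\<Union>\<K> = (\<Union>K\<in>\<K>. nonvanishing (F K))"
    using F by auto
  also have "\<dots> = nonvanishing (\<Union>K\<in>\<K>. F K)"
    by (auto simp: nonvanishing_def)
  finally have "\<Union>\<K> = nonvanishing (\<Union>K\<in>\<K>. F K)" .
  moreover have "\<forall>f\<in>(\<Union>K\<in>\<K>. F K). \<exists>d. homogeneous_poly d f"
    using F by simp
  ultimately show "\<exists>F. (\<forall>f\<in>F. \<exists>d. homogeneous_poly d f) \<and> \<Union>\<K> = nonvanishing F"
    by (intro exI[of _ "\<Union>K\<in>\<K>. F K"] conjI)
qed

lemma openin_zariski:
  "openin zariski U \<longleftrightarrow> (\<exists>F. (\<forall>f\<in>F. \<exists>d. homogeneous_poly d f) \<and> U = nonvanishing F)"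
  by (simp only: zariski_def topology_inverse'[OF istopology_zariski])

lemma nonvanishing_subset: "nonvanishing F \<subseteq> proj_space"
  by (simp add: nonvanishing_def)

lemma topspace_zariski: "topspace zariski = (proj_space :: ('a::field ^ 'n) set set)"
proof
  show "topspace zariski \<subseteq> (proj_space :: ('a ^ 'n) set set)"
  proof -
    obtain F :: "('a ^ 'n \<Rightarrow> 'a) set" where "topspace zariski = nonvanishing F"
      using openin_topspace[of "zariski :: ('a ^ 'n) set topology"]
      unfolding openin_zariski by blast
    then show ?thesis
      using nonvanishing_subset by simp
  qed
  have "homogeneous_poly 0 (\<lambda>x :: 'a ^ 'n. 1)"
  proof -
    have "{a :: 'n \<Rightarrow> nat. sum a UNIV = 0} = {\<lambda>i. 0}"
      by (auto simp: fun_eq_iff)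
    then show ?thesis
      unfolding homogeneous_poly_def by (intro exI[of _ "\<lambda>a. 1"]) simp
  qed
  then have "openin zariski (nonvanishing {\<lambda>x :: 'a ^ 'n. 1})"
    unfolding openin_zariski by (intro exI[of _ "{\<lambda>x. 1}"]) auto
  moreover have "L \<in> nonvanishing {\<lambda>x. 1}" if "L \<in> proj_space" for L :: "('a ^ 'n) set"
    using that vec.subspace_0[of L] by (auto simp: nonvanishing_def proj_space_def)
  ultimately show "(proj_space :: ('a ^ 'n) set set) \<subseteq> topspace zariski"
    using openin_subset[of zariski "nonvanishing {\<lambda>x :: 'a ^ 'n. 1}"] by auto
qed

lemma closedin_zariski:
  fixes C :: "('a::field ^ 'n) set set"
  shows "closedin zariski C \<longleftrightarrow>
    (\<exists>F. (\<forall>f\<in>F. \<exists>d. homogeneous_poly d f) \<and> C = {L \<in> proj_space. \<forall>f\<in>F. \<forall>x\<in>L. f x = 0})"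
proof -
  have eq: "{L \<in> proj_space. \<forall>f\<in>F. \<forall>x\<in>L. f x = 0} = proj_space - nonvanishing F"
    for F :: "('a ^ 'n \<Rightarrow> 'a) set"
    by (auto simp: nonvanishing_def)
  have "C \<subseteq> proj_space \<and> proj_space - C = nonvanishing F \<longleftrightarrow> C = proj_space - nonvanishing F"
    for F :: "('a ^ 'n \<Rightarrow> 'a) set"
    using nonvanishing_subset[of F] by auto
  then show ?thesis
    unfolding closedin_def topspace_zariski openin_zariski eq by auto
qed

definition irreducible_in :: "'b topology \<Rightarrow> 'b set \<Rightarrow> bool" where
  "irreducible_in T S \<longleftrightarrow> S \<subseteq> topspace T \<and> S \<noteq> {} \<and>
     (\<forall>C D. closedin T C \<longrightarrow> closedin T D \<longrightarrow> S \<subseteq> C \<union> D \<longrightarrow> S \<subseteq> C \<or> S \<subseteq> D)"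

text \<open>
  Krull dimension.  As the supremum is taken in \<^typ>\<open>enat\<close>, the empty space gets the value 0.
\<close>

definition krull_dim :: "'b topology \<Rightarrow> enat" where
  "krull_dim T = Sup {enat k | k.
     \<exists>Z :: nat \<Rightarrow> 'b set. (\<forall>i\<le>k. closedin T (Z i) \<and> irreducible_in T (Z i)) \<and>
       (\<forall>i<k. Z i \<subset> Z (Suc i))}"

definition proj_dim :: "('a::field ^ 'n) set set \<Rightarrow> enat" where
  "proj_dim X = krull_dim (subtopology zariski X)"

definition integral_variety :: "('a::field ^ 'n) set set \<Rightarrow> bool" where
  "integral_variety X \<longleftrightarrow> closedin zariski X \<and> irreducible_in zariski X"

definition nondegenerate :: "('a::field ^ 'n) set set \<Rightarrow> bool" where
  "nondegenerate X \<longleftrightarrow> proj_span X = proj_space"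

text \<open>The rank is infinite for points outside the linear span of \<open>X\<close>.\<close>

definition X_rank :: "('a::field ^ 'n) set set \<Rightarrow> ('a ^ 'n) set \<Rightarrow> enat" where
  "X_rank X P = Inf {enat (card S) | S. finite S \<and> S \<subseteq> X \<and> P \<in> proj_span S}"

definition secant_variety :: "nat \<Rightarrow> ('a::field ^ 'n) set set \<Rightarrow> ('a ^ 'n) set set" where
  "secant_variety s X =
     zariski closure_of (\<Union>ps \<in> {ps. length ps = s \<and> set ps \<subseteq> X}. proj_span (set ps))"

definition generic_rank :: "('a::field ^ 'n) set set \<Rightarrow> nat" where
  "generic_rank X = (LEAST s. secant_variety s X = proj_space)"

text \<open>
  The number \<open>b(Y, v)\<close>; its first argument is the dimension \<open>n\<close> of the target, so that \<open>Y\<close> lies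
  in the projective space of dimension \<open>n + v\<close>.
\<close>

definition secant_index :: "nat \<Rightarrow> ('a::field ^ 'n) set set \<Rightarrow> nat" where
  "secant_index n Y = (LEAST s. enat (n + 1) \<le> proj_dim (secant_variety s Y))"

text \<open>
  The projection from \<open>V\<close> is induced by a surjective linear map with kernel \<open>V\<close>, which is
  unique up to a linear automorphism of the target.
\<close>

definition is_projection_from ::
    "('a::field ^ 'n) set \<Rightarrow> ('a ^ 'n \<Rightarrow> 'a ^ 'm) \<Rightarrow> bool" where
  "is_projection_from V l \<longleftrightarrow>
     Vector_Spaces.linear (*s) (*s) l \<and> surj l \<and> {x. l x = 0} = V"

definition proj_image ::
    "('a::field ^ 'n \<Rightarrow> 'a ^ 'm) \<Rightarrow> ('a ^ 'n) set set \<Rightarrow> ('a ^ 'm) set set" where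
  "proj_image l Y = (\<lambda>L. l ` L) ` Y"

text \<open>
  The Grassmannian of subspaces of dimension \<open>CARD('v)\<close> carries the Zariski topology of the
  Pluecker embedding.  The Pluecker coordinates are the maximal minors of a matrix whose rows form
  a basis of the subspace; they are indexed here by all column selections \<open>'v \<Rightarrow> 'n\<close>, not only the
  increasing ones, which merely adds coordinates that are zero or equal to others up to sign.
\<close>

definition maximal_minors :: "'a::field ^ 'n ^ 'v \<Rightarrow> 'a ^ ('v \<Rightarrow> 'n)" where
  "maximal_minors B = (\<chi> \<sigma>. det (\<chi> i j. B $ i $ \<sigma> j))"

definition pluecker :: "('a::field ^ 'n) set \<Rightarrow> ('a ^ ('v::finite \<Rightarrow> 'n)) set" where
  "pluecker W = vec.span {maximal_minors B | B :: 'a ^ 'n ^ 'v. vec.span (rows B) = W}"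

definition grassmannian :: "'v::finite itself \<Rightarrow> ('a::field ^ 'n) set topology" where
  "grassmannian _ =
     pullback_topology {W. vec.subspace W \<and> vec.dim W = CARD('v)}
       (pluecker :: ('a ^ 'n) set \<Rightarrow> ('a ^ ('v \<Rightarrow> 'n)) set) zariski"

text \<open>
  A subspace of dimension \<open>CARD('v)\<close> has a well-defined Pluecker point: the minors of any
  of its bases are not all zero, and a change of basis multiplies them by a determinant.
\<close>

lemma maximal_minors_mult:
  fixes A :: "'a::field ^ 'v ^ 'v" and B :: "'a ^ 'n ^ 'v"
  shows "maximal_minors (A ** B) = det A *s maximal_minors B"
proof -
  have "(\<chi> i j. (A ** B) $ i $ \<sigma> j) = A ** (\<chi> i j. B $ i $ \<sigma> j)" for \<sigma> :: "'v \<Rightarrow> 'n"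
    by (simp add: matrix_matrix_mult_def vec_eq_iff)
  then show ?thesis
    by (simp add: maximal_minors_def vec_eq_iff det_mul)
qed

lemma maximal_minors_nonzero:
  fixes B :: "'a::field ^ 'n ^ 'v"
  assumes "vec.dim (rows B) = CARD('v)"
  shows "maximal_minors B \<noteq> 0"
proof -
  have indep: "c j = 0" if c: "(\<Sum>i\<in>UNIV. c i *s row i B) = 0" for c j
  proof (rule ccontr)
    assume nz: "c j \<noteq> 0"
    define R where "R = (\<lambda>i. row i B) ` (UNIV - {j})"
    have "c j *s row j B = - (\<Sum>i\<in>UNIV - {j}. c i *s row i B)"
      using c by (simp add: sum.remove[of UNIV j] eq_neg_iff_add_eq_0)
    moreover have "(\<Sum>i\<in>UNIV - {j}. c i *s row i B) \<in> vec.span R"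
      unfolding R_def by (intro vec.span_sum vec.span_scale vec.span_base) auto
    ultimately have "c j *s row j B \<in> vec.span R"
      by (simp add: vec.span_neg)
    then have "inverse (c j) *s (c j *s row j B) \<in> vec.span R"
      by (rule vec.span_scale)
    then have j: "row j B \<in> vec.span R"
      using nz by (simp add: vector_smult_assoc)
    have "rows B \<subseteq> vec.span R"
    proof
      fix x assume "x \<in> rows B"
      then obtain i where i: "x = row i B"
        by (auto simp: rows_def)
      show "x \<in> vec.span R"
      proof (cases "i = j")
        case True
        then show ?thesis using i j by simp
      next
        case False
        then show ?thesis unfolding i R_def by (intro vec.span_base) simp
      qed
    qed
    then have "vec.dim (rows B) \<le> card R"
      by (rule vec.dim_le_card) (simp add: R_def)
    also have "card R \<le> CARD('v) - 1"
      unfolding R_def by (rule order.trans[OF card_image_le]) (simp_all add: card_Diff_singleton)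
    finally show False
      using assms zero_less_card_finite[where 'a = 'v] by linarith
  qed
  then have "\<exists>A :: 'a ^ 'v ^ 'n. B ** A = mat 1"
    unfolding matrix_right_invertible_independent_rows by blast
  then have span: "vec.span (columns B) = UNIV"
    unfolding matrix_right_invertible_span_columns .
  obtain C where C: "C \<subseteq> columns B" "vec.independent C" "columns B \<subseteq> vec.span C"
      "card C = vec.dim (columns B)"
    by (rule vec.basis_exists)
  have C_span: "vec.span C = UNIV"
    using C(3) span vec.span_minimal[of "columns B" "vec.span C"] by auto
  have "vec.dim (columns B) = CARD('v)"
    using span vec.dim_span[of "columns B"] vec_dim_card[where 'a = 'a and 'n = 'v] by simp
  then have "card C = card (UNIV :: 'v set)"
    using C(4) by simp
  moreover have "finite C"
    using C(2) by (rule vec.finiteI_independent)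
  ultimately obtain h where h: "bij_betw h (UNIV :: 'v set) C"
    using finite_same_card_bij[of "UNIV :: 'v set" C] by auto
  have "\<exists>k. h j = column k B" for j
  proof -
    have "h j \<in> columns B"
      using h C(1) by (auto simp: bij_betw_def)
    then show ?thesis
      by (auto simp: columns_def)
  qed
  then obtain \<sigma> where \<sigma>: "\<And>j. h j = column (\<sigma> j) B"
    by metis
  define M where "M = (\<chi> i j. B $ i $ \<sigma> j)"
  have "column j M = h j" for j
    unfolding \<sigma> M_def by (simp add: column_def)
  then have "columns M = C"
    using h by (auto simp: columns_def bij_betw_def)
  then have "\<exists>A. M ** A = mat 1"
    unfolding matrix_right_invertible_span_columns using C_span by simp
  then have "det M \<noteq> 0"
    by (metis invertible_det_nz invertible_right_inverse)
  then have "maximal_minors B $ \<sigma> \<noteq> 0"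
    by (simp add: maximal_minors_def M_def)
  then show ?thesis
    by auto
qed

lemma span_rows_factor:
  fixes B B' :: "'a::field ^ 'n ^ 'v"
  assumes "rows B' \<subseteq> vec.span (rows B)"
  obtains A where "B' = A ** B"
proof -
  have "vec.subspace (range ((*v) (transpose B)))"
    by (intro vec.linear_subspace_image matrix_vector_mul_linear_gen vec.subspace_UNIV)
  moreover have "rows B \<subseteq> range ((*v) (transpose B))"
  proof
    fix x assume "x \<in> rows B"
    then obtain i where "x = row i B"
      by (auto simp: rows_def)
    then have "x = transpose B *v axis i 1"
      by (simp add: vec_eq_iff row_def matrix_vector_mult_def transpose_def axis_def if_distrib
          cong: if_cong del: transpose_matrix_vector)
    then show "x \<in> range ((*v) (transpose B))"
      by simp
  qed
  ultimately have "vec.span (rows B) \<subseteq> range ((*v) (transpose B))"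
    by (rule vec.span_minimal[rotated])
  then have "\<exists>y. row i B' = transpose B *v y" for i
    using assms by (force simp: rows_def)
  then obtain y where y: "\<And>i. row i B' = transpose B *v y i"
    by metis
  have "B' = (\<chi> i. y i) ** B"
  proof -
    have "B' $ i $ j = (\<Sum>k\<in>UNIV. y i $ k * B $ k $ j)" for i j
      using arg_cong[OF y[of i], of "\<lambda>v. v $ j"]
      by (simp add: row_def matrix_vector_mult_def transpose_def mult.commute)
    then show ?thesis
      by (simp add: vec_eq_iff matrix_matrix_mult_def)
  qed
  then show ?thesis
    by (rule that)
qed

lemma pluecker_in_proj_space:
  fixes W :: "('a::field ^ 'n) set"
  assumes "vec.subspace W" "vec.dim W = CARD('v::finite)"
  shows "(pluecker W :: ('a ^ ('v \<Rightarrow> 'n)) set) \<in> proj_space"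
proof -
  obtain C where C: "C \<subseteq> W" "vec.independent C" "W \<subseteq> vec.span C" "card C = vec.dim W"
    by (rule vec.basis_exists)
  have "finite C"
    using C(2) by (rule vec.finiteI_independent)
  then obtain h where h: "bij_betw h (UNIV :: 'v set) C"
    using finite_same_card_bij[of "UNIV :: 'v set" C] C(4) assms(2) by auto
  define B :: "'a ^ 'n ^ 'v" where "B = (\<chi> i. h i)"
  have "row i B = h i" for i
    by (simp add: row_def B_def vec_eq_iff)
  then have "rows B = C"
    using h by (auto simp: rows_def bij_betw_def)
  then have B: "vec.span (rows B) = W"
    using C(1,3) assms(1) vec.span_minimal[of C W] by auto
  then have "vec.dim (rows B) = CARD('v)"
    using assms(2) vec.dim_span[of "rows B"] by simp
  then have nz: "maximal_minors B \<noteq> 0"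
    by (rule maximal_minors_nonzero)
  have "(pluecker W :: ('a ^ ('v \<Rightarrow> 'n)) set) = vec.span {maximal_minors B}"
  proof
    have "maximal_minors B' \<in> vec.span {maximal_minors B}"
      if "vec.span (rows B') = W" for B' :: "'a ^ 'n ^ 'v"
    proof -
      have "rows B' \<subseteq> vec.span (rows B)"
        using that B vec.span_superset by metis
      then obtain A where "B' = A ** B"
        by (rule span_rows_factor)
      then show ?thesis
        by (simp add: maximal_minors_mult vec.span_scale vec.span_base)
    qed
    then show "(pluecker W :: ('a ^ ('v \<Rightarrow> 'n)) set) \<subseteq> vec.span {maximal_minors B}"
      unfolding pluecker_def by (intro vec.span_minimal vec.subspace_span) auto
    show "vec.span {maximal_minors B} \<subseteq> (pluecker W :: ('a ^ ('v \<Rightarrow> 'n)) set)"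
      unfolding pluecker_def using B by (intro vec.span_mono) auto
  qed
  then show ?thesis
    unfolding proj_space_iff vec.span_singleton using nz by (intro exI[of _ "maximal_minors B"] conjI)
qed

lemma openin_grassmannian:
  fixes U :: "('a::field ^ 'n) set set"
  shows "openin (grassmannian TYPE('v::finite)) U \<longleftrightarrow>
    (\<exists>D. openin (zariski :: ('a ^ ('v \<Rightarrow> 'n)) set topology) D \<and>
      U = {W. vec.subspace W \<and> vec.dim W = CARD('v) \<and> pluecker W \<in> D})"
proof -
  have "pluecker -` D \<inter> {W. vec.subspace W \<and> vec.dim W = CARD('v)} =
      {W. vec.subspace W \<and> vec.dim W = CARD('v) \<and> pluecker W \<in> D}"
    for D :: "('a ^ ('v \<Rightarrow> 'n)) set set"
    by blast
  then show ?thesis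
    unfolding grassmannian_def openin_pullback_topology by simp
qed

lemma topspace_grassmannian:
  "topspace (grassmannian TYPE('v::finite)) =
    {W :: ('a::field ^ 'n) set. vec.subspace W \<and> vec.dim W = CARD('v)}"
proof -
  have "(pluecker W :: ('a ^ ('v \<Rightarrow> 'n)) set) \<in> proj_space"
    if "vec.subspace W" "vec.dim W = CARD('v)" for W :: "('a ^ 'n) set"
    using that by (rule pluecker_in_proj_space)
  then show ?thesis
    unfolding grassmannian_def topspace_pullback_topology topspace_zariski by blast
qed

end

theory Submission
  imports Defs
begin

text \<open>
  A set of projective points is studied through the cone of vectors over it, and polynomials
  through the functions they define; nothing is lost, as \<open>K\<close> is infinite.  Let \<open>T\<^sub>s\<close> be the cone
  over the \<open>s\<close>-th secant variety, that is, the closure of the set of sums of \<open>s\<close> vectors lying over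
  \<open>Y\<close>, and let \<open>r = n + v + 1\<close> be the dimension of the ambient vector space.

  Why the rank bounds hold.  By a theorem of Chevalley type, every point of \<open>T\<^sub>s\<close> outside the zeros
  of some form \<open>F\<close> really is a sum of \<open>s\<close> vectors over \<open>Y\<close> (\<open>sumset_contains_open\<close>).  If \<open>l\<close> has
  kernel \<open>V\<close> and \<open>x\<close> is such a sum, then \<open>l x\<close> lies in the span of at most \<open>s\<close> points of the
  projected variety (\<open>X_rank_le\<close>).  So for a point \<open>P\<close> spanned by \<open>l w\<close>, it suffices that the coset
  \<open>w + V\<close>, or a nonzero multiple of it, meets \<open>{x \<in> T\<^sub>s. F x \<noteq> 0}\<close>.

  In part (a), \<open>T\<^sub>s\<close> is the whole space.  If \<open>V\<close> contains a vector \<open>u\<close> with \<open>F u \<noteq> 0\<close>, then \<open>F\<close>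
  vanishes at only finitely many points of the line \<open>u + t w\<close>.

  In part (b), \<open>T\<^sub>s\<close> has dimension \<open>D \<ge> n + 2\<close> as a cone, where \<open>s = b(Y, v)\<close>.  A general \<open>V\<close>
  contains a subspace \<open>N\<close> of dimension \<open>r - D\<close> with \<open>T\<^sub>s \<inter> N = 0\<close>, and a further vector \<open>\<nu>\<close> such that
  \<open>N + K \<nu>\<close> meets \<open>B = {x \<in> T\<^sub>s. F x = 0}\<close> only in \<open>0\<close>; here \<open>r - D + 1 \<le> v\<close> is used.  Then
  \<open>T\<^sub>s + N\<close> is everything, while \<open>B + N\<close> is a closed cone that does not contain \<open>\<nu>\<close> and therefore
  meets the line \<open>w + K \<nu>\<close> in finitely many points only.  Any other point of this line differs by an
  element of \<open>N\<close> from a point of \<open>T\<^sub>s\<close> outside \<open>B\<close>, and that point lies in \<open>w + V\<close>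
  (\<open>general_centers\<close>).  The same \<open>V\<close> serves every \<open>P\<close>.  The condition on \<open>V\<close> is open: suitable
  vectors of \<open>V\<close> depend linearly on the Pluecker coordinates (\<open>vector_from_minors\<close>), and meeting a
  closed cone in \<open>0\<close> only is an open condition on vectors that depend on parameters
  (\<open>param_projection\<close>).

  Dimension.  A closed cone \<open>T\<close> has dimension \<open>D\<close> if some subspace \<open>N\<close> of codimension \<open>D\<close>
  satisfies \<open>T \<inter> N = 0\<close> and \<open>T + N = K\<^sup>r\<close>: this is a linear Noether normalization, since \<open>T\<close> is then
  finite over the quotient by \<open>N\<close>.  To find \<open>N\<close>, keep adjoining vectors outside \<open>T + N\<close>; elimination
  theory, in the form of \<open>elimination\<close>, shows that \<open>T + N\<close> stays closed.  Finiteness bounds the number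
  of linearly independent polynomials of degree at most \<open>k\<close> on \<open>T\<close> by a constant times
  \<open>(k + 1) ^ D\<close>, and this growth makes \<open>D\<close> unique and subadditive under sums of cones, which gives
  the two numerical bounds on \<open>b(Y, v)\<close>.  On an irreducible cone it also shows that a proper closed
  subcone has smaller dimension, so chains of irreducible closed sets are not longer than \<open>D\<close>; chains
  of length \<open>D\<close> are cut out over a flag of subspaces.  Hence \<open>D - 1\<close> is the Krull dimension of the
  projective set (\<open>proj_dim_has_dim\<close>).
\<close>

section \<open>Polynomial functions and their zero sets\<close>

text \<open>
  The generators are kept arbitrary because elimination works over several rings: functions of a
  vector, of a parameter and a vector, and of a vector and some of the coordinates of another one.
\<close>

inductive_set alg :: "('x \<Rightarrow> 'k::comm_ring_1) set \<Rightarrow> ('x \<Rightarrow> 'k) set" for G where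
  alg_const: "(\<lambda>_. c) \<in> alg G"
| alg_gen: "g \<in> G \<Longrightarrow> g \<in> alg G"
| alg_add: "f \<in> alg G \<Longrightarrow> g \<in> alg G \<Longrightarrow> (\<lambda>x. f x + g x) \<in> alg G"
| alg_mult: "f \<in> alg G \<Longrightarrow> g \<in> alg G \<Longrightarrow> (\<lambda>x. f x * g x) \<in> alg G"

lemma alg_uminus: "f \<in> alg G \<Longrightarrow> (\<lambda>x. - f x) \<in> alg G"
  using alg_mult[OF alg_const[of "-1"], of f G] by simp

lemma alg_diff: "f \<in> alg G \<Longrightarrow> g \<in> alg G \<Longrightarrow> (\<lambda>x. f x - g x) \<in> alg G"
  using alg_add[of f G "\<lambda>x. - g x"] alg_uminus[of g G] by simp

lemma alg_sum: "(\<And>i. i \<in> I \<Longrightarrow> f i \<in> alg G) \<Longrightarrow> (\<lambda>x. \<Sum>i\<in>I. f i x) \<in> alg G"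
  by (induction I rule: infinite_finite_induct) (auto intro: alg.intros)

lemma alg_prod: "(\<And>i. i \<in> I \<Longrightarrow> f i \<in> alg G) \<Longrightarrow> (\<lambda>x. \<Prod>i\<in>I. f i x) \<in> alg G"
  by (induction I rule: infinite_finite_induct) (auto intro: alg.intros)

lemma alg_power: "f \<in> alg G \<Longrightarrow> (\<lambda>x. f x ^ n) \<in> alg G"
  by (induction n) (auto intro: alg.intros)

lemma alg_compose:
  assumes "f \<in> alg G" "\<And>g. g \<in> G \<Longrightarrow> (\<lambda>x. g (\<phi> x)) \<in> alg H"
  shows "(\<lambda>x. f (\<phi> x)) \<in> alg H"
  using assms(1) by induction (auto intro: alg.intros assms(2))

lemma alg_mono: "f \<in> alg G \<Longrightarrow> G \<subseteq> H \<Longrightarrow> f \<in> alg H"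
  by (induction rule: alg.induct) (auto intro: alg.intros)

definition zero_closed :: "('x \<Rightarrow> 'k::comm_ring_1) set \<Rightarrow> 'x set \<Rightarrow> bool" where
  "zero_closed R Z \<longleftrightarrow> (\<forall>x. (\<forall>f\<in>R. (\<forall>z\<in>Z. f z = 0) \<longrightarrow> f x = 0) \<longrightarrow> x \<in> Z)"

definition zero_closure :: "('x \<Rightarrow> 'k::comm_ring_1) set \<Rightarrow> 'x set \<Rightarrow> 'x set" where
  "zero_closure R Z = {x. \<forall>f\<in>R. (\<forall>z\<in>Z. f z = 0) \<longrightarrow> f x = 0}"

definition zero_prime :: "('x \<Rightarrow> 'k::comm_ring_1) set \<Rightarrow> 'x set \<Rightarrow> bool" where
  "zero_prime R Z \<longleftrightarrow> Z \<noteq> {} \<and> (\<forall>f\<in>R. \<forall>g\<in>R. (\<forall>z\<in>Z. f z * g z = 0) \<longrightarrow>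
     (\<forall>z\<in>Z. f z = 0) \<or> (\<forall>z\<in>Z. g z = 0))"

lemma zero_closedI: "(\<And>x. x \<notin> Z \<Longrightarrow> \<exists>f\<in>R. (\<forall>z\<in>Z. f z = 0) \<and> f x \<noteq> 0) \<Longrightarrow> zero_closed R Z"
  unfolding zero_closed_def by blast

lemma zero_closedE:
  assumes "zero_closed R Z" "x \<notin> Z"
  obtains f where "f \<in> R" "\<And>z. z \<in> Z \<Longrightarrow> f z = 0" "f x \<noteq> 0"
  using assms unfolding zero_closed_def by blast

lemma zero_closure_superset: "Z \<subseteq> zero_closure R Z"
  unfolding zero_closure_def by blast

lemma zero_closureI: "x \<in> Z \<Longrightarrow> x \<in> zero_closure R Z"
  unfolding zero_closure_def by simp

lemma zero_closure_vanish: "f \<in> R \<Longrightarrow> (\<And>z. z \<in> Z \<Longrightarrow> f z = 0) \<Longrightarrow> x \<in> zero_closure R Z \<Longrightarrow> f x = 0"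
  unfolding zero_closure_def by blast

lemma zero_closed_closure: "zero_closed R (zero_closure R Z)"
  by (rule zero_closedI) (auto simp: zero_closure_def)

lemma zero_closure_minimal: "zero_closed R C \<Longrightarrow> Z \<subseteq> C \<Longrightarrow> zero_closure R Z \<subseteq> C"
  by (auto simp: zero_closure_def elim!: zero_closedE)

lemma zero_closure_eq: "zero_closed R C \<Longrightarrow> zero_closure R C = C"
  using zero_closure_minimal[of R C C] zero_closure_superset[of C R] by auto

lemma zero_closed_Int: "zero_closed R A \<Longrightarrow> zero_closed R B \<Longrightarrow> zero_closed R (A \<inter> B)"
  by (rule zero_closedI) (auto elim!: zero_closedE)

lemma zero_closed_Inter: "(\<And>A. A \<in> \<A> \<Longrightarrow> zero_closed R A) \<Longrightarrow> zero_closed R (\<Inter>\<A>)"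
proof (rule zero_closedI)
  fix x assume A: "\<And>A. A \<in> \<A> \<Longrightarrow> zero_closed R A" and "x \<notin> \<Inter>\<A>"
  then obtain A where "A \<in> \<A>" "x \<notin> A" by blast
  obtain f where "f \<in> R" "\<And>z. z \<in> A \<Longrightarrow> f z = 0" "f x \<noteq> 0"
    by (rule zero_closedE[OF A[OF \<open>A \<in> \<A>\<close>] \<open>x \<notin> A\<close>]) blast
  then show "\<exists>f\<in>R. (\<forall>z\<in>\<Inter>\<A>. f z = 0) \<and> f x \<noteq> 0"
    using \<open>A \<in> \<A>\<close> by (intro bexI[of _ f]) auto
qed

lemma zero_primeD:
  assumes "zero_prime R Z" "f \<in> R" "g \<in> R" "\<And>z. z \<in> Z \<Longrightarrow> f z * g z = 0"
  shows "(\<forall>z\<in>Z. f z = 0) \<or> (\<forall>z\<in>Z. g z = 0)"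
  using assms unfolding zero_prime_def by simp

lemma zero_closure_vanish_iff:
  assumes "f \<in> R"
  shows "(\<forall>z\<in>zero_closure R Z. f z = 0) \<longleftrightarrow> (\<forall>z\<in>Z. f z = 0)"
  using assms zero_closure_superset[of Z R] zero_closure_vanish[of f R Z] by (metis subsetD)

lemma zero_prime_closure:
  assumes "zero_prime R Z" "\<And>f g. f \<in> R \<Longrightarrow> g \<in> R \<Longrightarrow> (\<lambda>x. f x * g x) \<in> R"
  shows "zero_prime R (zero_closure R Z)"
  unfolding zero_prime_def
proof (intro conjI ballI impI)
  show "zero_closure R Z \<noteq> {}"
    using assms(1) zero_closure_superset[of Z R] unfolding zero_prime_def by auto
  fix f g assume "f \<in> R" "g \<in> R" and *: "\<forall>z\<in>zero_closure R Z. f z * g z = 0"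
  have "f z * g z = 0" if "z \<in> Z" for z
    using * that zero_closure_superset[of Z R] by auto
  then have "(\<forall>z\<in>Z. f z = 0) \<or> (\<forall>z\<in>Z. g z = 0)"
    by (rule zero_primeD[OF assms(1) \<open>f \<in> R\<close> \<open>g \<in> R\<close>])
  then show "(\<forall>z\<in>zero_closure R Z. f z = 0) \<or> (\<forall>z\<in>zero_closure R Z. g z = 0)"
    unfolding zero_closure_vanish_iff[OF \<open>f \<in> R\<close>] zero_closure_vanish_iff[OF \<open>g \<in> R\<close>] .
qed

text \<open>
  A finite union of proper closed subsets does not exhaust an irreducible set; this makes several
  leading coefficients nonzero at the same point.
\<close>

lemma zero_prime_prod:
  fixes f :: "'i \<Rightarrow> 'x \<Rightarrow> 'k::idom"
  assumes "zero_prime (alg G) Z" "finite I" "\<And>i. i \<in> I \<Longrightarrow> f i \<in> alg G"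
    "\<And>i. i \<in> I \<Longrightarrow> \<exists>z\<in>Z. f i z \<noteq> 0"
  shows "\<exists>z\<in>Z. (\<Prod>i\<in>I. f i z) \<noteq> 0"
  using assms(2,3,4)
proof (induction I)
  case empty
  then show ?case using assms(1) unfolding zero_prime_def by auto
next
  case (insert i I)
  then have "\<exists>z\<in>Z. (\<Prod>i\<in>I. f i z) \<noteq> 0" "\<exists>z\<in>Z. f i z \<noteq> 0" by auto
  moreover have "f i \<in> alg G" "(\<lambda>z. \<Prod>i\<in>I. f i z) \<in> alg G"
    using insert by (auto intro: alg_prod)
  ultimately have "\<not> (\<forall>z\<in>Z. f i z * (\<Prod>i\<in>I. f i z) = 0)"
    using zero_primeD[OF assms(1), of "f i" "\<lambda>z. \<Prod>i\<in>I. f i z"] by blast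
  then show ?case using insert by simp
qed

text \<open>
  Homogeneous functions of degree \<open>d\<close> in the functions \<open>L\<close>, with coefficients in \<open>R\<close>.  With a
  nonconstant \<open>R\<close> these are forms in one group of variables that depend on parameters; with the
  constant function \<open>1\<close> in \<open>L\<close> they are the polynomials of degree at most \<open>d\<close>.
\<close>

inductive forms :: "('x \<Rightarrow> 'k::comm_ring_1) set \<Rightarrow> ('x \<Rightarrow> 'k) set \<Rightarrow> nat \<Rightarrow> ('x \<Rightarrow> 'k) \<Rightarrow> bool"
  for R L where
  forms_base: "r \<in> R \<Longrightarrow> forms R L 0 r"
| forms_gen: "l \<in> L \<Longrightarrow> forms R L 1 l"
| forms_zero: "forms R L d (\<lambda>_. 0)"
| forms_add: "forms R L d f \<Longrightarrow> forms R L d g \<Longrightarrow> forms R L d (\<lambda>x. f x + g x)"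
| forms_mult: "forms R L d f \<Longrightarrow> forms R L e g \<Longrightarrow> forms R L (d + e) (\<lambda>x. f x * g x)"

lemma forms_sum: "(\<And>i. i \<in> I \<Longrightarrow> forms R L d (f i)) \<Longrightarrow> forms R L d (\<lambda>x. \<Sum>i\<in>I. f i x)"
  by (induction I rule: infinite_finite_induct) (auto intro: forms.intros)

lemma forms_alg: "forms R L d f \<Longrightarrow> R \<subseteq> alg G \<Longrightarrow> L \<subseteq> alg G \<Longrightarrow> f \<in> alg G"
  by (induction rule: forms.induct) (auto intro: alg.intros)

lemma forms_const: "forms (alg G) L 0 (\<lambda>_. c)"
  by (auto intro: forms_base alg_const)

lemma forms_cmult: "forms (alg G) L d f \<Longrightarrow> forms (alg G) L d (\<lambda>x. c * f x)"
  using forms_mult[OF forms_const, of G L d f c] by simp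

lemma forms_power: "forms (alg G) L d f \<Longrightarrow> forms (alg G) L (n * d) (\<lambda>x. f x ^ n)"
proof (induction n)
  case 0 then show ?case using forms_const[of G L 1] by simp
next
  case (Suc n)
  then show ?case using forms_mult[of "alg G" L d f "n*d" "\<lambda>x. f x ^ n"] by simp
qed

lemma forms_prod: "(\<And>i. i \<in> I \<Longrightarrow> forms (alg G) L (d i) (f i)) \<Longrightarrow>
   forms (alg G) L (sum d I) (\<lambda>x. \<Prod>i\<in>I. f i x)"
  by (induction I rule: infinite_finite_induct) (auto intro: forms_const forms_mult)

lemma forms_scale:
  assumes "forms R L d f" "\<And>r. r \<in> R \<Longrightarrow> r y = r x" "\<And>l. l \<in> L \<Longrightarrow> l y = s * l x"
  shows "f y = s ^ d * f x"
  using assms(1)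
proof induction
  case (forms_mult d f e g)
  then show ?case by (simp add: power_add mult_ac)
qed (simp_all add: assms(2,3) distrib_left)

text \<open>
  The components vanish beyond \<open>N\<close>, so that those of a product can be written as a convolution
  without case distinctions on the degrees.
\<close>

lemma alg_graded:
  assumes "f \<in> alg (G \<union> L)"
  obtains N F where "\<And>d. forms (alg G) L d (F d)" "\<And>x. f x = (\<Sum>d\<le>N. F d x)"
    "\<And>d x. d > N \<Longrightarrow> F d x = 0"
proof -
  have "\<exists>N F. (\<forall>d. forms (alg G) L d (F d)) \<and> (\<forall>x. f x = (\<Sum>d\<le>N. F d x)) \<and> (\<forall>d x. d > N \<longrightarrow> F d x = 0)"
    using assms
  proof induction
    case (alg_const c)
    show ?case
      by (rule exI[of _ 0], rule exI[of _ "\<lambda>d x. if d = 0 then c else 0"])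
        (auto intro: forms_const forms_zero simp: fun_eq_iff split: if_splits)
  next
    case (alg_gen g)
    show ?case
    proof (cases "g \<in> L")
      case True
      have "forms (alg G) L d (\<lambda>x. if d = 1 then g x else 0)" for d
        by (cases "d = 1") (use forms_gen[OF True, of "alg G"] forms_zero in auto)
      then show ?thesis
        by (intro exI[of _ 1] exI[of _ "\<lambda>d x. if d = 1 then g x else 0"]) auto
    next
      case False
      then have "g \<in> G" using alg_gen by simp
      have "forms (alg G) L d (\<lambda>x. if d = 0 then g x else 0)" for d
        by (cases "d = 0") (use forms_base[OF alg.alg_gen[OF \<open>g \<in> G\<close>], of L] forms_zero in auto)
      then show ?thesis
        by (intro exI[of _ 0] exI[of _ "\<lambda>d x. if d = 0 then g x else 0"]) auto
    qed
  next
    case (alg_add f g)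
    then obtain N F M H where
      *: "\<And>d. forms (alg G) L d (F d)" "\<And>x. f x = (\<Sum>d\<le>N. F d x)" "\<And>d x. d > N \<Longrightarrow> F d x = 0"
      "\<And>d. forms (alg G) L d (H d)" "\<And>x. g x = (\<Sum>d\<le>M. H d x)" "\<And>d x. d > M \<Longrightarrow> H d x = 0"
      by blast
    have "(\<Sum>d\<le>N. F d x) = (\<Sum>d\<le>max N M. F d x)" "(\<Sum>d\<le>M. H d x) = (\<Sum>d\<le>max N M. H d x)" for x
      by (rule sum.mono_neutral_left; use *(3,6) in auto)+
    then show ?case
      by (intro exI[of _ "max N M"] exI[of _ "\<lambda>d x. F d x + H d x"])
        (use * in \<open>auto intro: forms_add simp: sum.distrib\<close>)
  next
    case (alg_mult f g)
    then obtain N F M H where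
      *: "\<And>d. forms (alg G) L d (F d)" "\<And>x. f x = (\<Sum>d\<le>N. F d x)" "\<And>d x. d > N \<Longrightarrow> F d x = 0"
      "\<And>d. forms (alg G) L d (H d)" "\<And>x. g x = (\<Sum>d\<le>M. H d x)" "\<And>d x. d > M \<Longrightarrow> H d x = 0"
      by blast
    define E where "E d x = (\<Sum>i\<le>d. F i x * H (d - i) x)" for d x
    have 1: "forms (alg G) L d (E d)" for d
      unfolding E_def
    proof (rule forms_sum)
      fix i assume "i \<in> {..d}"
      then show "forms (alg G) L d (\<lambda>x. F i x * H (d - i) x)"
        using forms_mult[OF *(1)[of i] *(4)[of "d - i"]] by simp
    qed
    have 2: "f x * g x = (\<Sum>d\<le>N+M. E d x)" for x
    proof -
      have "f x * g x = (\<Sum>i\<le>N. \<Sum>j\<le>M. F i x * H j x)"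
        by (simp add: *(2,5) sum_product)
      also have "\<dots> = (\<Sum>(i,j)\<in>{..N}\<times>{..M}. F i x * H j x)"
        by (simp add: sum.cartesian_product)
      also have "\<dots> = (\<Sum>(i,j)\<in>{(i,j). i + j \<le> N + M}. F i x * H j x)"
      proof (rule sum.mono_neutral_left)
        show "finite {(i,j). i + j \<le> N + M}"
          by (rule finite_subset[of _ "{..N+M}\<times>{..N+M}"]) auto
        show "\<forall>z\<in>{(i,j). i + j \<le> N + M} - {..N} \<times> {..M}. (case z of (i, j) \<Rightarrow> F i x * H j x) = 0"
        proof
          fix z assume "z \<in> {(i,j). i + j \<le> N + M} - {..N} \<times> {..M}"
          then have "fst z > N \<or> snd z > M" by (cases z) auto
          then show "(case z of (i, j) \<Rightarrow> F i x * H j x) = 0"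
            using *(3)[of "fst z" x] *(6)[of "snd z" x] by (cases z) auto
        qed
      qed auto
      also have "\<dots> = (\<Sum>d\<le>N+M. E d x)"
        unfolding E_def by (rule sum.triangle_reindex_eq)
      finally show ?thesis .
    qed
    have 3: "E d x = 0" if "d > N + M" for d x
      unfolding E_def
    proof (rule sum.neutral, rule ballI)
      fix i assume "i \<in> {..d}"
      show "F i x * H (d - i) x = 0"
        using that *(3)[of i x] *(6)[of "d - i" x] by (cases "i > N") auto
    qed
    show ?case
      by (intro exI[of _ "N+M"] exI[of _ E]) (use 1 2 3 in auto)
  qed
  then show ?thesis using that by blast
qed

section \<open>Elimination of one variable\<close>

text \<open>
  Polynomials in one variable whose coefficients are functions from \<open>R\<close>, of uniformly bounded degree.
\<close>

definition polyover :: "('x \<Rightarrow> 'k::comm_ring_1) set \<Rightarrow> ('x \<Rightarrow> 'k poly) set" where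
  "polyover R = {P. (\<forall>i. (\<lambda>x. coeff (P x) i) \<in> R) \<and> (\<exists>N. \<forall>x. degree (P x) \<le> N)}"

lemma polyover_coeff: "P \<in> polyover R \<Longrightarrow> (\<lambda>x. coeff (P x) i) \<in> R"
  unfolding polyover_def by auto

lemma polyover_add: "P \<in> polyover (alg G) \<Longrightarrow> Q \<in> polyover (alg G) \<Longrightarrow> (\<lambda>x. P x + Q x) \<in> polyover (alg G)"
  unfolding polyover_def
proof (safe, goal_cases)
  case (1 i N M) then show ?case by (auto intro: alg_add)
next
  case (2 N M)
  then have "degree (P x + Q x) \<le> max N M" for x
    by (intro degree_add_le) (auto intro: le_trans)
  then show ?case by blast
qed

lemma polyover_mult: 
  assumes "P \<in> polyover (alg G)" "Q \<in> polyover (alg G)"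
  shows "(\<lambda>x. P x * Q x) \<in> polyover (alg G)"
proof -
  obtain N M where "\<And>x. degree (P x) \<le> N" "\<And>x. degree (Q x) \<le> M"
    using assms unfolding polyover_def by auto
  then have "degree (P x * Q x) \<le> N + M" for x
    by (meson add_mono degree_mult_le le_trans)
  moreover have "(\<lambda>x. coeff (P x * Q x) i) \<in> alg G" for i
    unfolding coeff_mult by (intro alg_sum alg_mult polyover_coeff assms)
  ultimately show ?thesis unfolding polyover_def by auto
qed

lemma polyover_pCons: "f \<in> alg G \<Longrightarrow> P \<in> polyover (alg G) \<Longrightarrow> (\<lambda>x. pCons (f x) (P x)) \<in> polyover (alg G)"
  unfolding polyover_def 
proof (safe, goal_cases)
  case (1 N i) then show ?case by (cases i) auto
next
  case (2 N) then show ?case by (intro exI[of _ "Suc N"]) (auto intro: le_trans[OF degree_pCons_le])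
qed

lemma polyover_const: "(\<lambda>x. p) \<in> polyover (alg G)"
  unfolding polyover_def by (auto intro: alg_const)

lemma polyover_coeff_const: "f \<in> alg G \<Longrightarrow> (\<lambda>x. [:f x:]) \<in> polyover (alg G)"
  using polyover_pCons[OF _ polyover_const[of 0]] by auto

text \<open>
  Along a curve on which every generator is a polynomial in the curve parameter, the same is true of
  every function of the algebra.
\<close>

lemma alg_subst_polyover:
  assumes "f \<in> alg G"
    and "\<And>g. g \<in> G \<Longrightarrow> \<exists>P\<in>polyover (alg H). \<forall>x t. poly (P x) t = g (\<tau> x t)"
  shows "\<exists>P\<in>polyover (alg H). \<forall>x t. poly (P x) t = f (\<tau> x t)"
  using assms(1)
proof induction
  case (alg_const c)
  show ?case by (rule bexI[of _ "\<lambda>_. [:c:]"]) (auto intro: polyover_const)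
next
  case (alg_gen g)
  then show ?case by (rule assms(2))
next
  case (alg_add f g)
  then obtain P Q where "P \<in> polyover (alg H)" "Q \<in> polyover (alg H)"
    "\<forall>x t. poly (P x) t = f (\<tau> x t)" "\<forall>x t. poly (Q x) t = g (\<tau> x t)" by blast
  then show ?case
    by (intro bexI[of _ "\<lambda>x. P x + Q x"]) (auto intro: polyover_add)
next
  case (alg_mult f g)
  then obtain P Q where "P \<in> polyover (alg H)" "Q \<in> polyover (alg H)"
    "\<forall>x t. poly (P x) t = f (\<tau> x t)" "\<forall>x t. poly (Q x) t = g (\<tau> x t)" by blast
  then show ?case
    by (intro bexI[of _ "\<lambda>x. P x * Q x"]) (auto intro: polyover_mult)
qed

lemma coeff_mult_top:
  fixes P Q :: "'k::comm_ring_1 poly"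
  assumes "degree P \<le> d" "degree Q \<le> e"
  shows "coeff (P * Q) (d + e) = coeff P d * coeff Q e"
proof -
  have "coeff (P * Q) (d + e) = (\<Sum>i\<le>d+e. coeff P i * coeff Q (d + e - i))"
    by (simp add: coeff_mult)
  also have "\<dots> = (\<Sum>i\<in>{d}. coeff P i * coeff Q (d + e - i))"
  proof (rule sum.mono_neutral_right)
    show "\<forall>i\<in>{..d + e} - {d}. coeff P i * coeff Q (d + e - i) = 0"
    proof
      fix i assume "i \<in> {..d + e} - {d}"
      then have "i > d \<or> d + e - i > e" by auto
      then show "coeff P i * coeff Q (d + e - i) = 0"
        using assms by (auto simp: coeff_eq_0)
    qed
  qed auto
  finally show ?thesis by simp
qed

text \<open>
  Restricted to the line through \<open>x\<close> with direction \<open>\<delta> x\<close>, a form of degree \<open>d\<close> is a polynomial of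
  degree at most \<open>d\<close> whose coefficient at \<open>t ^ d\<close> is the value of the form at the direction.  So a
  form that does not vanish at the direction gives an equation with invertible leading coefficient.
\<close>

lemma forms_along_line:
  assumes "forms R L d f"
    and R: "\<And>r x t. r \<in> R \<Longrightarrow> r \<in> alg H \<and> r (\<tau> x t) = r x \<and> r (\<delta> x) = r x"
    and L: "\<And>l x t. l \<in> L \<Longrightarrow> l \<in> alg H \<and> (\<lambda>x. l (\<delta> x)) \<in> alg H \<and> l (\<tau> x t) = l x + t * l (\<delta> x)"
  shows "\<exists>P\<in>polyover (alg H). \<forall>x. degree (P x) \<le> d \<and> coeff (P x) d = f (\<delta> x) \<and> (\<forall>t. poly (P x) t = f (\<tau> x t))"
  using assms(1)
proof induction
  case (forms_base r)
  then show ?case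
    by (intro bexI[of _ "\<lambda>x. [:r x:]"]) (use R[OF forms_base] in \<open>auto intro: polyover_coeff_const\<close>)
next
  case (forms_gen l)
  have "(\<lambda>x. [:l x, l (\<delta> x):]) \<in> polyover (alg H)"
    using L[OF forms_gen] by (intro polyover_pCons polyover_const) auto
  then show ?case
    by (rule bexI[rotated]) (use L[OF forms_gen] in \<open>auto\<close>)
next
  case (forms_zero d)
  show ?case by (rule bexI[of _ "\<lambda>_. 0"]) (auto intro: polyover_const)
next
  case (forms_add d f g)
  then obtain P Q where *: "P \<in> polyover (alg H)" "Q \<in> polyover (alg H)"
    "\<forall>x. degree (P x) \<le> d \<and> coeff (P x) d = f (\<delta> x) \<and> (\<forall>t. poly (P x) t = f (\<tau> x t))"
    "\<forall>x. degree (Q x) \<le> d \<and> coeff (Q x) d = g (\<delta> x) \<and> (\<forall>t. poly (Q x) t = g (\<tau> x t))" by blast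
  show ?case
    by (intro bexI[of _ "\<lambda>x. P x + Q x"]) (use * in \<open>auto intro: polyover_add degree_add_le\<close>)
next
  case (forms_mult d f e g)
  then obtain P Q where *: "P \<in> polyover (alg H)" "Q \<in> polyover (alg H)"
    "\<And>x. degree (P x) \<le> d \<and> coeff (P x) d = f (\<delta> x) \<and> (\<forall>t. poly (P x) t = f (\<tau> x t))"
    "\<And>x. degree (Q x) \<le> e \<and> coeff (Q x) e = g (\<delta> x) \<and> (\<forall>t. poly (Q x) t = g (\<tau> x t))" by blast
  show ?case
  proof (intro bexI[of _ "\<lambda>x. P x * Q x"] allI conjI)
    show "(\<lambda>x. P x * Q x) \<in> polyover (alg H)" using * by (auto intro: polyover_mult)
    fix x
    show "degree (P x * Q x) \<le> d + e"
      using *(3,4)[of x] degree_mult_le[of "P x" "Q x"] by linarith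
    show "coeff (P x * Q x) (d + e) = f (\<delta> x) * g (\<delta> x)"
      using *(3,4)[of x] by (simp add: coeff_mult_top)
  qed (use *(3,4) in auto)
qed

text \<open>
  A substitute for the resultant that avoids determinants.  Euclid's algorithm lowers the degree of
  \<open>g\<close> while it is at least that of \<open>f\<close>.  Afterwards the lowest coefficients are cancelled instead of
  the leading ones, and the factor \<open>t\<close> is divided out of \<open>f\<close>: at \<open>x0\<close> the polynomial \<open>g\<close> is a nonzero
  constant, so this keeps the leading coefficient of \<open>f\<close> nonzero there, and it loses no common root.
\<close>

lemma eliminate_pair:
  fixes f g :: "'x \<Rightarrow> 'k::idom poly"
  assumes "\<And>i. (\<lambda>x. coeff (f x) i) \<in> alg G" "\<And>i. (\<lambda>x. coeff (g x) i) \<in> alg G"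
    "\<And>x. degree (f x) \<le> e" "\<And>x. degree (g x) \<le> N"
    "coeff (f x0) e \<noteq> 0" "g x0 = [:c:]" "c \<noteq> 0"
  shows "\<exists>h\<in>alg G. h x0 \<noteq> 0 \<and> (\<forall>x t. poly (f x) t = 0 \<longrightarrow> poly (g x) t = 0 \<longrightarrow> h x = 0)"
  using assms
proof (induction "e + N" arbitrary: e N f g c rule: less_induct)
  case less
  note f = less.prems(1) and g = less.prems(2) and df = less.prems(3) and dg = less.prems(4)
  consider "e = 0" | "e > 0" "N < e" | "e > 0" "N \<ge> e" by linarith
  then show ?case
  proof cases
    case 1
    have "f x = [:coeff (f x) 0:]" for x
      using df[of x] 1 by (metis degree_0_id le_zero_eq)
    then have "poly (f x) t = coeff (f x) 0" for x t
      by (metis mult_zero_right poly_0 poly_pCons add.right_neutral)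
    then show ?thesis
      using f[of 0] less.prems(5) 1 by (intro bexI[of _ "\<lambda>x. coeff (f x) 0"]) auto
  next
    case 2
    \<comment> \<open>The constant terms cancel, and the shift divides by the variable.\<close>
    define f' where "f' x = poly_shift 1 (smult (coeff (g x) 0) (f x) - smult (coeff (f x) 0) (g x))" for x
    have *: "smult (coeff (g x) 0) (f x) - smult (coeff (f x) 0) (g x) = pCons 0 (f' x)" for x
      unfolding f'_def by (rule poly_eqI) (auto simp: coeff_poly_shift coeff_pCons split: nat.split)
    have cf': "coeff (f' x) i = coeff (g x) 0 * coeff (f x) (Suc i) - coeff (f x) 0 * coeff (g x) (Suc i)" for x i
      by (simp add: f'_def coeff_poly_shift)
    have "\<exists>h\<in>alg G. h x0 \<noteq> 0 \<and> (\<forall>x t. poly (f' x) t = 0 \<longrightarrow> poly (g x) t = 0 \<longrightarrow> h x = 0)"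
    proof (rule less.hyps[of "e - 1" N f' g c])
      show "(\<lambda>x. coeff (f' x) i) \<in> alg G" for i
        unfolding cf' by (intro alg_diff alg_mult f g)
      show "degree (f' x) \<le> e - 1" for x
      proof (rule degree_le, safe)
        fix i assume "e - 1 < i"
        then have "coeff (f x) (Suc i) = 0" "coeff (g x) (Suc i) = 0"
          using df[of x] dg[of x] 2 by (auto intro!: coeff_eq_0)
        then show "coeff (f' x) i = 0" by (simp add: cf')
      qed
      have "coeff (g x0) e = 0" "coeff (g x0) 0 = c"
        using less.prems(6) 2 by (auto simp: coeff_pCons split: nat.split)
      then show "coeff (f' x0) (e - 1) \<noteq> 0"
        using less.prems 2 by (simp add: cf')
    qed (use 2 less.prems in auto)
    then obtain h where h: "h \<in> alg G" "h x0 \<noteq> 0"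
      "\<And>x t. poly (f' x) t = 0 \<Longrightarrow> poly (g x) t = 0 \<Longrightarrow> h x = 0" by blast
    have "h x = 0" if "poly (f x) t = 0" "poly (g x) t = 0" for x t
    proof (rule h(3)[OF _ that(2)])
      have "poly (pCons 0 (f' x)) t = 0"
        using that unfolding *[symmetric] by simp
      \<comment> \<open>At the root \<open>0\<close> both constant terms vanish, and with them all of \<open>f'\<close>.\<close>
      moreover have "f' x = 0" if "t = 0"
      proof -
        have "coeff (f x) 0 = 0" "coeff (g x) 0 = 0"
          using that \<open>poly (f x) t = 0\<close> \<open>poly (g x) t = 0\<close> by (auto simp: poly_0_coeff_0)
        then show ?thesis by (simp add: f'_def)
      qed
      ultimately show "poly (f' x) t = 0" by (cases "t = 0") auto
    qed
    then show ?thesis using h by blast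
  next
    case 3
    define g' where "g' x = smult (coeff (f x) e) (g x) - smult (coeff (g x) N) (monom 1 (N - e) * f x)" for x
    have cg': "coeff (g' x) i = coeff (f x) e * coeff (g x) i - coeff (g x) N * (if i < N - e then 0 else coeff (f x) (i - (N - e)))" for x i
      by (simp add: g'_def coeff_monom_mult)
    have "\<exists>h\<in>alg G. h x0 \<noteq> 0 \<and> (\<forall>x t. poly (f x) t = 0 \<longrightarrow> poly (g' x) t = 0 \<longrightarrow> h x = 0)"
    proof (rule less.hyps[of e "N - 1" f g' "coeff (f x0) e * c"])
      show "(\<lambda>x. coeff (g' x) i) \<in> alg G" for i
        unfolding cg' by (cases "i < N - e") (auto intro!: alg_diff alg_mult f g alg_const)
      show "degree (g' x) \<le> N - 1" for x
      proof (rule degree_le, safe)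
        fix i assume "N - 1 < i"
        then consider "i = N" | "i > N" by linarith
        then show "coeff (g' x) i = 0"
        proof cases
          case 1
          then show ?thesis using 3 by (simp add: cg')
        next
          case 2
          then have "coeff (f x) (i - (N - e)) = 0" "coeff (g x) i = 0"
            using df[of x] dg[of x] 3 by (auto intro!: coeff_eq_0)
          then show ?thesis by (simp add: cg')
        qed
      qed
      have "coeff (g x0) N = 0"
        using less.prems(6) 3 by (auto simp: coeff_pCons split: nat.split)
      then show "g' x0 = [:coeff (f x0) e * c:]"
        by (simp add: g'_def less.prems(6))
    qed (use 3 less.prems in auto)
    then obtain h where h: "h \<in> alg G" "h x0 \<noteq> 0"
      "\<And>x t. poly (f x) t = 0 \<Longrightarrow> poly (g' x) t = 0 \<Longrightarrow> h x = 0" by blast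
    have "h x = 0" if "poly (f x) t = 0" "poly (g x) t = 0" for x t
      by (rule h(3)[OF that(1)]) (simp add: g'_def that)
    then show ?thesis using h by blast
  qed
qed

lemma poly_ideal_no_root:
  fixes J :: "'k::alg_closed_field poly set"
  assumes "\<And>p q. p \<in> J \<Longrightarrow> q \<in> J \<Longrightarrow> p + q \<in> J" "\<And>p q. p \<in> J \<Longrightarrow> q * p \<in> J"
    and "\<And>t. \<exists>p\<in>J. poly p t \<noteq> 0"
  obtains c where "c \<noteq> 0" "[:c:] \<in> J"
proof -
  have "\<exists>p. p \<in> J \<and> p \<noteq> 0" using assms(3)[of 0] by auto
  then obtain p where p: "p \<in> J" "p \<noteq> 0" and min: "\<And>q. q \<in> J \<Longrightarrow> q \<noteq> 0 \<Longrightarrow> degree p \<le> degree q"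
    using ex_has_least_nat[of "\<lambda>p. p \<in> J \<and> p \<noteq> 0" _ degree] by blast
  have dv: "p dvd q" if "q \<in> J" for q
  proof (rule ccontr)
    assume "\<not> p dvd q"
    then have "q mod p \<noteq> 0" by (simp add: dvd_eq_mod_eq_0)
    have "q mod p = q + (- (q div p)) * p"
      by (simp add: minus_div_mult_eq_mod[symmetric])
    then have "q mod p \<in> J" using assms(1,2) that p by metis
    then show False
      using min[of "q mod p"] degree_mod_less[OF p(2), of q] \<open>q mod p \<noteq> 0\<close> by auto
  qed
  have "degree p = 0"
  proof (rule ccontr)
    assume "degree p \<noteq> 0"
    then obtain t where "poly p t = 0" using alg_closed_imp_poly_has_root[of p] by auto
    then have "poly q t = 0" if "q \<in> J" for q
      using dv[OF that] by (auto elim!: dvdE)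
    then show False using assms(3)[of t] by blast
  qed
  then obtain c where "p = [:c:]" by (metis degree_0_id)
  then show ?thesis using p that by auto
qed

text \<open>
  A projection along one variable is closed wherever an equation of the set has an invertible leading
  coefficient.  If the polynomials vanishing on \<open>S\<close> had no common root over \<open>x0\<close>, their values at
  \<open>x0\<close> would form the unit ideal of \<open>K[t]\<close>.  One of them would then be a nonzero constant at \<open>x0\<close>,
  and eliminating \<open>t\<close> between it and the equation \<open>f\<close> would give a function that vanishes on the
  projection but not at \<open>x0\<close>.
\<close>

lemma elimination:
  fixes S :: "('x \<times> 'k::alg_closed_field) set"
  assumes f: "f \<in> polyover (alg G)" "\<And>x. degree (f x) \<le> e" "\<And>x t. (x,t) \<in> S \<Longrightarrow> poly (f x) t = 0"
    and lead: "coeff (f x0) e \<noteq> 0"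
    and closure: "\<And>h. h \<in> alg G \<Longrightarrow> (\<And>x t. (x,t) \<in> S \<Longrightarrow> h x = 0) \<Longrightarrow> h x0 = 0"
  shows "\<exists>t0. \<forall>P\<in>polyover (alg G). (\<forall>(x,t)\<in>S. poly (P x) t = 0) \<longrightarrow> poly (P x0) t0 = 0"
proof (rule ccontr)
  assume no: "\<not> ?thesis"
  define I where "I = {P \<in> polyover (alg G). \<forall>(x,t)\<in>S. poly (P x) t = 0}"
  obtain c where c: "c \<noteq> 0" "[:c:] \<in> (\<lambda>P. P x0) ` I"
  proof (rule poly_ideal_no_root[of "(\<lambda>P. P x0) ` I"])
    fix p q assume "p \<in> (\<lambda>P. P x0) ` I" "q \<in> (\<lambda>P. P x0) ` I"
    then obtain P Q where "P \<in> I" "Q \<in> I" "p = P x0" "q = Q x0" by blast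
    then show "p + q \<in> (\<lambda>P. P x0) ` I"
      by (intro image_eqI[of _ _ "\<lambda>x. P x + Q x"]) (fastforce simp: I_def intro: polyover_add)+
  next
    fix p q assume "p \<in> (\<lambda>P. P x0) ` I"
    then obtain P where "P \<in> I" "p = P x0" by blast
    then show "q * p \<in> (\<lambda>P. P x0) ` I"
      by (intro image_eqI[of _ _ "\<lambda>x. q * P x"]) (fastforce simp: I_def intro: polyover_mult polyover_const)+
  next
    fix t show "\<exists>p\<in>(\<lambda>P. P x0) ` I. poly p t \<noteq> 0"
      using no unfolding I_def by blast
  qed
  then obtain g where g: "g \<in> I" "g x0 = [:c:]" by auto
  then obtain N where N: "\<And>x. degree (g x) \<le> N" unfolding I_def polyover_def by blast
  have "\<exists>h\<in>alg G. h x0 \<noteq> 0 \<and> (\<forall>x t. poly (f x) t = 0 \<longrightarrow> poly (g x) t = 0 \<longrightarrow> h x = 0)"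
    by (rule eliminate_pair[where e=e and N=N and c=c])
      (use f g N lead c in \<open>auto simp: I_def intro: polyover_coeff\<close>)
  then obtain h where h: "h \<in> alg G" "h x0 \<noteq> 0"
     "\<And>x t. poly (f x) t = 0 \<Longrightarrow> poly (g x) t = 0 \<Longrightarrow> h x = 0" by blast
  have "h x0 = 0"
  proof (rule closure[OF h(1)])
    fix x t assume "(x,t) \<in> S"
    then show "h x = 0" using h(3)[of x t] f(3)[of x t] g(1) unfolding I_def by auto
  qed
  with h(2) show False by simp
qed

section \<open>Closed cones and projections along vectors\<close>

definition coords :: "('k::field ^ 'r \<Rightarrow> 'k) set" where
  "coords = range (\<lambda>i x. x $ i)"

abbreviation zclosed :: "('k::field ^ 'r) set \<Rightarrow> bool" where
  "zclosed \<equiv> zero_closed (alg coords)"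

abbreviation zclosure :: "('k::field ^ 'r) set \<Rightarrow> ('k ^ 'r) set" where
  "zclosure \<equiv> zero_closure (alg coords)"

abbreviation zprime :: "('k::field ^ 'r) set \<Rightarrow> bool" where
  "zprime \<equiv> zero_prime (alg coords)"

abbreviation is_form :: "nat \<Rightarrow> ('k::field ^ 'r \<Rightarrow> 'k) \<Rightarrow> bool" where
  "is_form \<equiv> forms (alg {}) coords"

lemma coords_cases:
  assumes "g \<in> coords"
  obtains i where "g = (\<lambda>x. x $ i)"
  using assms by (auto simp: coords_def)

lemma coords_alg: "(\<lambda>x. x $ i) \<in> alg coords"
  by (rule alg_gen) (auto simp: coords_def)

definition is_cone :: "('k::field ^ 'r) set \<Rightarrow> bool" where
  "is_cone T \<longleftrightarrow> 0 \<in> T \<and> (\<forall>x\<in>T. \<forall>c. c *s x \<in> T)"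

lemma cone_0: "is_cone T \<Longrightarrow> 0 \<in> T"
  by (simp add: is_cone_def)

lemma cone_scale: "is_cone T \<Longrightarrow> x \<in> T \<Longrightarrow> c *s x \<in> T"
  by (simp add: is_cone_def)

lemma polynomial_coeffs_zero:
  fixes c :: "nat \<Rightarrow> 'k::field_char_0"
  assumes "\<And>s. (\<Sum>d\<le>N. s ^ d * c d) = 0" "d \<le> N"
  shows "c d = 0"
proof -
  define P where "P = (\<Sum>d\<le>N. monom (c d) d)"
  have "poly P s = 0" for s
    using assms(1)[of s] by (simp add: P_def poly_sum poly_monom mult.commute)
  then have "P = 0" using poly_all_0_iff_0 by blast
  then have "coeff P d = 0" by simp
  then show ?thesis using assms(2) by (simp add: P_def coeff_sum)
qed

lemma alg_empty_const: "r \<in> alg {} \<Longrightarrow> r x = r y"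
  by (induction rule: alg.induct) auto

lemma form_scale:
  assumes "is_form d F"
  shows "F (s *s x) = s ^ d * F x"
  by (rule forms_scale[OF assms]) (auto elim!: coords_cases intro: alg_empty_const)

lemma cone_components_vanish:
  fixes F :: "nat \<Rightarrow> 'k::field_char_0 ^ 'r \<Rightarrow> 'k"
  assumes "is_cone T" "\<And>d. is_form d (F d)" "\<And>x. x \<in> T \<Longrightarrow> (\<Sum>d\<le>N. F d x) = 0" "x \<in> T" "d \<le> N"
  shows "F d x = 0"
proof (rule polynomial_coeffs_zero[where c = "\<lambda>d. F d x"])
  fix s show "(\<Sum>d\<le>N. s ^ d * F d x) = 0"
    using assms(3)[OF cone_scale[OF assms(1,4)], of s] by (simp add: form_scale[OF assms(2)])
qed (rule assms(5))

text \<open>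
  A cone contains with each point the line through it, so the homogeneous components of a polynomial
  that vanishes on the cone vanish there too.
\<close>

lemma cone_separating_form:
  fixes T :: "('k::field_char_0 ^ 'r) set"
  assumes "zclosed T" "is_cone T" "v \<notin> T"
  obtains d F where "is_form d F" "\<And>x. x \<in> T \<Longrightarrow> F x = 0" "F v \<noteq> 0"
proof -
  obtain f where f: "f \<in> alg coords" "\<And>z. z \<in> T \<Longrightarrow> f z = 0" "f v \<noteq> 0"
    using zero_closedE[OF assms(1,3)] by blast
  from f(1) have "f \<in> alg ({} \<union> coords)" by simp
  then obtain N F where F: "\<And>d. is_form d (F d)" "\<And>x. f x = (\<Sum>d\<le>N. F d x)"
    using alg_graded[of f "{}" coords] by metis
  obtain d where "d \<le> N" "F d v \<noteq> 0"
    using f(3) F(2)[of v] by (metis atMost_iff sum.neutral)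
  moreover have "F d x = 0" if "x \<in> T" for x
    by (rule cone_components_vanish[OF assms(2) F(1) _ that \<open>d \<le> N\<close>]) (use F(2) f(2) in metis)
  ultimately show ?thesis using that F(1) by blast
qed

lemma cone_closure:
  fixes T :: "('k::field_char_0 ^ 'r) set"
  assumes "is_cone T"
  shows "is_cone (zclosure T)"
  unfolding is_cone_def
proof (intro conjI ballI allI)
  show "0 \<in> zclosure T"
    using assms zero_closure_superset[of T "alg coords"] by (auto simp: is_cone_def)
  fix x c assume x: "x \<in> zclosure T"
  show "c *s x \<in> zclosure T"
    unfolding zero_closure_def
  proof (safe)
    fix f assume f: "f \<in> alg coords" "\<forall>z\<in>T. f z = 0"
    have "(\<lambda>x. f (c *s x)) \<in> alg coords"
      by (rule alg_compose[OF f(1)]) (auto elim!: coords_cases intro!: alg_mult alg_const coords_alg)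
    then show "f (c *s x) = 0"
      using zero_closure_vanish[OF _ _ x, of "\<lambda>x. f (c *s x)"] f(2) cone_scale[OF assms] by blast
  qed
qed

text \<open>
  The sum of \<open>T\<close> and the span of the list.  The recursion over the list is the one used in proofs,
  where vectors are adjoined one at a time.
\<close>

fun add_span :: "('k::field ^ 'r) set \<Rightarrow> ('k ^ 'r) list \<Rightarrow> ('k ^ 'r) set" where
  "add_span T [] = T"
| "add_span T (v # vs) = {x. \<exists>t. x - t *s v \<in> add_span T vs}"

text \<open>
  The list is linearly independent and its span meets the cone \<open>T\<close> only in \<open>0\<close>.  In other words, \<open>T\<close>
  can be projected along each vector in turn, as the vector avoids the image of \<open>T\<close> obtained so far.
\<close>

fun indep_of :: "('k::field ^ 'r) set \<Rightarrow> ('k ^ 'r) list \<Rightarrow> bool" where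
  "indep_of T [] \<longleftrightarrow> True"
| "indep_of T (v # vs) \<longleftrightarrow> v \<notin> add_span T vs \<and> indep_of T vs"

lemma add_span_iff: "x \<in> add_span T vs \<longleftrightarrow> (\<exists>y\<in>T. x - y \<in> vec.span (set vs))"
proof (induction vs arbitrary: x)
  case (Cons v vs)
  have "x \<in> add_span T (v # vs) \<longleftrightarrow> (\<exists>y\<in>T. \<exists>t. x - y - t *s v \<in> vec.span (set vs))"
    by (auto simp: Cons algebra_simps)
  then show ?case by (simp add: vec.span_breakdown_eq)
qed auto

lemma span_subset_add_span: "0 \<in> T \<Longrightarrow> vec.span (set vs) \<subseteq> add_span T vs"
  by (auto simp: add_span_iff intro!: bexI[of _ 0])

lemma add_span_mono: "T \<subseteq> T' \<Longrightarrow> add_span T vs \<subseteq> add_span T' vs"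
  by (fastforce simp: add_span_iff)

lemma indep_of_mono: "T \<subseteq> T' \<Longrightarrow> indep_of T' vs \<Longrightarrow> indep_of T vs"
  by (induction vs) (auto dest: add_span_mono)

lemma cone_add_span: "is_cone T \<Longrightarrow> is_cone (add_span T vs)"
proof (induction vs)
  case (Cons v vs)
  then have c: "is_cone (add_span T vs)" by simp
  show ?case
    unfolding is_cone_def
  proof (intro conjI ballI allI)
    show "0 \<in> add_span T (v # vs)" using cone_0[OF c] by (auto intro!: exI[of _ 0])
    fix x c' assume "x \<in> add_span T (v # vs)"
    then obtain t where "x - t *s v \<in> add_span T vs" by auto
    from cone_scale[OF c this, of c'] show "c' *s x \<in> add_span T (v # vs)"
      by (auto intro!: exI[of _ "c' * t"] simp: vec.scale_right_diff_distrib)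
  qed
qed simp

lemma indep_of_independent:
  assumes "indep_of T vs" "0 \<in> T"
  shows "vec.independent (set vs) \<and> distinct vs"
  using assms
proof (induction vs)
  case (Cons v vs)
  then have "v \<notin> vec.span (set vs)" using span_subset_add_span[OF Cons.prems(2)] by auto
  then show ?case using Cons vec.span_base[of v "set vs"] by (auto simp: vec.independent_insert)
qed (auto simp: vec.independent_empty)

lemma indep_of_length:
  fixes T :: "('k::field ^ 'r) set"
  assumes "indep_of T vs" "0 \<in> T"
  shows "length vs \<le> CARD('r)" "vec.dim (set vs) = length vs"
proof -
  have *: "vec.independent (set vs)" "distinct vs" using indep_of_independent[OF assms] by auto
  then show "vec.dim (set vs) = length vs"
    using vec.dim_eq_card_independent distinct_card by metis
  then show "length vs \<le> CARD('r)"
    using vec.dim_subset_UNIV[of "set vs"] by (simp add: vec.dimension_def card_cart_basis)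
qed

definition base_coords :: "(('k::field ^ 'p) \<times> ('k ^ 'r) \<Rightarrow> 'k) set" where
  "base_coords = range (\<lambda>i y. fst y $ i)"

definition fibre_coords :: "(('k::field ^ 'p) \<times> ('k ^ 'r) \<Rightarrow> 'k) set" where
  "fibre_coords = range (\<lambda>i y. snd y $ i)"

lemma base_alg: "f \<in> alg coords \<Longrightarrow> (\<lambda>y. f (fst y)) \<in> alg base_coords"
  by (rule alg_compose) (auto simp: coords_def base_coords_def intro: alg_gen)

lemma fibre_alg: "f \<in> alg coords \<Longrightarrow> (\<lambda>y. f (snd y)) \<in> alg (base_coords \<union> fibre_coords)"
  by (rule alg_compose) (auto simp: coords_def fibre_coords_def intro!: alg_gen)

lemma base_alg_fst:
  assumes "r \<in> alg base_coords" "fst y = fst y'"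
  shows "r y = r y'"
  using assms by induction (auto simp: base_coords_def)

text \<open>
  Being projectable along vectors that depend polynomially on a parameter is an open condition on the
  parameter, and over this open set the cones \<open>T + span\<close> together form a closed set.  The form \<open>G\<close>
  that separates the next vector from the cone over \<open>p0\<close> may be chosen with coefficients depending on
  the parameter; its value at that vector is the leading coefficient needed for \<open>elimination\<close>, and it
  is nonzero for all parameters in an open set.
\<close>

lemma param_projection:
  fixes T :: "('k::{alg_closed_field,field_char_0} ^ 'r) set" and vs :: "('k ^ 'p \<Rightarrow> 'k ^ 'r) list"
  assumes T: "zclosed T" "is_cone T"
    and vs: "\<And>v i. v \<in> set vs \<Longrightarrow> (\<lambda>p. v p $ i) \<in> alg coords"
    and indep: "indep_of T (map (\<lambda>v. v p0) vs)"
  shows "\<exists>a\<in>alg coords. \<exists>Z. zero_closed (alg (base_coords \<union> fibre_coords)) Z \<and> a p0 \<noteq> 0 \<and>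
    (\<forall>p. a p \<noteq> 0 \<longrightarrow> indep_of T (map (\<lambda>v. v p) vs) \<and>
       (\<forall>x. (p, x) \<in> Z \<longleftrightarrow> x \<in> add_span T (map (\<lambda>v. v p) vs)))"
  using vs indep
proof (induction vs)
  case Nil
  have "zero_closed (alg (base_coords \<union> fibre_coords)) {y :: ('k ^ 'p) \<times> ('k ^ 'r). snd y \<in> T}"
  proof (rule zero_closedI)
    fix y :: "('k ^ 'p) \<times> ('k ^ 'r)" assume "y \<notin> {y. snd y \<in> T}"
    then obtain f where "f \<in> alg coords" "\<And>z. z \<in> T \<Longrightarrow> f z = 0" "f (snd y) \<noteq> 0"
      using zero_closedE[OF T(1)] by blast
    then show "\<exists>f\<in>alg (base_coords \<union> fibre_coords). (\<forall>z\<in>{y. snd y \<in> T}. f z = 0) \<and> f y \<noteq> 0"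
      by (intro bexI[of _ "\<lambda>y. f (snd y)"]) (auto intro: fibre_alg)
  qed
  then show ?case
    by (intro bexI[of _ "\<lambda>_. 1"] exI[of _ "{y. snd y \<in> T}"]) (auto intro: alg_const)
next
  case (Cons v vs)
  define W where "W p = add_span T (map (\<lambda>v. v p) vs)" for p
  let ?R = "alg (base_coords \<union> fibre_coords) :: (('k ^ 'p) \<times> ('k ^ 'r) \<Rightarrow> 'k) set"
  obtain a Z where a: "a \<in> alg coords" "a p0 \<noteq> 0" and Z: "zero_closed ?R Z"
    and aZ: "\<And>p. a p \<noteq> 0 \<Longrightarrow> indep_of T (map (\<lambda>v. v p) vs)"
      "\<And>p x. a p \<noteq> 0 \<Longrightarrow> (p, x) \<in> Z \<longleftrightarrow> x \<in> W p"
    using Cons.IH Cons.prems unfolding W_def by auto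
  have coneW: "is_cone (W p)" for p unfolding W_def by (rule cone_add_span[OF T(2)])
  have v: "(\<lambda>p. v p $ i) \<in> alg coords" for i using Cons.prems by simp
  have "(p0, v p0) \<notin> Z" using Cons.prems(2) aZ(2)[OF a(2)] unfolding W_def by simp
  then obtain F where F: "F \<in> ?R" "\<And>z. z \<in> Z \<Longrightarrow> F z = 0" "F (p0, v p0) \<noteq> 0"
    using zero_closedE[OF Z] by blast
  obtain N Fd where Fd: "\<And>d. forms (alg base_coords) fibre_coords d (Fd d)"
    "\<And>y. F y = (\<Sum>d\<le>N. Fd d y)"
    using alg_graded[OF F(1)] by metis
  have scale: "f (p, s *s x) = s ^ d * f (p, x)" if "forms (alg base_coords) fibre_coords d f" for f s p x d
    by (rule forms_scale[OF that]) (auto simp: fibre_coords_def intro: base_alg_fst)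
  obtain d where d: "d \<le> N" "Fd d (p0, v p0) \<noteq> 0"
    using F(3) Fd(2)[of "(p0, v p0)"] by (metis atMost_iff sum.neutral)
  \<comment> \<open>The factor \<open>a\<close> makes \<open>G\<close> vanish on \<open>Z\<close> also over parameters where the fibre need not be a cone.\<close>
  define G where "G y = a (fst y) * Fd d y" for y
  have "forms (alg base_coords) fibre_coords (0 + d) G"
    unfolding G_def by (rule forms_mult[OF forms_base[OF base_alg[OF a(1)]] Fd(1)])
  then have G: "forms (alg base_coords) fibre_coords d G" by simp
  have Gvan: "G (p, x) = 0" if px: "(p, x) \<in> Z" for p x
  proof (cases "a p = 0")
    case False
    have "Fd d (p, x) = 0"
    proof (rule polynomial_coeffs_zero[where c = "\<lambda>d. Fd d (p, x)", OF _ d(1)])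
      fix s
      have "(p, s *s x) \<in> Z" using px aZ(2)[OF False] cone_scale[OF coneW] by blast
      from F(2)[OF this] show "(\<Sum>d\<le>N. s ^ d * Fd d (p, x)) = 0"
        by (simp add: Fd(2) scale[OF Fd(1)])
    qed
    then show ?thesis by (simp add: G_def)
  qed (simp add: G_def)
  define \<tau> where "\<tau> = (\<lambda>(y :: ('k ^ 'p) \<times> ('k ^ 'r)) t. (fst y, snd y - t *s v (fst y)))"
  define \<delta> where "\<delta> = (\<lambda>(y :: ('k ^ 'p) \<times> ('k ^ 'r)). (fst y, - v (fst y)))"
  have sub: "f \<in> alg base_coords \<Longrightarrow> f \<in> ?R" for f by (rule alg_mono) auto
  have \<delta>R: "(\<lambda>y. - v (fst y) $ i) \<in> ?R" for i
    by (intro alg_uminus sub base_alg v)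
  have \<tau>_gen: "\<exists>P\<in>polyover ?R. \<forall>x t. poly (P x) t = g (\<tau> x t)" if gen: "g \<in> base_coords \<union> fibre_coords" for g
  proof (cases "g \<in> base_coords")
    case True
    then have "(\<lambda>y. [:g y:]) \<in> polyover ?R" by (intro polyover_coeff_const alg_gen) auto
    then show ?thesis
      by (rule bexI[rotated]) (use True in \<open>auto simp: base_coords_def \<tau>_def\<close>)
  next
    case False
    then obtain i where g: "g = (\<lambda>y. snd y $ i)" using gen by (auto simp: fibre_coords_def)
    have "(\<lambda>y. [:snd y $ i, - v (fst y) $ i:]) \<in> polyover ?R"
      by (intro polyover_pCons polyover_const \<delta>R alg_gen) (auto simp: fibre_coords_def)
    then show ?thesis
      by (rule bexI[rotated]) (auto simp: g \<tau>_def)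
  qed
  have "\<exists>P\<in>polyover ?R. \<forall>x. degree (P x) \<le> d \<and> coeff (P x) d = G (\<delta> x) \<and> (\<forall>t. poly (P x) t = G (\<tau> x t))"
  proof (rule forms_along_line[OF G])
    fix r :: "('k ^ 'p) \<times> ('k ^ 'r) \<Rightarrow> 'k" and x t assume "r \<in> alg base_coords"
    then show "r \<in> ?R \<and> r (\<tau> x t) = r x \<and> r (\<delta> x) = r x"
      by (auto intro: sub base_alg_fst simp: \<tau>_def \<delta>_def)
  next
    fix l :: "('k ^ 'p) \<times> ('k ^ 'r) \<Rightarrow> 'k" and x t assume "l \<in> fibre_coords"
    then obtain i where l: "l = (\<lambda>y. snd y $ i)" by (auto simp: fibre_coords_def)
    have "l \<in> ?R" unfolding l by (intro alg_gen) (auto simp: fibre_coords_def)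
    then show "l \<in> ?R \<and> (\<lambda>x. l (\<delta> x)) \<in> ?R \<and> l (\<tau> x t) = l x + t * l (\<delta> x)"
      using \<delta>R[of i] by (simp add: l \<tau>_def \<delta>_def)
  qed
  then obtain P where P: "P \<in> polyover ?R" "\<And>x. degree (P x) \<le> d" "\<And>x. coeff (P x) d = G (\<delta> x)"
    "\<And>x t. poly (P x) t = G (\<tau> x t)" by blast
  define a' where "a' p = a p * G (p, - v p)" for p
  have GR: "G \<in> ?R" by (rule forms_alg[OF G]) (auto intro: alg_mono alg_gen)
  have "(\<lambda>p. G (p, - v p)) \<in> alg coords"
  proof (rule alg_compose[OF GR])
    fix g :: "('k ^ 'p) \<times> ('k ^ 'r) \<Rightarrow> 'k" assume "g \<in> base_coords \<union> fibre_coords"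
    then show "(\<lambda>x. g (x, - v x)) \<in> alg coords"
      using v by (auto simp: base_coords_def fibre_coords_def intro!: coords_alg alg_uminus)
  qed
  then have a'alg: "a' \<in> alg coords" unfolding a'_def by (intro alg_mult a(1))
  have "G (p0, - v p0) = (-1) ^ d * G (p0, v p0)"
    using scale[OF G, of p0 "-1" "v p0"] by simp
  then have a'0: "a' p0 \<noteq> 0" using d(2) a(2) by (simp add: a'_def G_def)
  \<comment> \<open>Points with the amount \<open>t\<close> by which to move along \<open>v p\<close> in order to reach \<open>Z\<close>.\<close>
  define S where "S = {(y, t). \<tau> y t \<in> Z}"
  define Z' where "Z' = zero_closure ?R (fst ` S)"
  have main: "indep_of T (map (\<lambda>v. v p) (v # vs)) \<and> (\<forall>x. (p, x) \<in> Z' \<longleftrightarrow> x \<in> add_span T (map (\<lambda>v. v p) (v # vs)))"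
    if "a' p \<noteq> 0" for p
  proof (intro conjI allI)
    have ap: "a p \<noteq> 0" and Gp: "G (p, - v p) \<noteq> 0" using that by (auto simp: a'_def)
    have "v p \<notin> W p"
    proof
      assume "v p \<in> W p"
      then have "- v p \<in> W p" using cone_scale[OF coneW, of "v p" p "-1"] by simp
      then show False using Gvan aZ(2)[OF ap] Gp by blast
    qed
    then show "indep_of T (map (\<lambda>v. v p) (v # vs))" using aZ(1)[OF ap] by (simp add: W_def)
    fix x
    show "(p, x) \<in> Z' \<longleftrightarrow> x \<in> add_span T (map (\<lambda>v. v p) (v # vs))"
    proof
      assume "x \<in> add_span T (map (\<lambda>v. v p) (v # vs))"
      then obtain t where "x - t *s v p \<in> W p" by (auto simp: W_def)
      then have "((p, x), t) \<in> S" unfolding S_def \<tau>_def using aZ(2)[OF ap] by simp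
      then have "(p, x) \<in> fst ` S" by (rule image_eqI[rotated]) simp
      then show "(p, x) \<in> Z'" unfolding Z'_def by (rule zero_closureI)
    next
      assume px: "(p, x) \<in> Z'"
      have "\<exists>t0. \<forall>Q\<in>polyover ?R. (\<forall>(y,t)\<in>S. poly (Q y) t = 0) \<longrightarrow> poly (Q (p, x)) t0 = 0"
      proof (rule elimination[OF P(1,2)])
        show "poly (P y) t = 0" if "(y, t) \<in> S" for y t
          using that Gvan[of "fst (\<tau> y t)" "snd (\<tau> y t)"] by (simp add: S_def P(4))
        show "coeff (P (p, x)) d \<noteq> 0" using Gp by (simp add: P(3) \<delta>_def)
        show "h (p, x) = 0" if "h \<in> ?R" "\<And>y t. (y, t) \<in> S \<Longrightarrow> h y = 0" for h
          using px zero_closure_vanish[OF that(1), of "fst ` S"] that(2) unfolding Z'_def by force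
      qed
      then obtain t0 where t0: "\<And>Q. Q \<in> polyover ?R \<Longrightarrow> (\<forall>(y,t)\<in>S. poly (Q y) t = 0) \<Longrightarrow> poly (Q (p, x)) t0 = 0"
        by blast
      have "\<tau> (p, x) t0 \<in> Z"
      proof (rule ccontr)
        assume "\<tau> (p, x) t0 \<notin> Z"
        then obtain f where f: "f \<in> ?R" "\<And>z. z \<in> Z \<Longrightarrow> f z = 0" "f (\<tau> (p, x) t0) \<noteq> 0"
          using zero_closedE[OF Z] by blast
        obtain Q where Q: "Q \<in> polyover ?R" "\<And>x t. poly (Q x) t = f (\<tau> x t)"
          using alg_subst_polyover[OF f(1), of _ \<tau>, OF \<tau>_gen] by blast
        have "poly (Q (p, x)) t0 = 0"
          by (rule t0[OF Q(1)]) (auto simp: Q(2) S_def f(2))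
        then show False using f(3) Q(2) by simp
      qed
      then have "x - t0 *s v p \<in> W p" using aZ(2)[OF ap] by (simp add: \<tau>_def)
      then show "x \<in> add_span T (map (\<lambda>v. v p) (v # vs))" by (auto simp: W_def)
    qed
  qed
  have "zero_closed ?R Z'" unfolding Z'_def by (rule zero_closed_closure)
  then show ?case using a'alg a'0 main by blast
qed

text \<open>
  Constant vectors form a family over any parameter space; the closed set is its fibre over \<open>0\<close>.
\<close>

lemma zero_closed_add_span:
  fixes T :: "('k::{alg_closed_field,field_char_0} ^ 'r) set"
  assumes "zclosed T" "is_cone T" "indep_of T vs"
  shows "zclosed (add_span T vs)"
proof -
  let ?R = "alg (base_coords \<union> fibre_coords) :: (('k ^ 'r) \<times> ('k ^ 'r) \<Rightarrow> 'k) set"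
  have "\<exists>a\<in>alg coords. \<exists>Z. zero_closed ?R Z \<and> a 0 \<noteq> 0 \<and>
    (\<forall>p. a p \<noteq> 0 \<longrightarrow> indep_of T (map (\<lambda>v. v p) (map (\<lambda>v p. v) vs)) \<and>
       (\<forall>x. (p, x) \<in> Z \<longleftrightarrow> x \<in> add_span T (map (\<lambda>v. v p) (map (\<lambda>v p. v) vs))))"
    by (rule param_projection[OF assms(1,2)]) (use assms(3) in \<open>auto intro: alg_const simp: o_def\<close>)
  then obtain Z where Z: "zero_closed ?R Z" "\<And>x. (0, x) \<in> Z \<longleftrightarrow> x \<in> add_span T vs"
    by (auto simp: o_def)
  show ?thesis
  proof (rule zero_closedI)
    fix x assume "x \<notin> add_span T vs"
    then obtain f where f: "f \<in> ?R" "\<And>z. z \<in> Z \<Longrightarrow> f z = 0" "f (0, x) \<noteq> 0"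
      using zero_closedE[OF Z(1)] Z(2) by metis
    have "(\<lambda>x. f (0, x)) \<in> alg coords"
      by (rule alg_compose[OF f(1)])
        (auto simp: base_coords_def fibre_coords_def intro: coords_alg alg_const)
    then show "\<exists>f\<in>alg coords. (\<forall>z\<in>add_span T vs. f z = 0) \<and> f x \<noteq> 0"
      using f Z(2) by (intro bexI[of _ "\<lambda>x. f (0, x)"]) auto
  qed
qed

lemma indep_of_extend:
  fixes T :: "('k::field ^ 'r) set"
  assumes "indep_of T vs" "0 \<in> T"
  obtains us where "indep_of T (us @ vs)" "add_span T (us @ vs) = UNIV"
proof -
  have "\<exists>us. indep_of T (us @ vs) \<and> add_span T (us @ vs) = UNIV"
    using assms
  proof (induction "CARD('r) - length vs" arbitrary: vs rule: less_induct)
    case less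
    show ?case
    proof (cases "add_span T vs = UNIV")
      case True
      then show ?thesis using less by (intro exI[of _ "[]"]) auto
    next
      case False
      then obtain v where "v \<notin> add_span T vs" by auto
      then have i: "indep_of T (v # vs)" using less by simp
      have "CARD('r) - length (v # vs) < CARD('r) - length vs"
        using indep_of_length(1)[OF i less.prems(2)] by simp
      from less.hyps[OF this i less.prems(2)]
      obtain us where "indep_of T (us @ v # vs)" "add_span T (us @ v # vs) = UNIV"
        by blast
      then show ?thesis by (intro exI[of _ "us @ [v]"]) auto
    qed
  qed
  then show ?thesis using that by blast
qed

text \<open>
  On the line, a form that vanishes on \<open>W\<close> is a polynomial with leading coefficient \<open>\<plusminus> F v \<noteq> 0\<close>.
\<close>

lemma finite_line_cone:
  fixes W :: "('k::field_char_0 ^ 'r) set"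
  assumes "zclosed W" "is_cone W" "v \<notin> W"
  shows "finite {t. x - t *s v \<in> W}"
proof -
  obtain d F where F: "is_form d F" "\<And>x. x \<in> W \<Longrightarrow> F x = 0" "F v \<noteq> 0"
    using cone_separating_form[OF assms] by blast
  have "\<exists>P\<in>polyover (alg coords). \<forall>x. degree (P x) \<le> d \<and> coeff (P x) d = F (- v) \<and>
     (\<forall>t. poly (P x) t = F (x - t *s v))"
  proof (rule forms_along_line[OF F(1)])
    show "r \<in> alg coords \<and> r (x - t *s v) = r x \<and> r (- v) = r x" if "r \<in> alg {}" for r x t
      using that by (auto intro: alg_mono alg_empty_const)
  qed (auto elim!: coords_cases intro: coords_alg alg_const)
  then obtain P where P: "coeff P d = F (- v)" "\<And>t. poly P t = F (x - t *s v)" by blast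
  have "F (- v) = (-1) ^ d * F v" using form_scale[OF F(1), of "-1" v] by simp
  then have "P \<noteq> 0" using P(1) F(3) by auto
  then have "finite {t. poly P t = 0}" by (rule poly_roots_finite)
  then show ?thesis by (rule rev_finite_subset) (auto simp: P(2) F(2))
qed

lemma finite_fibres:
  fixes T :: "('k::{alg_closed_field,field_char_0} ^ 'r) set"
  assumes "zclosed T" "is_cone T" "indep_of T vs"
  shows "finite {y\<in>T. x - y \<in> vec.span (set vs)}"
  using assms(3)
proof (induction vs arbitrary: x)
  case Nil
  have "{y\<in>T. x - y \<in> vec.span (set [])} \<subseteq> {x}" by auto
  then show ?case using finite_subset by blast
next
  case (Cons v vs)
  let ?A = "{t. x - t *s v \<in> add_span T vs}"
  have "finite ?A"
    by (rule finite_line_cone) (use Cons assms in \<open>auto intro: zero_closed_add_span cone_add_span\<close>)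
  moreover have "finite {y\<in>T. (x - t *s v) - y \<in> vec.span (set vs)}" for t
    using Cons by auto
  ultimately have "finite (\<Union>t\<in>?A. {y\<in>T. (x - t *s v) - y \<in> vec.span (set vs)})" by blast
  moreover have "{y\<in>T. x - y \<in> vec.span (set (v # vs))} \<subseteq> (\<Union>t\<in>?A. {y\<in>T. (x - t *s v) - y \<in> vec.span (set vs)})"
  proof
    fix y assume "y \<in> {y\<in>T. x - y \<in> vec.span (set (v # vs))}"
    then obtain t where "y \<in> T" "(x - y) - t *s v \<in> vec.span (set vs)"
      by (auto simp: vec.span_breakdown_eq)
    moreover have "(x - y) - t *s v = (x - t *s v) - y" by simp
    ultimately show "y \<in> (\<Union>t\<in>?A. {y\<in>T. (x - t *s v) - y \<in> vec.span (set vs)})"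
      by (auto simp: add_span_iff)
  qed
  ultimately show ?case by (rule rev_finite_subset)
qed

section \<open>Finiteness over linear coordinates\<close>

text \<open>
  Functions that agree on \<open>T\<close> with a finite linear combination of members of \<open>S\<close>.  Comparing values on
  \<open>T\<close> only takes the place of the coordinate ring of \<open>T\<close>.
\<close>

inductive_set span_on :: "'x set \<Rightarrow> ('x \<Rightarrow> 'k::field) set \<Rightarrow> ('x \<Rightarrow> 'k) set" for T S where
  span_on_zero: "(\<And>x. x \<in> T \<Longrightarrow> f x = 0) \<Longrightarrow> f \<in> span_on T S"
| span_on_step: "f \<in> span_on T S \<Longrightarrow> s \<in> S \<Longrightarrow> (\<And>x. x \<in> T \<Longrightarrow> g x = f x + c * s x) \<Longrightarrow> g \<in> span_on T S"

lemma span_on_cong: 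
  assumes "f \<in> span_on T S" "\<And>x. x \<in> T \<Longrightarrow> g x = f x"
  shows "g \<in> span_on T S"
  using assms
proof (induction arbitrary: g)
  case (span_on_zero f)
  then show ?case by (auto intro: span_on.span_on_zero)
next
  case (span_on_step f s g' c)
  show ?case
    by (rule span_on.span_on_step[OF span_on_step.hyps(1,2), where c = c]) (use span_on_step in auto)
qed

lemma span_on_base: "s \<in> S \<Longrightarrow> s \<in> span_on T S"
  by (rule span_on_step[OF span_on_zero[of T "\<lambda>_. 0"], where c = 1]) auto

lemma span_on_add:
  assumes "f \<in> span_on T S" "g \<in> span_on T S"
  shows "(\<lambda>x. f x + g x) \<in> span_on T S"
  using assms(2)
proof induction
  case (span_on_zero g)
  then show ?case using assms(1) by (auto intro: span_on_cong)
next
  case (span_on_step g s h c)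
  show ?case
    by (rule span_on.span_on_step[OF span_on_step.IH span_on_step.hyps(2), where c = c]) (use span_on_step in auto)
qed

lemma span_on_scale:
  assumes "f \<in> span_on T S"
  shows "(\<lambda>x. c * f x) \<in> span_on T S"
  using assms
proof induction
  case (span_on_zero g)
  then show ?case by (auto intro: span_on.span_on_zero)
next
  case (span_on_step g s h c')
  show ?case
    by (rule span_on.span_on_step[OF span_on_step.IH span_on_step.hyps(2), where c = "c * c'"])
      (use span_on_step in \<open>auto simp: algebra_simps\<close>)
qed

lemma span_on_trans:
  assumes "f \<in> span_on T S" "\<And>s. s \<in> S \<Longrightarrow> s \<in> span_on T S'"
  shows "f \<in> span_on T S'"
  using assms(1)
proof induction
  case (span_on_zero g)
  then show ?case by (auto intro: span_on.span_on_zero)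
next
  case (span_on_step g s h c)
  from span_on_add[OF span_on_step.IH span_on_scale[OF assms(2)[OF span_on_step.hyps(2)]]] 
  show ?case by (rule span_on_cong) (use span_on_step in auto)
qed

lemma span_on_mono: "f \<in> span_on T S \<Longrightarrow> S \<subseteq> S' \<Longrightarrow> f \<in> span_on T S'"
  by (erule span_on_trans) (auto intro: span_on_base)

lemma span_on_image:
  assumes "f \<in> span_on T S" "\<And>x. x \<in> T' \<Longrightarrow> \<phi> x \<in> T"
    "\<And>s. s \<in> S \<Longrightarrow> (\<lambda>x. h x * s (\<phi> x)) \<in> span_on T' S'"
  shows "(\<lambda>x. h x * f (\<phi> x)) \<in> span_on T' S'"
  using assms(1)
proof induction
  case (span_on_zero g)
  then show ?case by (intro span_on.span_on_zero) (auto simp: assms(2))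
next
  case (span_on_step g s h' c)
  from span_on_add[OF span_on_step.IH span_on_scale[OF assms(3)[OF span_on_step.hyps(2)]]] 
  show ?case by (rule span_on_cong) (use span_on_step assms(2) in \<open>auto simp: algebra_simps\<close>)
qed

lemma span_on_mult:
  assumes "f \<in> span_on T S" "g \<in> span_on T S'" "\<And>s s'. s \<in> S \<Longrightarrow> s' \<in> S' \<Longrightarrow> (\<lambda>x. s x * s' x) \<in> span_on T S''"
  shows "(\<lambda>x. f x * g x) \<in> span_on T S''"
proof (rule span_on_image[OF assms(2), where \<phi> = "\<lambda>x. x", of T f S''])
  fix s' assume s': "s' \<in> S'"
  have "(\<lambda>x. s' x * f x) \<in> span_on T S''"
    by (rule span_on_image[OF assms(1), where \<phi> = "\<lambda>x. x"]) (use assms(3)[OF _ s'] in \<open>auto simp: mult.commute\<close>)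
  then show "(\<lambda>x. f x * s' x) \<in> span_on T S''" by (simp add: mult.commute)
qed

lemma span_on_insertE:
  assumes "f \<in> span_on T (insert s S)"
  obtains a h where "h \<in> span_on T S" "\<And>x. x \<in> T \<Longrightarrow> f x = h x + a * s x"
proof -
  have "\<exists>a h. h \<in> span_on T S \<and> (\<forall>x\<in>T. f x = h x + a * s x)"
    using assms
  proof induction
    case (span_on_zero f)
    then show ?case by (intro exI[of _ 0] exI[of _ "\<lambda>_. 0"]) (auto intro: span_on.span_on_zero)
  next
    case (span_on_step f s' g c)
    then obtain a h where h: "h \<in> span_on T S" "\<forall>x\<in>T. f x = h x + a * s x" by blast
    show ?case
    proof (cases "s' = s")
      case True
      then show ?thesis using h span_on_step
        by (intro exI[of _ "a + c"] exI[of _ h]) (auto simp: algebra_simps)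
    next
      case False
      then have s': "s' \<in> S" using span_on_step by auto
      show ?thesis using span_on.span_on_step[OF h(1) s', of "\<lambda>x. h x + c * s' x" c] h(2) span_on_step
        by (intro exI[of _ a] exI[of _ "\<lambda>x. h x + c * s' x"]) auto
    qed
  qed
  then show ?thesis using that by blast
qed

lemma span_on_dependent:
  assumes "finite S" "finite J" "card S < card J" "\<And>j. j \<in> J \<Longrightarrow> g j \<in> span_on T S"
  shows "\<exists>c. (\<exists>j\<in>J. c j \<noteq> 0) \<and> (\<forall>x\<in>T. (\<Sum>j\<in>J. c j * g j x) = 0)"
  using assms
proof (induction S arbitrary: J g)
  case empty
  have "g j x = 0" if "j \<in> J" "x \<in> T" for j x
    using empty(3)[OF that(1)] that(2) by (cases rule: span_on.cases) auto
  moreover obtain j where "j \<in> J" using empty by fastforce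
  ultimately show ?case by (intro exI[of _ "\<lambda>_. 1"]) auto
next
  case (insert s S)
  have "\<forall>j\<in>J. \<exists>a h. h \<in> span_on T S \<and> (\<forall>x\<in>T. g j x = h x + a * s x)"
    using insert.prems(3) span_on_insertE by metis
  then obtain a h where h: "\<And>j. j \<in> J \<Longrightarrow> h j \<in> span_on T S" "\<And>j x. j \<in> J \<Longrightarrow> x \<in> T \<Longrightarrow> g j x = h j x + a j * s x"
    by metis
  show ?case
  proof (cases "\<forall>j\<in>J. a j = 0")
    case True
    show ?thesis
    proof (rule insert.IH)
      show "card S < card J" using insert by simp
      show "g j \<in> span_on T S" if "j \<in> J" for j
        using h that True by (auto intro: span_on_cong)
    qed (use insert in auto)
  next
    case False
    then obtain j0 where j0: "j0 \<in> J" "a j0 \<noteq> 0" by auto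
    \<comment> \<open>One step of Gaussian elimination: the functions \<open>g' j\<close> no longer involve \<open>s\<close>.\<close>
    define g' where "g' j x = g j x - a j / a j0 * g j0 x" for j x
    have "\<exists>c. (\<exists>j\<in>J - {j0}. c j \<noteq> 0) \<and> (\<forall>x\<in>T. (\<Sum>j\<in>J - {j0}. c j * g' j x) = 0)"
    proof (rule insert.IH)
      show "card S < card (J - {j0})" using insert j0 by simp
      show "g' j \<in> span_on T S" if "j \<in> J - {j0}" for j
      proof (rule span_on_cong[OF span_on_add[OF h(1) span_on_scale[OF h(1)]]])
        fix x assume "x \<in> T"
        then show "g' j x = h j x + (- (a j / a j0)) * h j0 x"
          using h(2)[of j x] h(2)[of j0 x] that j0 by (simp add: g'_def field_simps)
      qed (use that j0 in auto)
    qed (use insert in auto)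
    then obtain c j1 where c: "j1 \<in> J - {j0}" "c j1 \<noteq> 0" "\<And>x. x \<in> T \<Longrightarrow> (\<Sum>j\<in>J - {j0}. c j * g' j x) = 0"
      by blast
    define c' where "c' j = (if j = j0 then - (\<Sum>j\<in>J - {j0}. c j * (a j / a j0)) else c j)" for j
    have "(\<Sum>j\<in>J. c' j * g j x) = 0" if "x \<in> T" for x
    proof -
      have "(\<Sum>j\<in>J. c' j * g j x) = c' j0 * g j0 x + (\<Sum>j\<in>J - {j0}. c j * g j x)"
        using insert.prems(1) j0 by (simp add: sum.remove[of J j0] c'_def)
      also have "\<dots> = (\<Sum>j\<in>J - {j0}. c j * g' j x)"
        by (simp add: c'_def g'_def sum_distrib_right sum_distrib_left sum_subtractf algebra_simps)
      finally show ?thesis using c(3)[OF that] by simp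
    qed
    then show ?thesis using c by (intro exI[of _ c']) (auto simp: c'_def intro!: bexI[of _ j1])
  qed
qed

definition dot :: "'k::field ^ 'r \<Rightarrow> 'k ^ 'r \<Rightarrow> 'k" where
  "dot a x = (\<Sum>j\<in>UNIV. a $ j * x $ j)"

lemma dot_add: "dot a (x + y) = dot a x + dot a y"
  by (simp add: dot_def sum.distrib algebra_simps)

lemma dot_scale: "dot a (c *s x) = c * dot a x"
  by (simp add: dot_def sum_distrib_left mult_ac)

lemma dot_zero: "dot a 0 = 0"
  by (simp add: dot_def)

lemma dot_diff: "dot a (x - y) = dot a x - dot a y"
  by (simp add: dot_def sum_subtractf algebra_simps)

lemma dot_diff_left: "dot (a - b) x = dot a x - dot b x"
  by (simp add: dot_def sum_subtractf algebra_simps)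

lemma dot_scale_left: "dot (c *s a) x = c * dot a x"
  by (simp add: dot_def sum_distrib_left mult_ac)

lemma dot_sum: "dot a (\<Sum>i\<in>I. f i) = (\<Sum>i\<in>I. dot a (f i))"
  by (induction I rule: infinite_finite_induct) (auto simp: dot_zero dot_add)

lemma dot_axis: "dot (axis i 1) x = x $ i"
proof -
  have "axis i 1 $ j * x $ j = (if j = i then x $ j else 0)" for j by (simp add: axis_def)
  then show ?thesis by (simp add: dot_def)
qed

lemma dot_form: "is_form 1 (dot a)"
  unfolding dot_def
  by (intro forms_sum forms_cmult forms_gen) (auto simp: coords_def)

lemma dot_span: 
  assumes "x \<in> vec.span S" "\<And>v. v \<in> S \<Longrightarrow> dot a v = 0"
  shows "dot a x = 0"
  using assms(1) by (induction rule: vec.span_induct_alt) (auto simp: dot_zero dot_add dot_scale assms(2))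

text \<open>
  Linear coordinates on the quotient by the span of \<open>vs\<close>: the functionals \<open>dot (a i)\<close>, dual to the
  vectors \<open>w i\<close>.  They are indexed by a subset of the original index type, so that passing to a further
  quotient drops an index.
\<close>

definition chart :: "('k::field ^ 'r) list \<Rightarrow> 'r set \<Rightarrow> ('r \<Rightarrow> 'k ^ 'r) \<Rightarrow> ('r \<Rightarrow> 'k ^ 'r) \<Rightarrow> bool" where
  "chart vs I a w \<longleftrightarrow>
     (\<forall>i\<in>I. \<forall>v\<in>set vs. dot (a i) v = 0) \<and>
     (\<forall>i\<in>I. \<forall>j\<in>I. dot (a i) (w j) = (if i = j then 1 else 0)) \<and>
     (\<forall>x. x - (\<Sum>i\<in>I. dot (a i) x *s w i) \<in> vec.span (set vs)) \<and>
     card I + length vs = CARD('r)"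

lemma chart_span: "chart vs I a w \<Longrightarrow> i \<in> I \<Longrightarrow> x \<in> vec.span (set vs) \<Longrightarrow> dot (a i) x = 0"
  by (rule dot_span) (auto simp: chart_def)

text \<open>
  Polynomials of degree at most \<open>k\<close> in the functions \<open>L\<close>, homogenized by the constant function \<open>1\<close>.
\<close>

definition forms_upto :: "('x \<Rightarrow> 'k::comm_ring_1) set \<Rightarrow> nat \<Rightarrow> ('x \<Rightarrow> 'k) \<Rightarrow> bool" where
  "forms_upto L k f \<longleftrightarrow> forms (alg {}) (insert (\<lambda>_. 1) L) k f"

lemma forms_upto_const: "forms_upto L 0 (\<lambda>_. c)"
  unfolding forms_upto_def by (rule forms_const)

lemma forms_upto_gen: "l \<in> L \<Longrightarrow> forms_upto L 1 l"
  unfolding forms_upto_def by (rule forms_gen) auto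

lemma forms_upto_add: "forms_upto L k f \<Longrightarrow> forms_upto L k g \<Longrightarrow> forms_upto L k (\<lambda>x. f x + g x)"
  unfolding forms_upto_def by (rule forms_add)

lemma forms_upto_mult: "forms_upto L k f \<Longrightarrow> forms_upto L l g \<Longrightarrow> forms_upto L (k + l) (\<lambda>x. f x * g x)"
  unfolding forms_upto_def by (rule forms_mult)

lemma forms_upto_power: "forms_upto L k f \<Longrightarrow> forms_upto L (n * k) (\<lambda>x. f x ^ n)"
  unfolding forms_upto_def by (rule forms_power)

lemma forms_upto_prod: "(\<And>i. i \<in> I \<Longrightarrow> forms_upto L (d i) (f i)) \<Longrightarrow> forms_upto L (sum d I) (\<lambda>x. \<Prod>i\<in>I. f i x)"
  unfolding forms_upto_def by (rule forms_prod)

lemma forms_upto_mono: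
  assumes "forms_upto L k f" "k \<le> l"
  shows "forms_upto L l f"
proof -
  have "forms_upto L ((l - k) * 1) (\<lambda>x. 1 ^ (l - k))"
    unfolding forms_upto_def by (intro forms_power forms_gen) auto
  from forms_upto_mult[OF assms(1) this] show ?thesis using assms(2) by simp
qed

lemma alg_forms_upto: "f \<in> alg L \<Longrightarrow> \<exists>k. forms_upto L k f"
proof (induction rule: alg.induct)
  case (alg_const c) show ?case using forms_upto_const by blast
next
  case (alg_gen g) then show ?case using forms_upto_gen by blast
next
  case (alg_add f g)
  then obtain k l where "forms_upto L k f" "forms_upto L l g" by blast
  then have "forms_upto L (max k l) f" "forms_upto L (max k l) g" by (auto intro: forms_upto_mono)
  then show ?case using forms_upto_add by blast
next
  case (alg_mult f g) then show ?case using forms_upto_mult by blast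
qed

text \<open>
  If on \<open>T\<close> the power \<open>q ^ d\<close> is a combination of lower powers of \<open>q\<close>, with coefficients of
  complementary degree in \<open>L\<close>, then every polynomial in \<open>q\<close> and \<open>L\<close> can be reduced to powers below
  \<open>d\<close> without raising the total degree.  Control of the total degree is what the growth estimate
  below depends on.
\<close>

lemma finite_module_step:
  fixes T :: "'x set" and q :: "'x \<Rightarrow> 'k::field" and L :: "('x \<Rightarrow> 'k) set"
  assumes rel: "(\<lambda>x. q x ^ d) \<in> span_on T {\<lambda>x. q x ^ i * G x | i G m. i < d \<and> i + m = d \<and> forms_upto L m G}"
    and F: "forms_upto L' k F"
    and L': "\<And>l. l \<in> L' \<Longrightarrow> \<exists>c g. forms_upto L 1 g \<and> (\<forall>x. l x = g x + c * q x)"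
  shows "F \<in> span_on T {\<lambda>x. q x ^ i * G x | i G. i < d \<and> forms_upto L k G}"
proof -
  define M where "M k = {\<lambda>x. q x ^ j * G x | j G m. j + m = k \<and> forms_upto L m G}" for k
  define Q where "Q k = {\<lambda>x. q x ^ i * G x | i G. i < d \<and> forms_upto L k G}" for k
  have MI: "(\<lambda>x. q x ^ j * G x) \<in> span_on T (M k)" if "j + m = k" "forms_upto L m G" for j m k G
    by (rule span_on_base) (use that in \<open>auto simp: M_def\<close>)
  have Mlin: "l \<in> span_on T (M 1)" if "forms_upto L 1 g" "\<And>x. l x = g x + c * q x" for l g c
  proof -
    have "(\<lambda>x. q x ^ 0 * g x) \<in> span_on T (M 1)" "(\<lambda>x. q x ^ 1 * 1) \<in> span_on T (M 1)"
      by (rule MI[OF _ that(1)], simp, rule MI[OF _ forms_upto_const], simp)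
    then have "(\<lambda>x. g x) \<in> span_on T (M 1)" "(\<lambda>x. q x) \<in> span_on T (M 1)"
      by simp_all
    from span_on_add[OF this(1) span_on_scale[OF this(2)]] show ?thesis
      by (rule span_on_cong) (rule that(2))
  qed
  have FM: "F \<in> span_on T (M k)"
    using F unfolding forms_upto_def
  proof induction
    case (forms_base r)
    have "(\<lambda>x. q x ^ 0 * r x) \<in> span_on T (M 0)"
      by (rule MI) (auto simp: forms_upto_def intro: forms.forms_base[OF forms_base])
    then show ?case by simp
  next
    case (forms_gen l)
    have one: "forms_upto L 1 (\<lambda>_. 1)" by (rule forms_upto_mono[OF forms_upto_const]) simp
    have "\<exists>c g. forms_upto L 1 g \<and> (\<forall>x. l x = g x + c * q x)"
    proof (cases "l \<in> L'")
      case False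
      then have "l = (\<lambda>_. 1)" using forms_gen by simp
      then show ?thesis using one by (intro exI[of _ 0] exI[of _ "\<lambda>_. 1"]) auto
    qed (rule L')
    then show ?case using Mlin by blast
  next
    case (forms_zero d) then show ?case by (auto intro: span_on_zero)
  next
    case (forms_add d f g) then show ?case by (auto intro: span_on_add)
  next
    case (forms_mult d f e g)
    show ?case
    proof (rule span_on_mult[OF forms_mult.IH])
      fix s s' assume "s \<in> M d" "s' \<in> M e"
      then obtain j G m j' G' m' where s: "s = (\<lambda>x. q x ^ j * G x)" "j + m = d" "forms_upto L m G"
        "s' = (\<lambda>x. q x ^ j' * G' x)" "j' + m' = e" "forms_upto L m' G'"
        unfolding M_def by blast
      have "(\<lambda>x. q x ^ (j + j') * (G x * G' x)) \<in> span_on T (M (d + e))"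
        by (rule MI[OF _ forms_upto_mult[OF s(3,6)]]) (use s in auto)
      then show "(\<lambda>x. s x * s' x) \<in> span_on T (M (d + e))" by (simp add: s power_add mult_ac)
    qed
  qed
  have red: "(\<lambda>x. q x ^ j * G x) \<in> span_on T (Q (j + m))" if "forms_upto L m G" for j m G
    using that
  proof (induction j arbitrary: m G rule: less_induct)
    case (less j)
    show ?case
    proof (cases "j < d")
      case True
      have "forms_upto L (j + m) G" by (rule forms_upto_mono[OF less.prems]) simp
      then have "(\<lambda>x. q x ^ j * G x) \<in> Q (j + m)" unfolding Q_def using True by blast
      then show ?thesis by (rule span_on_base)
    next
      case False
      have "(\<lambda>x. (q x ^ (j - d) * G x) * q x ^ d) \<in> span_on T (Q (j + m))"
      proof (rule span_on_image[OF rel, where \<phi> = "\<lambda>x. x"])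
        fix s assume "s \<in> {\<lambda>x. q x ^ i * G x | i G m. i < d \<and> i + m = d \<and> forms_upto L m G}"
        then obtain i G' m' where s: "s = (\<lambda>x. q x ^ i * G' x)" "i < d" "i + m' = d" "forms_upto L m' G'"
          by blast
        have "(\<lambda>x. q x ^ (j - d + i) * (G x * G' x)) \<in> span_on T (Q ((j - d + i) + (m + m')))"
          by (rule less.IH) (use s False less.prems in \<open>auto intro: forms_upto_mult\<close>)
        moreover have "(j - d + i) + (m + m') = j + m" using s False by linarith
        moreover have "(\<lambda>x. q x ^ (j - d) * G x * s x) = (\<lambda>x. q x ^ (j - d + i) * (G x * G' x))"
          by (simp add: s(1) power_add mult_ac)
        ultimately show "(\<lambda>x. q x ^ (j - d) * G x * s x) \<in> span_on T (Q (j + m))" by simp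
      qed auto
      moreover have "q x ^ (j - d) * G x * q x ^ d = q x ^ j * G x" for x
        using False power_add[of "q x" "j - d" d] by (simp add: mult_ac)
      ultimately show ?thesis by simp
    qed
  qed
  have "F \<in> span_on T (Q k)"
  proof (rule span_on_trans[OF FM])
    fix s assume "s \<in> M k"
    then show "s \<in> span_on T (Q k)" unfolding M_def using red by blast
  qed
  then show ?thesis unfolding Q_def .
qed

text \<open>
  Project further along \<open>v\<close>: a coordinate \<open>i0\<close> that does not vanish at \<open>v\<close> is used to correct the
  others by multiples of it, so that they do, and is then dropped.
\<close>

lemma chart_step:
  fixes vs :: "('k::field ^ 'r) list"
  assumes ch: "chart vs I a w" and i0: "i0 \<in> I" "dot (a i0) v \<noteq> 0"
  defines "c \<equiv> \<lambda>i. dot (a i) v / dot (a i0) v"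
  shows "chart (v # vs) (I - {i0}) (\<lambda>i. a i - c i *s a i0) w"
  unfolding chart_def
proof (intro conjI ballI allI)
  fix i u assume i: "i \<in> I - {i0}" and u: "u \<in> set (v # vs)"
  show "dot (a i - c i *s a i0) u = 0"
  proof (cases "u = v")
    case True
    then show ?thesis using i0 by (simp add: dot_diff_left dot_scale_left c_def)
  next
    case False
    then show ?thesis using u i i0 ch by (simp add: dot_diff_left dot_scale_left chart_def)
  qed
next
  fix i j assume "i \<in> I - {i0}" "j \<in> I - {i0}"
  then show "dot (a i - c i *s a i0) (w j) = (if i = j then 1 else 0)"
    using ch i0 by (auto simp: dot_diff_left dot_scale_left chart_def)
next
  fix x
  let ?t = "dot (a i0) x / dot (a i0) v"
  have fin: "finite I" by simp
  have sp: "y - (\<Sum>i\<in>I. dot (a i) y *s w i) \<in> vec.span (set vs)" for y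
    using ch by (simp add: chart_def)
  have "(\<Sum>i\<in>I - {i0}. dot (a i - c i *s a i0) x *s w i) =
     (\<Sum>i\<in>I. dot (a i - c i *s a i0) x *s w i)"
    using i0 by (simp add: sum.remove[of I i0] dot_diff_left dot_scale_left c_def)
  also have "\<dots> = (\<Sum>i\<in>I. dot (a i) (x - ?t *s v) *s w i)"
    by (intro sum.cong) (simp_all add: dot_diff_left dot_scale_left dot_diff dot_scale c_def)
  finally have *: "x - (\<Sum>i\<in>I - {i0}. dot (a i - c i *s a i0) x *s w i) - ?t *s v
     = (x - ?t *s v) - (\<Sum>i\<in>I. dot (a i) (x - ?t *s v) *s w i)"
    by simp
  have "x - (\<Sum>i\<in>I - {i0}. dot (a i - c i *s a i0) x *s w i) - ?t *s v \<in> vec.span (set vs)"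
    unfolding * by (rule sp)
  then show "x - (\<Sum>i\<in>I - {i0}. dot (a i - c i *s a i0) x *s w i) \<in> vec.span (set (v # vs))"
    by (auto simp: vec.span_breakdown_eq)
next
  have "card I > 0" using i0 by (auto simp: card_gt_0_iff)
  then show "card (I - {i0}) + length (v # vs) = CARD('r)"
    using ch i0 by (simp add: chart_def)
qed

text \<open>
  The expansion of \<open>F\<close> at the point \<open>g + q u\<close> in powers of \<open>q\<close>: the top coefficient is \<open>F u\<close>, and the
  coefficient of \<open>q ^ i\<close> has degree \<open>d - i\<close> in the remaining coordinates.
\<close>

lemma form_top_coefficient:
  fixes F :: "'k::field ^ 'r \<Rightarrow> 'k"
  assumes F: "is_form d F"
    and \<rho>: "\<And>x k. \<rho> x $ k = g k x + q x * u $ k" "\<And>k. forms_upto L 1 (g k)"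
  shows "(\<lambda>x. F (\<rho> x) - F u * q x ^ d) \<in> span_on T {\<lambda>x. q x ^ i * G x | i G m. i < d \<and> i + m = d \<and> forms_upto L m G}"
proof -
  define N where "N d = {\<lambda>x. q x ^ i * G x | i G m. i < d \<and> i + m = d \<and> forms_upto L m G}" for d
  have NI: "(\<lambda>x. q x ^ i * G x) \<in> span_on T (N d)" if "i < d" "i + m = d" "forms_upto L m G" for i d m G
    by (rule span_on_base) (use that in \<open>auto simp: N_def\<close>)
  have "(\<lambda>x. F (\<rho> x) - F u * q x ^ d) \<in> span_on T (N d)"
    using F
  proof induction
    case (forms_base r)
    show ?case
      by (rule span_on_zero) (use alg_empty_const[OF forms_base, of _ u] in simp)
  next
    case (forms_gen l)
    then obtain k where l: "l = (\<lambda>x. x $ k)" by (auto elim: coords_cases)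
    have "(\<lambda>x. q x ^ 0 * g k x) \<in> span_on T (N 1)" by (rule NI[OF _ _ \<rho>(2)]) auto
    then show ?case by (simp add: l \<rho>(1) mult.commute)
  next
    case (forms_zero d)
    then show ?case by (auto intro: span_on_zero)
  next
    case (forms_add d f g)
    from span_on_add[OF forms_add.IH] show ?case by (rule span_on_cong) (simp add: algebra_simps)
  next
    case (forms_mult d f e h)
    let ?f = "\<lambda>x. f (\<rho> x) - f u * q x ^ d" and ?h = "\<lambda>x. h (\<rho> x) - h u * q x ^ e"
    have 1: "(\<lambda>x. ?f x * ?h x) \<in> span_on T (N (d + e))"
    proof (rule span_on_mult[OF forms_mult.IH])
      fix s s' assume "s \<in> N d" "s' \<in> N e"
      then obtain i G m i' G' m' where s: "s = (\<lambda>x. q x ^ i * G x)" "i < d" "i + m = d" "forms_upto L m G"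
        "s' = (\<lambda>x. q x ^ i' * G' x)" "i' < e" "i' + m' = e" "forms_upto L m' G'"
        unfolding N_def by blast
      have "(\<lambda>x. q x ^ (i + i') * (G x * G' x)) \<in> span_on T (N (d + e))"
        by (rule NI[OF _ _ forms_upto_mult[OF s(4,8)]]) (use s in auto)
      then show "(\<lambda>x. s x * s' x) \<in> span_on T (N (d + e))" by (simp add: s power_add mult_ac)
    qed
    have 2: "(\<lambda>x. q x ^ e * ?f x) \<in> span_on T (N (d + e))"
    proof (rule span_on_image[OF forms_mult.IH(1), where \<phi> = "\<lambda>x. x"])
      fix s assume "s \<in> N d"
      then obtain i G m where s: "s = (\<lambda>x. q x ^ i * G x)" "i < d" "i + m = d" "forms_upto L m G"
        unfolding N_def by blast
      have "(\<lambda>x. q x ^ (e + i) * G x) \<in> span_on T (N (d + e))"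
        by (rule NI[OF _ _ s(4)]) (use s in auto)
      then show "(\<lambda>x. q x ^ e * s x) \<in> span_on T (N (d + e))" by (simp add: s power_add mult_ac)
    qed auto
    have 3: "(\<lambda>x. q x ^ d * ?h x) \<in> span_on T (N (d + e))"
    proof (rule span_on_image[OF forms_mult.IH(2), where \<phi> = "\<lambda>x. x"])
      fix s assume "s \<in> N e"
      then obtain i G m where s: "s = (\<lambda>x. q x ^ i * G x)" "i < e" "i + m = e" "forms_upto L m G"
        unfolding N_def by blast
      have "(\<lambda>x. q x ^ (d + i) * G x) \<in> span_on T (N (d + e))"
        by (rule NI[OF _ _ s(4)]) (use s in auto)
      then show "(\<lambda>x. q x ^ d * s x) \<in> span_on T (N (d + e))" by (simp add: s power_add mult_ac)
    qed auto
    show ?case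
      by (rule span_on_cong[OF span_on_add[OF 1 span_on_add[OF span_on_scale[OF 2, of "h u"] span_on_scale[OF 3, of "f u"]]]])
        (simp add: algebra_simps power_add)
  qed
  then show ?thesis unfolding N_def .
qed

text \<open>
  Noether normalization with degrees.  Each vector \<open>v\<close> of the list lies outside the closed cone \<open>W\<close>
  projected along the earlier ones, and a form that vanishes on \<open>W\<close> but not in the direction of \<open>v\<close>
  makes the coordinate \<open>q\<close> that is dropped at this step integral over the remaining ones.
\<close>

lemma finite_module:
  fixes T :: "('k::{alg_closed_field,field_char_0} ^ 'r) set"
  assumes T: "zclosed T" "is_cone T" and "indep_of T vs"
  shows "\<exists>I a w E. chart vs I a w \<and> finite E \<and>
    (\<forall>k F. forms_upto coords k F \<longrightarrow>
       F \<in> span_on T {\<lambda>x. e x * g x | e g. e \<in> E \<and> forms_upto ((\<lambda>i. dot (a i)) ` I) k g})"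
  using assms(3)
proof (induction vs)
  case Nil
  have co: "(\<lambda>i :: 'r. dot (axis i 1)) ` UNIV = (coords :: ('k ^ 'r \<Rightarrow> 'k) set)"
    by (auto simp: coords_def dot_axis fun_eq_iff image_iff)
  have "chart [] (UNIV :: 'r set) (\<lambda>i. axis i 1) (\<lambda>i. axis i (1::'k))"
    unfolding chart_def
  proof (intro conjI allI ballI)
    fix x :: "'k ^ 'r"
    have "(\<Sum>i\<in>UNIV. dot (axis i 1) x *s axis i 1) = x"
      by (simp add: dot_axis basis_expansion)
    then show "x - (\<Sum>i\<in>UNIV. dot (axis i 1) x *s axis i 1) \<in> vec.span (set [])" by simp
  next
    show "dot (axis i 1) (axis j 1) = (if i = j then 1 else (0::'k))" for i j :: 'r
      unfolding dot_axis by (simp add: axis_def)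
  qed auto
  moreover have "F \<in> span_on T {\<lambda>x. e x * g x | e g. e \<in> {\<lambda>_. 1} \<and> forms_upto ((\<lambda>i. dot (axis i 1)) ` UNIV) k g}"
    if "forms_upto coords k F" for k and F :: "'k ^ 'r \<Rightarrow> 'k"
    using that by (intro span_on_base) (auto simp: co)
  ultimately show ?case by (intro exI[of _ UNIV] exI[of _ "\<lambda>i. axis i 1"] exI[of _ "{\<lambda>_. 1}"]) blast
next
  case (Cons v vs)
  then have vnot: "v \<notin> add_span T vs" and ind: "indep_of T vs" by auto
  from Cons.IH[OF ind] obtain I a w E where ch: "chart vs I a w" and E: "finite E"
    "\<And>k F. forms_upto coords k F \<Longrightarrow> F \<in> span_on T {\<lambda>x. e x * g x | e g. e \<in> E \<and> forms_upto ((\<lambda>i. dot (a i)) ` I) k g}"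
    by blast
  define W where "W = add_span T vs"
  have W: "zclosed W" "is_cone W"
    unfolding W_def using zero_closed_add_span[OF T ind] cone_add_span[OF T(2)] by auto
  define \<rho> where "\<rho> x = (\<Sum>i\<in>I. dot (a i) x *s w i)" for x
  have \<rho>: "x - \<rho> x \<in> vec.span (set vs)" for x using ch by (simp add: chart_def \<rho>_def)
  have \<rho>W: "\<rho> x \<in> W" if "x \<in> T" for x
    unfolding W_def add_span_iff
    using that vec.span_neg[OF \<rho>[of x]] by (intro bexI[of _ x]) auto
  \<comment> \<open>The form is separated at \<open>\<rho> v\<close> instead of \<open>v\<close>, so that its pullback along \<open>\<rho>\<close> involves the coordinates only.\<close>
  have "\<rho> v \<notin> W"
  proof
    assume "\<rho> v \<in> W"
    then obtain y where y: "y \<in> T" "\<rho> v - y \<in> vec.span (set vs)" unfolding W_def add_span_iff by blast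
    have "v - y = (v - \<rho> v) + (\<rho> v - y)" by simp
    then have "v - y \<in> vec.span (set vs)" using vec.span_add[OF \<rho>[of v] y(2)] by simp
    then show False using vnot y(1) by (auto simp: add_span_iff)
  qed
  then obtain d F where F: "is_form d F" "\<And>x. x \<in> W \<Longrightarrow> F x = 0" "F (\<rho> v) \<noteq> 0"
    using cone_separating_form[OF W] by blast
  have "\<exists>i0\<in>I. dot (a i0) v \<noteq> 0"
  proof (rule ccontr)
    assume "\<not> ?thesis"
    then have "\<rho> v = 0" by (simp add: \<rho>_def)
    then show False using \<open>\<rho> v \<notin> W\<close> cone_0[OF W(2)] by simp
  qed
  then obtain i0 where i0: "i0 \<in> I" "dot (a i0) v \<noteq> 0" by blast
  define c where "c i = dot (a i) v / dot (a i0) v" for i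
  define a' where "a' i = a i - c i *s a i0" for i
  define I' where "I' = I - {i0}"
  define L where "L = (\<lambda>i. dot (a' i)) ` I'"
  have ch': "chart (v # vs) I' a' w"
    using chart_step[OF ch i0] unfolding c_def a'_def I'_def .
  define q where "q = dot (a i0)"
  have q: "dot (a i) x = dot (a' i) x + c i * q x" for i x
    by (simp add: a'_def q_def dot_diff_left dot_scale_left)
  define u where "u = (\<Sum>i\<in>I. c i *s w i)"
  have "\<rho> v = dot (a i0) v *s u"
    unfolding \<rho>_def u_def vec.scale_sum_right by (intro sum.cong) (use i0 in \<open>auto simp: c_def\<close>)
  then have Fu: "F u \<noteq> 0" using F(3) form_scale[OF F(1)] by auto
  have a'0: "dot (a' i0) x = 0" for x
    using i0 by (simp add: a'_def c_def dot_def)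
  define g where "g k x = (\<Sum>i\<in>I'. w i $ k * dot (a' i) x)" for k x
  have gform: "forms_upto L 1 (g k)" for k
    unfolding g_def forms_upto_def
    by (intro forms_sum forms_cmult forms_gen) (auto simp: L_def)
  have \<rho>k: "\<rho> x $ k = g k x + q x * u $ k" for x k
  proof -
    have "\<rho> x $ k = (\<Sum>i\<in>I. w i $ k * dot (a' i) x) + q x * u $ k"
      by (simp add: \<rho>_def u_def q algebra_simps sum.distrib sum_distrib_left)
    moreover have "(\<Sum>i\<in>I. w i $ k * dot (a' i) x) = g k x"
      using i0 by (simp add: g_def I'_def sum.remove[of I i0] a'0)
    ultimately show ?thesis by simp
  qed
  define N where "N = {\<lambda>x. q x ^ i * G x | i G m. i < d \<and> i + m = d \<and> forms_upto L m G}"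
  have "(\<lambda>x. F (\<rho> x) - F u * q x ^ d) \<in> span_on T N"
    unfolding N_def by (rule form_top_coefficient[OF F(1) \<rho>k gform])
  from span_on_scale[OF this, of "- 1 / F u"]
  have rel: "(\<lambda>x. q x ^ d) \<in> span_on T N"
    by (rule span_on_cong) (use Fu F(2) \<rho>W in auto)
  define E' where "E' = (\<lambda>(e, i) x. e x * q x ^ i) ` (E \<times> {..<d})"
  have "finite E'" unfolding E'_def using E(1) by simp
  moreover have "F \<in> span_on T {\<lambda>x. e x * g x | e g. e \<in> E' \<and> forms_upto L k g}" if "forms_upto coords k F" for k F
  proof (rule span_on_trans[OF E(2)[OF that]])
    fix s assume "s \<in> {\<lambda>x. e x * g x | e g. e \<in> E \<and> forms_upto ((\<lambda>i. dot (a i)) ` I) k g}"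
    then obtain e h where s: "s = (\<lambda>x. e x * h x)" "e \<in> E" "forms_upto ((\<lambda>i. dot (a i)) ` I) k h" by blast
    have "h \<in> span_on T {\<lambda>x. q x ^ i * G x | i G. i < d \<and> forms_upto L k G}"
    proof (rule finite_module_step[OF rel[unfolded N_def] s(3)])
      fix l assume "l \<in> (\<lambda>i. dot (a i)) ` I"
      then obtain i where i: "i \<in> I" "l = dot (a i)" by blast
      have "forms_upto L 1 (dot (a' i))"
      proof (cases "i = i0")
        case True
        then have "dot (a' i) = (\<lambda>_. 0)" using a'0 by auto
        then show ?thesis unfolding forms_upto_def by (simp add: forms_zero)
      next
        case False
        then show ?thesis using i by (intro forms_upto_gen) (auto simp: L_def I'_def)
      qed
      then show "\<exists>c g. forms_upto L 1 g \<and> (\<forall>x. l x = g x + c * q x)"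
        using i(2) q by blast
    qed
    then have "(\<lambda>x. e x * h x) \<in> span_on T {\<lambda>x. e x * g x | e g. e \<in> E' \<and> forms_upto L k g}"
    proof (rule span_on_image[where \<phi> = "\<lambda>x. x"])
      fix s assume "s \<in> {\<lambda>x. q x ^ i * G x | i G. i < d \<and> forms_upto L k G}"
      then obtain i G where sG: "s = (\<lambda>x. q x ^ i * G x)" "i < d" "forms_upto L k G" by blast
      have "(\<lambda>x. e x * q x ^ i) \<in> E'" unfolding E'_def using s(2) sG(2) by force
      then have "(\<lambda>x. (e x * q x ^ i) * G x) \<in> {\<lambda>x. e x * g x | e g. e \<in> E' \<and> forms_upto L k g}"
        using sG(3) by (intro CollectI exI[of _ "\<lambda>x. e x * q x ^ i"] exI[of _ G]) simp
      then have "(\<lambda>x. (e x * q x ^ i) * G x) \<in> span_on T {\<lambda>x. e x * g x | e g. e \<in> E' \<and> forms_upto L k g}"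
        by (rule span_on_base)
      then show "(\<lambda>x. e x * s x) \<in> span_on T {\<lambda>x. e x * g x | e g. e \<in> E' \<and> forms_upto L k g}"
        by (rule span_on_cong) (simp add: sG(1) mult.assoc)
    qed auto
    then show "s \<in> span_on T {\<lambda>x. e x * g x | e g. e \<in> E' \<and> forms_upto L k g}" using s(1) by simp
  qed
  ultimately show ?case using ch' unfolding L_def by blast
qed

lemma forms_upto_monomials:
  fixes l :: "'i \<Rightarrow> 'x \<Rightarrow> 'k::field"
  assumes "forms_upto (l ` I) k f" "finite I"
  shows "f \<in> span_on T ((\<lambda>\<alpha> x. \<Prod>i\<in>I. l i x ^ \<alpha> i) ` (I \<rightarrow>\<^sub>E {..k}))"
  using assms(1) unfolding forms_upto_def
proof induction
  case (forms_base r)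
  have "r \<in> span_on T {\<lambda>_. 1}"
    by (rule span_on_cong[OF span_on_scale[OF span_on_base[of "\<lambda>_. 1" "{\<lambda>_. 1}"], where c = "r undefined"]])
      (auto intro: alg_empty_const[OF forms_base])
  moreover have "(\<lambda>_. 1) \<in> (\<lambda>\<alpha> x. \<Prod>i\<in>I. l i x ^ \<alpha> i) ` (I \<rightarrow>\<^sub>E {..0})"
    by (rule image_eqI[of _ _ "restrict (\<lambda>_. 0) I"]) auto
  ultimately show ?case by (auto intro: span_on_mono)
next
  case (forms_gen g)
  have "(\<lambda>_. 1) \<in> (\<lambda>\<alpha> x. \<Prod>i\<in>I. l i x ^ \<alpha> i) ` (I \<rightarrow>\<^sub>E {..1})"
    by (rule image_eqI[of _ _ "restrict (\<lambda>_. 0) I"]) auto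
  moreover have "l j \<in> (\<lambda>\<alpha> x. \<Prod>i\<in>I. l i x ^ \<alpha> i) ` (I \<rightarrow>\<^sub>E {..1})" if j: "j \<in> I" for j
  proof (rule image_eqI[of _ _ "restrict (\<lambda>i. if i = j then 1 else 0) I"])
    have "(\<Prod>i\<in>I. l i x ^ restrict (\<lambda>i. if i = j then 1 else 0) I i) = l j x" for x
    proof -
      have "(\<Prod>i\<in>I. l i x ^ restrict (\<lambda>i. if i = j then 1 else 0) I i) = (\<Prod>i\<in>I. if i = j then l i x else 1)"
        by (rule prod.cong) auto
      then show ?thesis using assms(2) j by simp
    qed
    then show "l j = (\<lambda>x. \<Prod>i\<in>I. l i x ^ restrict (\<lambda>i. if i = j then 1 else 0) I i)" by simp
  qed auto
  ultimately show ?case using forms_gen by (intro span_on_base) auto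
next
  case (forms_zero d)
  then show ?case by (auto intro: span_on_zero)
next
  case (forms_add d f g)
  then show ?case by (auto intro: span_on_add)
next
  case (forms_mult d f e g)
  show ?case
  proof (rule span_on_mult[OF forms_mult.IH])
    fix s s' assume "s \<in> (\<lambda>\<alpha> x. \<Prod>i\<in>I. l i x ^ \<alpha> i) ` (I \<rightarrow>\<^sub>E {..d})" "s' \<in> (\<lambda>\<alpha> x. \<Prod>i\<in>I. l i x ^ \<alpha> i) ` (I \<rightarrow>\<^sub>E {..e})"
    then obtain \<alpha> \<beta> where ab: "\<alpha> \<in> I \<rightarrow>\<^sub>E {..d}" "\<beta> \<in> I \<rightarrow>\<^sub>E {..e}"
      "s = (\<lambda>x. \<Prod>i\<in>I. l i x ^ \<alpha> i)" "s' = (\<lambda>x. \<Prod>i\<in>I. l i x ^ \<beta> i)" by blast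
    show "(\<lambda>x. s x * s' x) \<in> span_on T ((\<lambda>\<alpha> x. \<Prod>i\<in>I. l i x ^ \<alpha> i) ` (I \<rightarrow>\<^sub>E {..d + e}))"
    proof (rule span_on_base, rule image_eqI[of _ _ "restrict (\<lambda>i. \<alpha> i + \<beta> i) I"])
      show "restrict (\<lambda>i. \<alpha> i + \<beta> i) I \<in> I \<rightarrow>\<^sub>E {..d + e}"
        using ab(1,2) by (auto simp: PiE_iff intro!: add_mono)
    qed (auto simp: ab(3,4) prod.distrib[symmetric] power_add intro!: prod.cong)
  qed
qed

text \<open>
  Polynomials of degree at most \<open>k\<close> span on \<open>T\<close> a space of dimension \<open>O(k ^ d)\<close>.
\<close>

definition spanned :: "('k::field ^ 'r) set \<Rightarrow> nat \<Rightarrow> bool" where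
  "spanned T d \<longleftrightarrow> (\<exists>A. \<forall>k. \<exists>S. finite S \<and> card S \<le> A * (k + 1) ^ d \<and>
     (\<forall>F. forms_upto coords k F \<longrightarrow> F \<in> span_on T S))"

lemma spanned_cone:
  fixes T :: "('k::{alg_closed_field,field_char_0} ^ 'r) set"
  assumes T: "zclosed T" "is_cone T" and vs: "indep_of T vs"
  obtains I a w where "chart vs I a w" "spanned T (card I)"
proof -
  obtain I a w E where ch: "chart vs I a w" and E: "finite E"
    "\<And>k F. forms_upto coords k F \<Longrightarrow>
       F \<in> span_on T {\<lambda>x. e x * g x | e g. e \<in> E \<and> forms_upto ((\<lambda>i. dot (a i)) ` I) k g}"
    using finite_module[OF assms] by blast
  have "spanned T (card I)"
    unfolding spanned_def
  proof (intro exI[of _ "card E"] allI)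
    fix k
    define M where "M = (\<lambda>\<alpha> x. \<Prod>i\<in>I. dot (a i) x ^ \<alpha> i) ` (I \<rightarrow>\<^sub>E {..k})"
    have finI: "finite I" by simp
    have finP: "finite (I \<rightarrow>\<^sub>E {..k})" by (rule finite_PiE) auto
    then have finM: "finite M" by (simp add: M_def)
    have "card M \<le> card (I \<rightarrow>\<^sub>E {..k})" unfolding M_def by (rule card_image_le[OF finP])
    also have "\<dots> = (k + 1) ^ card I" by (simp add: card_PiE)
    finally have cM: "card M \<le> (k + 1) ^ card I" .
    define S where "S = (\<lambda>(e, m) x. e x * m x) ` (E \<times> M)"
    have "finite S" unfolding S_def using E(1) finM by simp
    moreover have "card S \<le> card E * (k + 1) ^ card I"
    proof -
      have "card S \<le> card (E \<times> M)" unfolding S_def by (rule card_image_le) (use E(1) finM in simp)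
      also have "\<dots> = card E * card M" by (rule card_cartesian_product)
      also have "\<dots> \<le> card E * (k + 1) ^ card I" using cM by (rule mult_le_mono2)
      finally show ?thesis .
    qed
    moreover have "F \<in> span_on T S" if "forms_upto coords k F" for F
    proof (rule span_on_trans[OF E(2)[OF that]])
      fix s assume "s \<in> {\<lambda>x. e x * g x | e g. e \<in> E \<and> forms_upto ((\<lambda>i. dot (a i)) ` I) k g}"
      then obtain e g where s: "s = (\<lambda>x. e x * g x)" "e \<in> E" "forms_upto ((\<lambda>i. dot (a i)) ` I) k g" by blast
      have "g \<in> span_on T M" unfolding M_def by (rule forms_upto_monomials[OF s(3) finI])
      then have "(\<lambda>x. e x * g x) \<in> span_on T S"
      proof (rule span_on_image[where \<phi> = "\<lambda>x. x"])
        fix m assume "m \<in> M"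
        then show "(\<lambda>x. e x * m x) \<in> span_on T S"
          unfolding S_def using s(2) by (intro span_on_base) force
      qed auto
      then show "s \<in> span_on T S" using s(1) by simp
    qed
    ultimately show "\<exists>S. finite S \<and> card S \<le> card E * (k + 1) ^ card I \<and>
      (\<forall>F. forms_upto coords k F \<longrightarrow> F \<in> span_on T S)" by blast
  qed
  then show ?thesis using ch that by blast
qed

section \<open>Growth and algebraic dependence\<close>

text \<open>
  The weaker form of \<open>spanned\<close> that only speaks of linear dependence.  Unlike a spanning set, a
  dependence passes from pairs \<open>(x, y)\<close> to sums \<open>x + y\<close> and from a set to its closure.
\<close>

definition growth :: "('k::field ^ 'r) set \<Rightarrow> nat \<Rightarrow> bool" where
  "growth Z d \<longleftrightarrow> (\<exists>A. \<forall>k (g :: nat \<Rightarrow> _). (\<forall>j \<le> A * (k + 1) ^ d. forms_upto coords k (g j)) \<longrightarrow>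
     (\<exists>c. (\<exists>j \<le> A * (k + 1) ^ d. c j \<noteq> 0) \<and> (\<forall>z\<in>Z. (\<Sum>j \<le> A * (k + 1) ^ d. c j * g j z) = 0)))"

lemma spanned_growth: 
  fixes T :: "('k::field ^ 'r) set"
  assumes "spanned T d"
  shows "growth T d"
proof -
  have "spanned T d" by (rule assms)
  then obtain A where A: "\<And>k. \<exists>S. finite S \<and> card S \<le> A * (k + 1) ^ d \<and>
     (\<forall>F. forms_upto coords k F \<longrightarrow> F \<in> span_on T S)" unfolding spanned_def by blast
  show ?thesis
    unfolding growth_def
  proof (intro exI[of _ A] allI impI)
    fix k and g :: "nat \<Rightarrow> 'k ^ 'r \<Rightarrow> 'k" assume g: "\<forall>j \<le> A * (k + 1) ^ d. forms_upto coords k (g j)"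
    obtain S where S: "finite S" "card S \<le> A * (k + 1) ^ d" "\<And>F. forms_upto coords k F \<Longrightarrow> F \<in> span_on T S"
      using A[of k] by blast
    have "\<exists>c. (\<exists>j\<in>{..A * (k + 1) ^ d}. c j \<noteq> 0) \<and> (\<forall>x\<in>T. (\<Sum>j\<in>{..A * (k + 1) ^ d}. c j * g j x) = 0)"
      by (rule span_on_dependent[OF S(1)]) (use S(2,3) g in auto)
    then show "\<exists>c. (\<exists>j \<le> A * (k + 1) ^ d. c j \<noteq> 0) \<and> (\<forall>z\<in>T. (\<Sum>j \<le> A * (k + 1) ^ d. c j * g j z) = 0)"
      by (simp add: Bex_def)
  qed
qed

text \<open>
  The addition formula \<open>F (x + y) = \<Sum> G x * H y\<close>, with all degrees bounded by that of \<open>F\<close>.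
\<close>

lemma forms_upto_shift:
  fixes F :: "'k::field ^ 'r \<Rightarrow> 'k"
  assumes "forms_upto coords k F"
  shows "(\<lambda>p. F (fst p + snd p)) \<in> span_on U {\<lambda>p. G (fst p) * H (snd p) | G H. forms_upto coords k G \<and> forms_upto coords k H}"
proof -
  define M :: "nat \<Rightarrow> (('k ^ 'r) \<times> ('k ^ 'r) \<Rightarrow> 'k) set" where
    "M k = {\<lambda>p. G (fst p) * H (snd p) | G H. forms_upto coords k G \<and> forms_upto coords k H}" for k
  have MI: "(\<lambda>p. G (fst p) * H (snd p)) \<in> span_on U (M k)" if "forms_upto coords k G" "forms_upto coords k H" for k G H
    by (rule span_on_base) (use that in \<open>auto simp: M_def\<close>)
  have one: "forms_upto coords 1 (\<lambda>_. 1 :: 'k)" by (rule forms_upto_mono[OF forms_upto_const]) simp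
  have "(\<lambda>p. F (fst p + snd p)) \<in> span_on U (M k)"
    using assms unfolding forms_upto_def
  proof induction
    case (forms_base r)
    have "forms_upto coords 0 r" unfolding forms_upto_def by (rule forms.forms_base[OF forms_base])
    from MI[OF this forms_upto_const[of _ 1]] show ?case
      by (rule span_on_cong) (simp, rule alg_empty_const[OF forms_base])
  next
    case (forms_gen l)
    consider "l = (\<lambda>_. 1)" | i where "l = (\<lambda>x. x $ i)" using forms_gen by (auto elim: coords_cases)
    then show ?case
    proof cases
      case 1
      have "(\<lambda>p. 1 * 1) \<in> span_on U (M 1)" by (rule MI[OF one one])
      then show ?thesis using 1 by simp
    next
      case 2
      have l: "forms_upto coords 1 l" by (rule forms_upto_gen) (auto simp: 2 coords_def)
      from span_on_add[OF MI[OF l one] MI[OF one l]] show ?thesis by (simp add: 2)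
    qed
  next
    case (forms_zero d)
    then show ?case by (auto intro: span_on_zero)
  next
    case (forms_add d f g)
    then show ?case by (auto intro: span_on_add)
  next
    case (forms_mult d f e g)
    show ?case
    proof (rule span_on_mult[OF forms_mult.IH])
      fix s s' assume "s \<in> M d" "s' \<in> M e"
      then obtain G H G' H' where s: "s = (\<lambda>p. G (fst p) * H (snd p))" "forms_upto coords d G" "forms_upto coords d H"
        "s' = (\<lambda>p. G' (fst p) * H' (snd p))" "forms_upto coords e G'" "forms_upto coords e H'"
        unfolding M_def by blast
      from MI[OF forms_upto_mult[OF s(2,5)] forms_upto_mult[OF s(3,6)]]
      show "(\<lambda>x. s x * s' x) \<in> span_on U (M (d + e))" by (simp add: s mult_ac)
    qed
  qed
  then show ?thesis by (simp add: M_def)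
qed

text \<open>
  Products of a spanning set for \<open>T\<close> and one for \<open>C\<close> span the polynomials in \<open>x + y\<close>, which makes the
  exponents of growth additive.
\<close>

lemma growth_sum:
  fixes T C :: "('k::field ^ 'r) set"
  assumes T: "spanned T d" and C: "spanned C e"
  shows "growth {x + y | x y. x \<in> T \<and> y \<in> C} (d + e)"
proof -
  obtain A where A: "\<And>k. \<exists>S. finite S \<and> card S \<le> A * (k + 1) ^ d \<and>
     (\<forall>F. forms_upto coords k F \<longrightarrow> F \<in> span_on T S)" using T unfolding spanned_def by blast
  obtain B where B: "\<And>k. \<exists>S. finite S \<and> card S \<le> B * (k + 1) ^ e \<and>
     (\<forall>F. forms_upto coords k F \<longrightarrow> F \<in> span_on C S)" using C unfolding spanned_def by blast
  show ?thesis
    unfolding growth_def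
  proof (intro exI[of _ "A * B"] allI impI)
    fix k and g :: "nat \<Rightarrow> 'k ^ 'r \<Rightarrow> 'k"
    let ?N = "A * B * (k + 1) ^ (d + e)"
    assume g: "\<forall>j \<le> ?N. forms_upto coords k (g j)"
    obtain S where S: "finite S" "card S \<le> A * (k + 1) ^ d" "\<And>F. forms_upto coords k F \<Longrightarrow> F \<in> span_on T S"
      using A[of k] by blast
    obtain S' where S': "finite S'" "card S' \<le> B * (k + 1) ^ e" "\<And>F. forms_upto coords k F \<Longrightarrow> F \<in> span_on C S'"
      using B[of k] by blast
    define R where "R = (\<lambda>(s, s') p. s (fst p) * s' (snd p)) ` (S \<times> S')"
    have "card R \<le> card (S \<times> S')" unfolding R_def by (rule card_image_le) (use S(1) S'(1) in simp)
    also have "\<dots> = card S * card S'" by (rule card_cartesian_product)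
    also have "\<dots> \<le> (A * (k + 1) ^ d) * (B * (k + 1) ^ e)" by (rule mult_le_mono[OF S(2) S'(2)])
    also have "\<dots> = ?N" by (simp add: power_add)
    finally have cR: "card R < card {..?N}" by simp
    have gR: "(\<lambda>p. g j (fst p + snd p)) \<in> span_on (T \<times> C) R" if "j \<in> {..?N}" for j
    proof (rule span_on_trans[OF forms_upto_shift])
      show "forms_upto coords k (g j)" using g that by simp
      fix s :: "('k ^ 'r) \<times> ('k ^ 'r) \<Rightarrow> 'k"
      assume "s \<in> {\<lambda>p. G (fst p) * H (snd p) | G H. forms_upto coords k G \<and> forms_upto coords k H}"
      then obtain G H :: "'k ^ 'r \<Rightarrow> 'k" where s: "s = (\<lambda>p. G (fst p) * H (snd p))" "forms_upto coords k G" "forms_upto coords k H"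
        by blast
      have G1: "(\<lambda>p :: ('k ^ 'r) \<times> ('k ^ 'r). 1 * G (fst p)) \<in> span_on (T \<times> C) ((\<lambda>s p. s (fst p)) ` S)"
        by (rule span_on_image[OF S(3)[OF s(2)], where \<phi> = fst]) (auto intro: span_on_base)
      have H1: "(\<lambda>p :: ('k ^ 'r) \<times> ('k ^ 'r). 1 * H (snd p)) \<in> span_on (T \<times> C) ((\<lambda>s p. s (snd p)) ` S')"
        by (rule span_on_image[OF S'(3)[OF s(3)], where \<phi> = snd]) (auto intro: span_on_base)
      have "(\<lambda>p. (1 * G (fst p)) * (1 * H (snd p))) \<in> span_on (T \<times> C) R"
      proof (rule span_on_mult[OF G1 H1])
        fix a b :: "('k ^ 'r) \<times> ('k ^ 'r) \<Rightarrow> 'k"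
        assume "a \<in> (\<lambda>s p. s (fst p)) ` S" "b \<in> (\<lambda>s p. s (snd p)) ` S'"
        then show "(\<lambda>x. a x * b x) \<in> span_on (T \<times> C) R"
          by (intro span_on_base) (auto simp: R_def image_iff)
      qed
      then show "s \<in> span_on (T \<times> C) R" by (simp add: s(1))
    qed
    have "finite R" unfolding R_def using S(1) S'(1) by simp
    then have "\<exists>c. (\<exists>j\<in>{..?N}. c j \<noteq> 0) \<and> (\<forall>p\<in>T \<times> C. (\<Sum>j\<le>?N. c j * g j (fst p + snd p)) = 0)"
      by (rule span_on_dependent[OF _ finite_atMost cR gR])
    then obtain c j where c: "j \<in> {..?N}" "c j \<noteq> 0" "\<forall>p\<in>T \<times> C. (\<Sum>j\<le>?N. c j * g j (fst p + snd p)) = 0"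
      by (elim exE conjE bexE)
    have "\<forall>z\<in>{x + y | x y. x \<in> T \<and> y \<in> C}. (\<Sum>j\<le>?N. c j * g j z) = 0"
    proof
      fix z assume "z \<in> {x + y | x y. x \<in> T \<and> y \<in> C}"
      then obtain x y where "z = x + y" "(x, y) \<in> T \<times> C" by blast
      then show "(\<Sum>j\<le>?N. c j * g j z) = 0" using bspec[OF c(3), of "(x, y)"] by simp
    qed
    then show "\<exists>c. (\<exists>j\<le>?N. c j \<noteq> 0) \<and> (\<forall>z\<in>{x + y | x y. x \<in> T \<and> y \<in> C}. (\<Sum>j\<le>?N. c j * g j z) = 0)"
      using c(1,2) by blast
  qed
qed

lemma growth_closure: 
  fixes Z :: "('k::field ^ 'r) set"
  assumes "growth Z d" shows "growth (zclosure Z) d"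
proof -
  obtain A where A: "\<And>k (g :: nat \<Rightarrow> _). (\<forall>j \<le> A * (k + 1) ^ d. forms_upto coords k (g j)) \<Longrightarrow>
     (\<exists>c. (\<exists>j \<le> A * (k + 1) ^ d. c j \<noteq> 0) \<and> (\<forall>z\<in>Z. (\<Sum>j \<le> A * (k + 1) ^ d. c j * g j z) = 0))"
    using assms unfolding growth_def by blast
  show ?thesis
    unfolding growth_def
  proof (intro exI[of _ A] allI impI)
    fix k and g :: "nat \<Rightarrow> 'k ^ 'r \<Rightarrow> 'k" assume g: "\<forall>j \<le> A * (k + 1) ^ d. forms_upto coords k (g j)"
    from A[OF g] obtain c j where c: "j \<le> A * (k + 1) ^ d" "c j \<noteq> 0" "\<And>z. z \<in> Z \<Longrightarrow> (\<Sum>j \<le> A * (k + 1) ^ d. c j * g j z) = 0"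
      by blast
    have "(\<lambda>z. \<Sum>j \<le> A * (k + 1) ^ d. c j * g j z) \<in> alg coords"
    proof (intro alg_sum alg_mult alg_const)
      fix j assume "j \<in> {..A * (k + 1) ^ d}"
      then have "forms_upto coords k (g j)" using g by simp
      then show "g j \<in> alg coords" unfolding forms_upto_def
        by (rule forms_alg) (auto intro: alg_mono alg_gen alg_const)
    qed
    from zero_closure_vanish[OF this c(3)] c(1,2)
    show "\<exists>c. (\<exists>j \<le> A * (k + 1) ^ d. c j \<noteq> 0) \<and> (\<forall>z\<in>zclosure Z. (\<Sum>j \<le> A * (k + 1) ^ d. c j * g j z) = 0)"
      by blast
  qed
qed

text \<open>
  A polynomial of degree \<open>d + 1\<close> in \<open>k\<close> outgrows one of degree \<open>d\<close>, also when the degrees of the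
  functions involved are multiplied by a constant \<open>q\<close>.
\<close>

lemma growth_dependent:
  fixes Z :: "('k::field ^ 'r) set"
  assumes "growth Z d"
  obtains k where "\<And>(J :: 'j set) g. finite J \<Longrightarrow> (k + 1) ^ (d + 1) \<le> card J \<Longrightarrow>
     (\<And>j. j \<in> J \<Longrightarrow> forms_upto coords (q * k) (g j)) \<Longrightarrow>
     \<exists>c. (\<exists>j\<in>J. c j \<noteq> 0) \<and> (\<forall>z\<in>Z. (\<Sum>j\<in>J. c j * g j z) = 0)"
proof -
  obtain A where A: "\<And>k (g :: nat \<Rightarrow> _). (\<forall>j \<le> A * (k + 1) ^ d. forms_upto coords k (g j)) \<Longrightarrow>
     (\<exists>c. (\<exists>j \<le> A * (k + 1) ^ d. c j \<noteq> 0) \<and> (\<forall>z\<in>Z. (\<Sum>j \<le> A * (k + 1) ^ d. c j * g j z) = 0))"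
    using assms unfolding growth_def by blast
  \<comment> \<open>As \<open>(q k + 1) ^ d \<le> (q + 1) ^ d * (k + 1) ^ d\<close>, the bound needed is \<open>A * (q + 1) ^ d < k + 1\<close>.\<close>
  define k where "k = A * (q + 1) ^ d"
  let ?N = "A * (q * k + 1) ^ d"
  have N: "?N < (k + 1) ^ (d + 1)"
  proof -
    have "(q * k + 1) ^ d \<le> ((q + 1) * (k + 1)) ^ d" by (intro power_mono) auto
    then have "?N \<le> A * ((q + 1) ^ d * (k + 1) ^ d)"
      unfolding power_mult_distrib by (rule mult_le_mono2)
    also have "\<dots> = k * (k + 1) ^ d" by (simp add: k_def)
    also have "\<dots> < (k + 1) ^ (d + 1)" by simp
    finally show ?thesis .
  qed
  show ?thesis
  proof (rule that[of k])
    fix J :: "'j set" and g :: "'j \<Rightarrow> 'k ^ 'r \<Rightarrow> 'k"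
    assume J: "finite J" "(k + 1) ^ (d + 1) \<le> card J"
      and g: "\<And>j. j \<in> J \<Longrightarrow> forms_upto coords (q * k) (g j)"
    have "card {..?N} \<le> card J" using N J(2) by simp
    then obtain h where h: "h ` {..?N} \<subseteq> J" "inj_on h {..?N}"
      using card_le_inj[of "{..?N}" J] J(1) by auto
    have "\<forall>j \<le> A * (q * k + 1) ^ d. forms_upto coords (q * k) (g (h j))"
      using h(1) g by auto
    from A[OF this] obtain c j0 where c: "j0 \<le> ?N" "c j0 \<noteq> 0" "\<And>z. z \<in> Z \<Longrightarrow> (\<Sum>j\<le>?N. c j * g (h j) z) = 0"
      by blast
    define c' where "c' j = (if j \<in> h ` {..?N} then c (the_inv_into {..?N} h j) else 0)" for j
    have c'h: "c' (h j) = c j" if "j \<in> {..?N}" for j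
      using that h(2) by (simp add: c'_def the_inv_into_f_f)
    have "(\<Sum>j\<in>J. c' j * g j z) = 0" if "z \<in> Z" for z
    proof -
      have "(\<Sum>j\<in>J. c' j * g j z) = (\<Sum>j\<in>h ` {..?N}. c' j * g j z)"
        by (rule sum.mono_neutral_right) (use J h in \<open>auto simp: c'_def\<close>)
      also have "\<dots> = (\<Sum>j\<le>?N. c j * g (h j) z)"
        using c'h by (subst sum.reindex[OF h(2)]) (auto intro!: sum.cong)
      finally show ?thesis using c(3)[OF that] by simp
    qed
    moreover have "c' (h j0) \<noteq> 0" "h j0 \<in> J" using c'h[of j0] c h by auto
    ultimately show "\<exists>c. (\<exists>j\<in>J. c j \<noteq> 0) \<and> (\<forall>z\<in>Z. (\<Sum>j\<in>J. c j * g j z) = 0)" by blast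
  qed
qed

lemma monomials_independent:
  fixes c :: "('i \<Rightarrow> nat) \<Rightarrow> 'k::field_char_0"
  assumes "finite I" "\<And>x :: 'i \<Rightarrow> 'k. (\<Sum>\<alpha>\<in>I \<rightarrow>\<^sub>E {..k}. c \<alpha> * (\<Prod>i\<in>I. x i ^ \<alpha> i)) = 0" "\<alpha> \<in> I \<rightarrow>\<^sub>E {..k}"
  shows "c \<alpha> = 0"
  using assms
proof (induction I arbitrary: c \<alpha>)
  case empty
  then show ?case by simp
next
  case (insert i I)
  have inj: "inj_on (\<lambda>(y, g). g(i := y)) ({..k} \<times> (I \<rightarrow>\<^sub>E {..k}))"
    using inj_combinator[OF insert(2), of "\<lambda>_. {..k}"] by simp
  have split: "(\<Sum>\<alpha>\<in>insert i I \<rightarrow>\<^sub>E {..k}. c \<alpha> * (\<Prod>i\<in>insert i I. x i ^ \<alpha> i))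
     = (\<Sum>j\<le>k. x i ^ j * (\<Sum>\<beta>\<in>I \<rightarrow>\<^sub>E {..k}. c (\<beta>(i := j)) * (\<Prod>l\<in>I. x l ^ \<beta> l)))" for x :: "'i \<Rightarrow> 'k"
  proof -
    have "(\<Sum>\<alpha>\<in>insert i I \<rightarrow>\<^sub>E {..k}. c \<alpha> * (\<Prod>i\<in>insert i I. x i ^ \<alpha> i))
      = (\<Sum>(j, \<beta>)\<in>{..k} \<times> (I \<rightarrow>\<^sub>E {..k}). c (\<beta>(i := j)) * (\<Prod>l\<in>insert i I. x l ^ (\<beta>(i := j)) l))"
      by (subst PiE_insert_eq, subst sum.reindex[OF inj]) (simp add: o_def case_prod_beta)
    also have "\<dots> = (\<Sum>(j, \<beta>)\<in>{..k} \<times> (I \<rightarrow>\<^sub>E {..k}). x i ^ j * (c (\<beta>(i := j)) * (\<Prod>l\<in>I. x l ^ \<beta> l)))"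
    proof (rule sum.cong[OF refl], clarify)
      fix j \<beta>
      have "(\<Prod>l\<in>insert i I. x l ^ (\<beta>(i := j)) l) = x i ^ j * (\<Prod>l\<in>I. x l ^ (\<beta>(i := j)) l)"
        using insert by simp
      also have "(\<Prod>l\<in>I. x l ^ (\<beta>(i := j)) l) = (\<Prod>l\<in>I. x l ^ \<beta> l)"
        by (rule prod.cong) (use insert in auto)
      finally show "c (\<beta>(i := j)) * (\<Prod>l\<in>insert i I. x l ^ (\<beta>(i := j)) l) =
        x i ^ j * (c (\<beta>(i := j)) * (\<Prod>l\<in>I. x l ^ \<beta> l))" by (simp add: mult_ac)
    qed
    finally show ?thesis
      by (simp add: sum.cartesian_product[symmetric] sum_distrib_left)
  qed
  obtain j \<beta> where jb: "\<alpha> = \<beta>(i := j)" "j \<le> k" "\<beta> \<in> I \<rightarrow>\<^sub>E {..k}"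
    using insert.prems(2) unfolding PiE_insert_eq by auto
  show ?case
    unfolding jb(1)
  proof (rule insert.IH[where c = "\<lambda>\<beta>. c (\<beta>(i := j))", OF _ jb(3)])
    fix x :: "'i \<Rightarrow> 'k"
    show "(\<Sum>\<beta>\<in>I \<rightarrow>\<^sub>E {..k}. c (\<beta>(i := j)) * (\<Prod>l\<in>I. x l ^ \<beta> l)) = 0"
    proof (rule polynomial_coeffs_zero[where c = "\<lambda>j. \<Sum>\<beta>\<in>I \<rightarrow>\<^sub>E {..k}. c (\<beta>(i := j)) * (\<Prod>l\<in>I. x l ^ \<beta> l)", OF _ jb(2)])
      fix s
      have "(\<Sum>\<beta>\<in>I \<rightarrow>\<^sub>E {..k}. c (\<beta>(i := j)) * (\<Prod>l\<in>I. (x(i := s)) l ^ \<beta> l)) =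
         (\<Sum>\<beta>\<in>I \<rightarrow>\<^sub>E {..k}. c (\<beta>(i := j)) * (\<Prod>l\<in>I. x l ^ \<beta> l))" for j
        by (intro sum.cong arg_cong2[where f = "(*)"] prod.cong) (use insert in auto)
      then show "(\<Sum>j\<le>k. s ^ j * (\<Sum>\<beta>\<in>I \<rightarrow>\<^sub>E {..k}. c (\<beta>(i := j)) * (\<Prod>l\<in>I. x l ^ \<beta> l))) = 0"
        using insert.prems(1)[of "x(i := s)"] unfolding split by simp
    qed
  qed
qed

lemma chart_monomials_independent:
  fixes c :: "('r::finite \<Rightarrow> nat) \<Rightarrow> 'k::field_char_0"
  assumes ch: "chart vs I a w" and "I' \<subseteq> I"
    and "\<And>x. (\<Sum>\<alpha>\<in>I' \<rightarrow>\<^sub>E {..k}. c \<alpha> * (\<Prod>i\<in>I'. dot (a i) x ^ \<alpha> i)) = 0" "\<alpha> \<in> I' \<rightarrow>\<^sub>E {..k}"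
  shows "c \<alpha> = 0"
proof (rule monomials_independent[where I = I' and k = k and c = c, OF _ _ assms(4)])
  fix t :: "'r \<Rightarrow> 'k"
  define x where "x = (\<Sum>i\<in>I. t i *s w i)"
  have "dot (a j) x = t j" if "j \<in> I'" for j
  proof -
    have "dot (a j) x = (\<Sum>i\<in>I. t i * (if j = i then 1 else 0))"
      unfolding x_def dot_sum dot_scale
      by (rule sum.cong) (use ch that assms(2) in \<open>auto simp: chart_def\<close>)
    then show ?thesis using that assms(2) by (simp add: if_distrib cong: if_cong) auto
  qed
  then show "(\<Sum>\<alpha>\<in>I' \<rightarrow>\<^sub>E {..k}. c \<alpha> * (\<Prod>i\<in>I'. t i ^ \<alpha> i)) = 0"
    using assms(3)[of x] by simp
qed simp

lemma monomial_forms_upto: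
  assumes "\<And>i. i \<in> I \<Longrightarrow> \<alpha> i \<le> k" "finite I"
  shows "forms_upto coords (card I * k) (\<lambda>x. \<Prod>i\<in>I. dot (a i) x ^ \<alpha> i)"
proof -
  have "forms_upto coords (\<Sum>i\<in>I. \<alpha> i * 1) (\<lambda>x. \<Prod>i\<in>I. dot (a i) x ^ \<alpha> i)"
  proof (intro forms_upto_prod forms_upto_power)
    fix i
    show "forms_upto coords 1 (dot (a i))"
      unfolding forms_upto_def dot_def
      by (intro forms_sum forms_cmult forms_gen) (auto simp: coords_def)
  qed
  moreover have "(\<Sum>i\<in>I. \<alpha> i * 1) \<le> card I * k"
    using sum_bounded_above[of I \<alpha> k] assms(1) by simp
  ultimately show ?thesis by (rule forms_upto_mono)
qed

text \<open>
  If \<open>Z\<close> surjects onto the quotient with coordinates \<open>I\<close>, these coordinates are algebraically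
  independent on \<open>Z\<close>, whereas \<open>d + 1\<close> of them have more monomials than growth of order \<open>d\<close> allows.
\<close>

lemma growth_lower_bound:
  fixes Z :: "('k::field_char_0 ^ 'r) set"
  assumes "growth Z d" "chart vs I a w" "add_span Z vs = UNIV"
  shows "card I \<le> d"
proof (rule ccontr)
  assume "\<not> card I \<le> d"
  then obtain I' where I': "I' \<subseteq> I" "card I' = d + 1"
    by (metis Suc_eq_plus1 not_less_eq_eq obtain_subset_with_card_n)
  have finI': "finite I'" by simp
  obtain k where k: "\<And>(J :: ('r \<Rightarrow> nat) set) g. finite J \<Longrightarrow> (k + 1) ^ (d + 1) \<le> card J \<Longrightarrow>
     (\<And>j. j \<in> J \<Longrightarrow> forms_upto coords ((d + 1) * k) (g j)) \<Longrightarrow>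
     \<exists>c. (\<exists>j\<in>J. c j \<noteq> 0) \<and> (\<forall>z\<in>Z. (\<Sum>j\<in>J. c j * g j z) = 0)"
    using growth_dependent[OF assms(1)] by blast
  have "\<exists>c. (\<exists>\<alpha>\<in>I' \<rightarrow>\<^sub>E {..k}. c \<alpha> \<noteq> 0) \<and>
    (\<forall>z\<in>Z. (\<Sum>\<alpha>\<in>I' \<rightarrow>\<^sub>E {..k}. c \<alpha> * (\<Prod>i\<in>I'. dot (a i) z ^ \<alpha> i)) = 0)"
  proof (rule k)
    show "finite (I' \<rightarrow>\<^sub>E {..k})" by (rule finite_PiE) auto
    show "(k + 1) ^ (d + 1) \<le> card (I' \<rightarrow>\<^sub>E {..k})" using I' by (simp add: card_PiE)
    show "forms_upto coords ((d + 1) * k) (\<lambda>z. \<Prod>i\<in>I'. dot (a i) z ^ \<alpha> i)" if "\<alpha> \<in> I' \<rightarrow>\<^sub>E {..k}" for \<alpha>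
      using monomial_forms_upto[of I' \<alpha> k a] that I' by (auto simp: PiE_iff)
  qed
  then obtain c \<alpha> where c: "\<alpha> \<in> I' \<rightarrow>\<^sub>E {..k}" "c \<alpha> \<noteq> 0"
    "\<And>z. z \<in> Z \<Longrightarrow> (\<Sum>\<alpha>\<in>I' \<rightarrow>\<^sub>E {..k}. c \<alpha> * (\<Prod>i\<in>I'. dot (a i) z ^ \<alpha> i)) = 0" by blast
  have "(\<Sum>\<alpha>\<in>I' \<rightarrow>\<^sub>E {..k}. c \<alpha> * (\<Prod>i\<in>I'. dot (a i) x ^ \<alpha> i)) = 0" for x
  proof -
    obtain z where z: "z \<in> Z" "x - z \<in> vec.span (set vs)"
      using assms(3) by (metis add_span_iff UNIV_I)
    have "dot (a i) x = dot (a i) z" if "i \<in> I'" for i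
      using chart_span[OF assms(2) _ z(2), of i] that I' by (auto simp: dot_diff)
    then show ?thesis using c(3)[OF z(1)] by simp
  qed
  from chart_monomials_independent[OF assms(2) I'(1) this c(1)] c(2) show False by simp
qed

text \<open>
  The norm of \<open>f\<close>.  Growth yields an algebraic relation \<open>\<Sum> g j * f ^ j = 0\<close> on \<open>T\<close> in which the \<open>g j\<close>
  are polynomials on the quotient.  Dividing by the lowest power of \<open>f\<close> that occurs, which is possible
  as \<open>T\<close> is irreducible, leaves a nonzero constant term \<open>g j0\<close>.  It vanishes wherever \<open>f\<close> does, so the
  zeros of \<open>f\<close> project into a proper closed subset.
\<close>

lemma proper_zero_set_projection:
  fixes T :: "('k::{alg_closed_field,field_char_0} ^ 'r) set"
  assumes T: "zclosed T" "is_cone T" "zprime T" and vs: "indep_of T vs"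
    and f: "f \<in> alg coords" "\<exists>x\<in>T. f x \<noteq> 0"
  shows "add_span {x \<in> T. f x = 0} vs \<noteq> UNIV"
proof -
  obtain I a w where ch: "chart vs I a w" and sp: "spanned T (card I)"
    using spanned_cone[OF T(1,2) vs] by blast
  define d where "d = card I"
  obtain e where e: "forms_upto coords e f" using alg_forms_upto[OF f(1)] by blast
  obtain k where k: "\<And>(J :: (nat \<times> ('r \<Rightarrow> nat)) set) g. finite J \<Longrightarrow> (k + 1) ^ (d + 1) \<le> card J \<Longrightarrow>
     (\<And>j. j \<in> J \<Longrightarrow> forms_upto coords ((e + d) * k) (g j)) \<Longrightarrow>
     \<exists>c. (\<exists>j\<in>J. c j \<noteq> 0) \<and> (\<forall>z\<in>T. (\<Sum>j\<in>J. c j * g j z) = 0)"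
    using growth_dependent[OF spanned_growth[OF sp]] unfolding d_def by blast
  let ?J = "{..k} \<times> (I \<rightarrow>\<^sub>E {..k})"
  have finP: "finite (I \<rightarrow>\<^sub>E {..k})" by (rule finite_PiE) auto
  have "\<exists>c. (\<exists>j\<in>?J. c j \<noteq> 0) \<and>
    (\<forall>z\<in>T. (\<Sum>j\<in>?J. c j * (f z ^ fst j * (\<Prod>i\<in>I. dot (a i) z ^ snd j i))) = 0)"
  proof (rule k)
    show "finite ?J" using finP by simp
    show "(k + 1) ^ (d + 1) \<le> card ?J" by (simp add: card_cartesian_product card_PiE d_def)
    fix j assume j: "j \<in> ?J"
    have "forms_upto coords (fst j * e + card I * k) (\<lambda>z. f z ^ fst j * (\<Prod>i\<in>I. dot (a i) z ^ snd j i))"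
      by (intro forms_upto_mult forms_upto_power[OF e] monomial_forms_upto) (use j in \<open>auto simp: PiE_iff\<close>)
    moreover have "fst j * e + card I * k \<le> (e + d) * k"
      using j mult_le_mono1[of "fst j" k e] by (auto simp: d_def algebra_simps)
    ultimately show "forms_upto coords ((e + d) * k) (\<lambda>z. f z ^ fst j * (\<Prod>i\<in>I. dot (a i) z ^ snd j i))"
      by (rule forms_upto_mono)
  qed
  then obtain c j1 \<beta>1 where c1: "j1 \<le> k" "\<beta>1 \<in> I \<rightarrow>\<^sub>E {..k}" "c (j1, \<beta>1) \<noteq> 0"
    and rel: "\<And>z. z \<in> T \<Longrightarrow> (\<Sum>j\<in>?J. c j * (f z ^ fst j * (\<Prod>i\<in>I. dot (a i) z ^ snd j i))) = 0"
    by fastforce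
  define g where "g j x = (\<Sum>\<beta>\<in>I \<rightarrow>\<^sub>E {..k}. c (j, \<beta>) * (\<Prod>i\<in>I. dot (a i) x ^ \<beta> i))" for j x
  have galg: "g j \<in> alg coords" for j
    unfolding g_def
    by (intro alg_sum alg_mult alg_const alg_prod alg_power forms_alg[OF dot_form])
      (auto intro: alg_mono alg_gen)
  have rel': "(\<Sum>j\<le>k. f z ^ j * g j z) = 0" if "z \<in> T" for z
  proof -
    have "(\<Sum>j\<le>k. f z ^ j * g j z) = (\<Sum>j\<le>k. \<Sum>\<beta>\<in>I \<rightarrow>\<^sub>E {..k}. c (j, \<beta>) * (f z ^ j * (\<Prod>i\<in>I. dot (a i) z ^ \<beta> i)))"
      unfolding g_def sum_distrib_left by (simp only: mult_ac)
    then show ?thesis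
      using rel[OF that] by (simp add: sum.cartesian_product case_prod_unfold)
  qed
  have ginv: "g j x = g j y" if "x - y \<in> vec.span (set vs)" for j x y
  proof -
    have "dot (a i) x = dot (a i) y" if "i \<in> I" for i
      using chart_span[OF ch that \<open>x - y \<in> vec.span (set vs)\<close>] by (simp add: dot_diff)
    then show ?thesis by (simp add: g_def)
  qed
  have "\<exists>x. g j1 x \<noteq> 0"
  proof (rule ccontr)
    assume "\<not> ?thesis"
    then have "c (j1, \<beta>1) = 0"
      by (intro chart_monomials_independent[OF ch order_refl _ c1(2), of "\<lambda>\<beta>. c (j1, \<beta>)"]) (simp add: g_def)
    then show False using c1(3) by simp
  qed
  \<comment> \<open>The lowest power of \<open>f\<close> whose coefficient is not identically zero.\<close>
  define j0 where "j0 = (LEAST j. \<exists>x. g j x \<noteq> 0)"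
  have j0: "\<exists>x. g j0 x \<noteq> 0" and least: "\<And>j x. j < j0 \<Longrightarrow> g j x = 0"
    unfolding j0_def using LeastI[of "\<lambda>j. \<exists>x. g j x \<noteq> 0", OF \<open>\<exists>x. g j1 x \<noteq> 0\<close>]
    by (auto dest: not_less_Least)
  have "j0 \<le> k" unfolding j0_def using Least_le[of "\<lambda>j. \<exists>x. g j x \<noteq> 0", OF \<open>\<exists>x. g j1 x \<noteq> 0\<close>] c1(1) by simp
  define h where "h z = (\<Sum>j\<in>{j0..k}. f z ^ (j - j0) * g j z)" for z
  have halg: "h \<in> alg coords" unfolding h_def by (intro alg_sum alg_mult alg_power f(1) galg)
  have "f z ^ j0 * h z = 0" if "z \<in> T" for z
  proof -
    have "(\<Sum>j\<le>k. f z ^ j * g j z) = (\<Sum>j\<in>{j0..k}. f z ^ j * g j z)"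
      by (rule sum.mono_neutral_right) (auto simp: least)
    also have "\<dots> = f z ^ j0 * h z"
      unfolding h_def sum_distrib_left
      by (rule sum.cong) (auto simp: mult.assoc[symmetric] power_add[symmetric])
    finally show ?thesis using rel'[OF that] by simp
  qed
  from zero_primeD[OF T(3) alg_power[OF f(1)] halg this] f(2)
  have h0: "\<And>z. z \<in> T \<Longrightarrow> h z = 0" by auto
  have gz: "g j0 z = 0" if "z \<in> T" "f z = 0" for z
  proof -
    have "h z = (\<Sum>j\<in>{j0..k}. if j = j0 then g j z else 0)"
      unfolding h_def by (rule sum.cong) (use that in auto)
    then show ?thesis using h0[OF that(1)] \<open>j0 \<le> k\<close> by simp
  qed
  obtain x where x: "g j0 x \<noteq> 0" using j0 by blast
  have "x \<notin> add_span {x \<in> T. f x = 0} vs"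
    using x gz ginv[of x _ j0] by (auto simp: add_span_iff)
  then show ?thesis by blast
qed

section \<open>The dimension of a cone\<close>

text \<open>
  The codimension of a subspace that is complementary to \<open>T\<close> in the sense of a linear Noether
  normalization.
\<close>

definition has_dim :: "('k::field ^ 'r) set \<Rightarrow> nat \<Rightarrow> bool" where
  "has_dim T d \<longleftrightarrow> (\<exists>vs. indep_of T vs \<and> add_span T vs = UNIV \<and> length vs + d = CARD('r))"

lemma has_dim_exists:
  fixes T :: "('k::field ^ 'r) set"
  assumes "is_cone T" obtains d where "has_dim T d"
proof -
  obtain us where "indep_of T (us @ [])" "add_span T (us @ []) = UNIV"
    using indep_of_extend[of T "[]"] cone_0[OF assms] by auto
  then have us: "indep_of T us" "add_span T us = UNIV" by auto
  then have "has_dim T (CARD('r) - length us)"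
    unfolding has_dim_def using indep_of_length(1)[OF us(1) cone_0[OF assms]]
    by (intro exI[of _ us]) auto
  then show ?thesis by (rule that)
qed

lemma has_dim_spanned:
  fixes T :: "('k::{alg_closed_field,field_char_0} ^ 'r) set"
  assumes "zclosed T" "is_cone T" "has_dim T d"
  shows "spanned T d"
proof -
  obtain vs where vs: "indep_of T vs" "length vs + d = CARD('r)" using assms(3) by (auto simp: has_dim_def)
  obtain I a w where "chart vs I a w" "spanned T (card I)" using spanned_cone[OF assms(1,2) vs(1)] by blast
  moreover from this have "card I = d" using vs(2) by (simp add: chart_def)
  ultimately show ?thesis by simp
qed

lemma has_dim_le_growth:
  fixes T :: "('k::{alg_closed_field,field_char_0} ^ 'r) set"
  assumes "zclosed T" "is_cone T" "has_dim T d" "growth T e"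
  shows "d \<le> e"
proof -
  obtain vs where vs: "indep_of T vs" "add_span T vs = UNIV" "length vs + d = CARD('r)"
    using assms(3) by (auto simp: has_dim_def)
  obtain I a w where ch: "chart vs I a w" using spanned_cone[OF assms(1,2) vs(1)] by blast
  then have "card I = d" using vs(3) by (simp add: chart_def)
  then show ?thesis using growth_lower_bound[OF assms(4) ch vs(2)] by simp
qed

lemma has_dim_unique:
  fixes T :: "('k::{alg_closed_field,field_char_0} ^ 'r) set"
  assumes "zclosed T" "is_cone T" "has_dim T d" "has_dim T e"
  shows "d = e"
proof (rule antisym)
  show "d \<le> e"
    by (rule has_dim_le_growth[OF assms(1-3) spanned_growth[OF has_dim_spanned[OF assms(1,2,4)]]])
  show "e \<le> d"
    by (rule has_dim_le_growth[OF assms(1,2,4) spanned_growth[OF has_dim_spanned[OF assms(1-3)]]])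
qed

text \<open>
  The inequality behind all dimension counts for secant varieties.
\<close>

lemma has_dim_sum_le:
  fixes T C :: "('k::{alg_closed_field,field_char_0} ^ 'r) set"
  assumes "zclosed T" "is_cone T" "has_dim T d"
    "zclosed C" "is_cone C" "has_dim C e"
    "is_cone {x + y | x y. x \<in> T \<and> y \<in> C}"
    "has_dim (zclosure {x + y | x y. x \<in> T \<and> y \<in> C}) q"
  shows "q \<le> d + e"
  by (rule has_dim_le_growth[OF zero_closed_closure cone_closure[OF assms(7)] assms(8)
        growth_closure[OF growth_sum[OF has_dim_spanned[OF assms(1-3)] has_dim_spanned[OF assms(4-6)]]]])

section \<open>Krull dimension of cones\<close>

lemma alg_line:
  assumes "f \<in> alg coords"
  obtains P where "\<And>t. poly P t = f (x + t *s y)"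
proof -
  have "\<exists>P. \<forall>t. poly P t = f (x + t *s y)"
    using assms
  proof induction
    case (alg_const c)
    show ?case by (intro exI[of _ "[:c:]"]) simp
  next
    case (alg_gen g)
    then obtain i where "g = (\<lambda>x. x $ i)" by (rule coords_cases)
    then show ?case by (intro exI[of _ "[:x $ i, y $ i:]"]) simp
  next
    case (alg_add f g)
    then obtain P Q where "\<forall>t. poly P t = f (x + t *s y)" "\<forall>t. poly Q t = g (x + t *s y)" by blast
    then show ?case by (intro exI[of _ "P + Q"]) simp
  next
    case (alg_mult f g)
    then obtain P Q where "\<forall>t. poly P t = f (x + t *s y)" "\<forall>t. poly Q t = g (x + t *s y)" by blast
    then show ?case by (intro exI[of _ "P * Q"]) simp
  qed
  then show ?thesis using that by blast
qed

lemma poly_nonroot: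
  fixes P :: "'k::field_char_0 poly"
  assumes "P \<noteq> 0" obtains t where "poly P t \<noteq> 0"
  using assms poly_all_0_iff_0[of P] by blast

lemma indep_of_meet_span:
  assumes "is_cone T" "indep_of T vs" "x \<in> T" "x \<in> vec.span (set vs)"
  shows "x = 0"
  using assms(2,4)
proof (induction vs)
  case (Cons v vs)
  then obtain t where t: "x - t *s v \<in> vec.span (set vs)" by (auto simp: vec.span_breakdown_eq)
  show ?case
  proof (cases "t = 0")
    case True
    then show ?thesis using Cons t by auto
  next
    case False
    have "(- inverse t) *s (x - t *s v) \<in> vec.span (set vs)" by (rule vec.span_scale[OF t])
    moreover have "(- inverse t) *s (x - t *s v) = v - inverse t *s x"
      using False by (simp add: vec_eq_iff field_simps)
    ultimately have "v \<in> add_span T vs"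
      using cone_scale[OF assms(1,3), of "inverse t"] by (auto simp: add_span_iff)
    then show ?thesis using Cons by simp
  qed
qed simp

text \<open>
  One step down the chain, the smaller cone does not cover the quotient by the span of \<open>vs\<close>, by
  \<open>proper_zero_set_projection\<close>, so that a vector can be adjoined to \<open>vs\<close>.  There is room for at most
  \<open>CARD('r)\<close> vectors.
\<close>

lemma chain_length_bound:
  fixes Z :: "nat \<Rightarrow> ('k::{alg_closed_field,field_char_0} ^ 'r) set"
  assumes "\<And>i. i \<le> k \<Longrightarrow> zclosed (Z i) \<and> is_cone (Z i) \<and> zprime (Z i)"
    and "\<And>i. i < k \<Longrightarrow> Z i \<subset> Z (Suc i)" and "Z 0 \<noteq> {0}"
    and "indep_of (Z k) vs"
  shows "k + 1 + length vs \<le> CARD('r)"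
  using assms
proof (induction k arbitrary: vs)
  case 0
  have c: "is_cone (Z 0)" using 0 by simp
  obtain x where x: "x \<in> Z 0" "x \<noteq> 0" using 0 cone_0[OF c] by auto
  then have "x \<notin> vec.span (set vs)" using indep_of_meet_span[OF c 0(4)] by auto
  then have "vec.span (set vs) \<noteq> UNIV" by auto
  then have "vec.dim (set vs) \<noteq> CARD('r)"
    using vec.dim_eq_full[of "set vs"] by (simp add: vec.dimension_def card_cart_basis)
  then show ?case using indep_of_length[OF 0(4) cone_0[OF c]] by simp
next
  case (Suc k)
  have Zk: "zclosed (Z k)" "is_cone (Z k)" and
    Zs: "zclosed (Z (Suc k))" "is_cone (Z (Suc k))" "zprime (Z (Suc k))"
    using Suc.prems(1) by auto
  obtain x where x: "x \<in> Z (Suc k)" "x \<notin> Z k" using Suc.prems(2)[of k] by auto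
  obtain f where f: "f \<in> alg coords" "\<And>z. z \<in> Z k \<Longrightarrow> f z = 0" "f x \<noteq> 0"
    using zero_closedE[OF Zk(1) x(2)] by blast
  have "add_span {y \<in> Z (Suc k). f y = 0} vs \<noteq> UNIV"
    by (rule proper_zero_set_projection[OF Zs Suc.prems(4) f(1)]) (use f x in blast)
  moreover have "Z k \<subseteq> {y \<in> Z (Suc k). f y = 0}" using Suc.prems(2)[of k] f(2) by auto
  ultimately have "add_span (Z k) vs \<noteq> UNIV" using add_span_mono by (metis UNIV_I subsetD subsetI subset_antisym)
  then obtain v where v: "v \<notin> add_span (Z k) vs" by auto
  have "indep_of (Z k) vs" using Suc.prems(2)[of k] by (intro indep_of_mono[OF _ Suc.prems(4)]) auto
  then have "indep_of (Z k) (v # vs)" using v by simp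
  from Suc.IH[OF _ _ Suc.prems(3) this] Suc.prems(1,2)
  show ?case by simp
qed

lemma zero_closed_singleton_0: "zclosed {0 :: 'k::field ^ 'r}"
proof (rule zero_closedI)
  fix x :: "'k ^ 'r" assume "x \<notin> {0}"
  then obtain i where "x $ i \<noteq> 0" by (auto simp: vec_eq_iff)
  then show "\<exists>f\<in>alg coords. (\<forall>z\<in>{0}. f z = 0) \<and> f x \<noteq> 0"
    by (intro bexI[of _ "\<lambda>x. x $ i"]) (auto intro: coords_alg)
qed

lemma is_cone_singleton_0: "is_cone {0}"
  by (simp add: is_cone_def)

lemma indep_of_0: "distinct bs \<Longrightarrow> vec.independent (set bs) \<Longrightarrow> indep_of {0} bs"
proof (induction bs)
  case (Cons b bs)
  then show ?case by (auto simp: add_span_iff vec.independent_insert split: if_splits)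
qed simp

lemma zero_closed_subspace:
  fixes M :: "('k::{alg_closed_field,field_char_0} ^ 'r) set"
  assumes "vec.subspace M"
  shows "zclosed M"
proof -
  obtain B where B: "B \<subseteq> M" "vec.independent B" "M \<subseteq> vec.span B"
    using vec.basis_exists by metis
  have "finite B" using B(2) by (rule vec.finiteI_independent)
  then obtain bs where bs: "set bs = B" "distinct bs" using finite_distinct_list by blast
  have M: "M = add_span {0} bs"
    using B vec.span_minimal[OF B(1) assms] by (auto simp: add_span_iff bs)
  show ?thesis
    unfolding M by (rule zero_closed_add_span[OF zero_closed_singleton_0 is_cone_singleton_0])
      (use indep_of_0 bs B in auto)
qed

lemma subspace_irreducible:
  fixes M :: "('k::field_char_0 ^ 'r) set"
  assumes "vec.subspace M" "zclosed A" "zclosed B" "M \<subseteq> A \<union> B"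
  shows "M \<subseteq> A \<or> M \<subseteq> B"
proof (rule ccontr)
  assume "\<not> ?thesis"
  then obtain x y where x: "x \<in> M" "x \<notin> A" and y: "y \<in> M" "y \<notin> B" by blast
  obtain f where f: "f \<in> alg coords" "\<And>z. z \<in> A \<Longrightarrow> f z = 0" "f x \<noteq> 0"
    using zero_closedE[OF assms(2) x(2)] by blast
  obtain g where g: "g \<in> alg coords" "\<And>z. z \<in> B \<Longrightarrow> g z = 0" "g y \<noteq> 0"
    using zero_closedE[OF assms(3) y(2)] by blast
  obtain P where P: "\<And>t. poly P t = f (x + t *s (y - x))" using alg_line[OF f(1)] by blast
  obtain Q where Q: "\<And>t. poly Q t = g (x + t *s (y - x))" using alg_line[OF g(1)] by blast
  have "poly P 0 \<noteq> 0" "poly Q 1 \<noteq> 0" using f(3) g(3) by (simp_all add: P Q)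
  then have "P * Q \<noteq> 0" by auto
  then obtain t where "poly (P * Q) t \<noteq> 0" by (rule poly_nonroot)
  then have "x + t *s (y - x) \<notin> A \<union> B" using f(2) g(2) by (auto simp: P Q)
  moreover have "x + t *s (y - x) \<in> M"
    using assms(1) x(1) y(1) by (intro vec.subspace_add vec.subspace_scale vec.subspace_diff)
  ultimately show False using assms(4) by blast
qed

text \<open>
  The largest union of lines in \<open>Z\<close> on which \<open>f\<close> vanishes.  It takes the place of the zero set of \<open>f\<close>,
  which need not be a cone.
\<close>

definition lines_in :: "('k::field ^ 'r \<Rightarrow> 'k) \<Rightarrow> ('k ^ 'r) set \<Rightarrow> ('k ^ 'r) set" where
  "lines_in f Z = {z \<in> Z. \<forall>c. f (c *s z) = 0}"

lemma is_cone_lines_in: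
  assumes "is_cone Z" "lines_in f Z \<noteq> {}"
  shows "is_cone (lines_in f Z)"
proof -
  obtain z where "\<And>c. f (c *s z) = 0" using assms(2) by (auto simp: lines_in_def)
  from this[of 0] have "f 0 = 0" by simp
  then show ?thesis using assms(1) by (auto simp: is_cone_def lines_in_def vector_smult_assoc)
qed

lemma zero_closed_lines_in:
  assumes "zclosed Z" "f \<in> alg coords"
  shows "zclosed (lines_in f Z)"
proof (rule zero_closedI)
  fix x assume "x \<notin> lines_in f Z"
  then consider "x \<notin> Z" | c where "f (c *s x) \<noteq> 0" by (auto simp: lines_in_def)
  then show "\<exists>g\<in>alg coords. (\<forall>z\<in>lines_in f Z. g z = 0) \<and> g x \<noteq> 0"
  proof cases
    case 1
    obtain g where "g \<in> alg coords" "\<And>z. z \<in> Z \<Longrightarrow> g z = 0" "g x \<noteq> 0"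
      by (rule zero_closedE[OF assms(1) 1]) blast
    then show ?thesis by (intro bexI[of _ g]) (auto simp: lines_in_def)
  next
    case 2
    have "(\<lambda>x. f (c *s x)) \<in> alg coords"
      by (rule alg_compose[OF assms(2)]) (auto elim!: coords_cases intro!: alg_mult alg_const coords_alg)
    then show ?thesis using 2 by (intro bexI[of _ "\<lambda>x. f (c *s x)"]) (auto simp: lines_in_def)
  qed
qed

text \<open>
  Among the closed subcones of \<open>T\<close> whose projection along \<open>vs\<close> is \<open>M\<close>, a minimal one is irreducible:
  if it were the union of two closed subcones, their projections would be closed with union \<open>M\<close>, so one
  of them would be \<open>M\<close>, and minimality would apply.  Zorn's lemma provides a minimal one because the
  projection has finite fibres, so that points over a given \<open>x\<close> persist in the intersection of a chain.
\<close>

lemma irreducible_cone_over_subspace: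
  fixes T :: "('k::{alg_closed_field,field_char_0} ^ 'r) set"
  assumes T: "zclosed T" "is_cone T" "indep_of T vs"
    and M: "vec.subspace M" "vec.span (set vs) \<subseteq> M" "M \<subseteq> add_span T vs"
  obtains Z where "Z \<subseteq> T" "zclosed Z" "is_cone Z" "zprime Z" "add_span Z vs = M"
proof -
  define \<Z> where "\<Z> = {Z. Z \<subseteq> T \<and> zclosed Z \<and> is_cone Z \<and> add_span Z vs = M}"
  have "T \<inter> M \<in> \<Z>"
  proof -
    have "add_span (T \<inter> M) vs = M"
    proof
      show "add_span (T \<inter> M) vs \<subseteq> M"
      proof
        fix x assume "x \<in> add_span (T \<inter> M) vs"
        then obtain y where "y \<in> M" "x - y \<in> M" using M(2) by (auto simp: add_span_iff)
        then have "(x - y) + y \<in> M" using M(1) by (intro vec.subspace_add)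
        then show "x \<in> M" by simp
      qed
      show "M \<subseteq> add_span (T \<inter> M) vs"
      proof
        fix x assume x: "x \<in> M"
        then have "x \<in> add_span T vs" using M(3) by blast
        then obtain y where y: "y \<in> T" "x - y \<in> vec.span (set vs)" by (auto simp: add_span_iff)
        have "x - (x - y) \<in> M"
          by (rule vec.subspace_diff[OF M(1) x]) (use y M(2) in blast)
        then show "x \<in> add_span (T \<inter> M) vs" using y by (auto simp: add_span_iff)
      qed
    qed
    moreover have "is_cone (T \<inter> M)"
      using T(2) M(1) by (auto simp: is_cone_def vec.subspace_def)
    ultimately show ?thesis
      unfolding \<Z>_def using zero_closed_Int[OF T(1) zero_closed_subspace[OF M(1)]] by simp
  qed
  \<comment> \<open>Zorn's lemma yields maximal elements, hence the passage to complements.\<close>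
  have "\<exists>A\<in>uminus ` \<Z>. \<forall>X\<in>uminus ` \<Z>. A \<subseteq> X \<longrightarrow> X = A"
  proof (rule subset_Zorn_nonempty)
    show "uminus ` \<Z> \<noteq> {}" using \<open>T \<inter> M \<in> \<Z>\<close> by auto
    fix \<C> assume ne: "\<C> \<noteq> {}" and ch: "subset.chain (uminus ` \<Z>) \<C>"
    define \<D> where "\<D> = uminus ` \<C>"
    have D: "\<D> \<subseteq> \<Z>" "\<D> \<noteq> {}" and tot: "\<And>A B. A \<in> \<D> \<Longrightarrow> B \<in> \<D> \<Longrightarrow> A \<subseteq> B \<or> B \<subseteq> A"
      using ne ch unfolding \<D>_def subset.chain_def by auto
    have DM: "add_span Z vs = M" if "Z \<in> \<D>" for Z using that D by (auto simp: \<Z>_def)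
    have sub: "add_span (\<Inter>\<D>) vs \<subseteq> M"
      using D(2) DM add_span_mono[of "\<Inter>\<D>" _ vs] by blast
    have sup: "M \<subseteq> add_span (\<Inter>\<D>) vs"
    proof
      fix x assume x: "x \<in> M"
      define F where "F Z = {y \<in> Z. x - y \<in> vec.span (set vs)}" for Z
      have fin: "finite (F Z)" if "Z \<in> \<D>" for Z
        by (rule finite_subset[OF _ finite_fibres[OF T, of x]]) (use that D in \<open>auto simp: \<Z>_def F_def\<close>)
      \<comment> \<open>A smallest fibre in the chain is contained in all the others.\<close>
      obtain Z0 where Z0: "Z0 \<in> \<D>" "\<And>Z. Z \<in> \<D> \<Longrightarrow> card (F Z0) \<le> card (F Z)"
        using ex_has_least_nat[of "\<lambda>Z. Z \<in> \<D>" _ "\<lambda>Z. card (F Z)"] D(2) by blast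
      have F0: "F Z0 \<subseteq> F Z" if "Z \<in> \<D>" for Z
      proof (cases "Z0 \<subseteq> Z")
        case False
        then have "Z \<subseteq> Z0" using tot[OF Z0(1) that] by blast
        then have "F Z \<subseteq> F Z0" by (auto simp: F_def)
        then have "F Z = F Z0" using card_subset_eq[OF fin[OF Z0(1)]] Z0(2)[OF that] card_mono[OF fin[OF Z0(1)]]
          by (metis antisym)
        then show ?thesis by simp
      qed (auto simp: F_def)
      have "x \<in> add_span Z0 vs" using DM[OF Z0(1)] x by simp
      then obtain y where "y \<in> F Z0" by (auto simp: add_span_iff F_def)
      then have "y \<in> \<Inter>\<D>" "x - y \<in> vec.span (set vs)" using F0 by (auto simp: F_def)
      then show "x \<in> add_span (\<Inter>\<D>) vs" unfolding add_span_iff by blast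
    qed
    have "\<Inter>\<D> \<in> \<Z>"
      unfolding \<Z>_def
    proof (intro CollectI conjI)
      show "\<Inter>\<D> \<subseteq> T" using D by (auto simp: \<Z>_def)
      show "zclosed (\<Inter>\<D>)" using D by (intro zero_closed_Inter) (auto simp: \<Z>_def)
      show "is_cone (\<Inter>\<D>)" using D by (auto simp: \<Z>_def is_cone_def)
      show "add_span (\<Inter>\<D>) vs = M" using sub sup by simp
    qed
    moreover have "\<Union>\<C> = - \<Inter>\<D>" unfolding \<D>_def by auto
    ultimately show "\<Union>\<C> \<in> uminus ` \<Z>" by blast
  qed
  then obtain Z where Z: "Z \<in> \<Z>" and min0: "\<forall>X\<in>uminus ` \<Z>. - Z \<subseteq> X \<longrightarrow> X = - Z"
    by blast
  have min: "X = Z" if "X \<in> \<Z>" "X \<subseteq> Z" for X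
    using min0 that by (metis Compl_subset_Compl_iff double_compl image_eqI)
  have Zp: "Z \<subseteq> T" "zclosed Z" "is_cone Z" "add_span Z vs = M" using Z by (auto simp: \<Z>_def)
  have lines: "\<forall>z\<in>Z. f z = 0"
    if f: "f \<in> alg coords" and sub: "M \<subseteq> add_span (lines_in f Z) vs" for f
  proof -
    have "lines_in f Z \<noteq> {}" using sub vec.subspace_0[OF M(1)] by (auto simp: add_span_iff)
    then have "is_cone (lines_in f Z)" by (rule is_cone_lines_in[OF Zp(3)])
    moreover have "lines_in f Z \<subseteq> Z" by (auto simp: lines_in_def)
    moreover have "add_span (lines_in f Z) vs = M"
      using sub add_span_mono[of "lines_in f Z" Z vs] Zp(4) by (auto simp: lines_in_def)
    ultimately have "lines_in f Z \<in> \<Z>"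
      using Zp(1) zero_closed_lines_in[OF Zp(2) f] by (auto simp: \<Z>_def)
    then have "lines_in f Z = Z" by (rule min) (auto simp: lines_in_def)
    then have "\<forall>z\<in>Z. \<forall>c. f (c *s z) = 0" by (auto simp: lines_in_def)
    then show ?thesis by (metis vec.scale_one)
  qed
  have clo: "zclosed (add_span (lines_in f Z) vs) \<or> add_span (lines_in f Z) vs = {}"
    if f: "f \<in> alg coords" for f
  proof (cases "lines_in f Z = {}")
    case False
    have "lines_in f Z \<subseteq> T" using Zp(1) by (auto simp: lines_in_def)
    then show ?thesis
      using zero_closed_add_span[OF zero_closed_lines_in[OF Zp(2) f] is_cone_lines_in[OF Zp(3) False]]
        indep_of_mono[OF _ T(3)] by blast
  qed (auto simp: add_span_iff)
  have "zprime Z"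
    unfolding zero_prime_def
  proof (intro conjI ballI impI)
    show "Z \<noteq> {}" using cone_0[OF Zp(3)] by auto
    fix f g :: "'k ^ 'r \<Rightarrow> 'k" assume f: "f \<in> alg coords" and g: "g \<in> alg coords" and fg: "\<forall>z\<in>Z. f z * g z = 0"
    have un: "Z \<subseteq> lines_in f Z \<union> lines_in g Z"
    proof
      fix z assume z: "z \<in> Z"
      obtain P where P: "\<And>t. poly P t = f (0 + t *s z)" using alg_line[OF f] by blast
      obtain Q where Q: "\<And>t. poly Q t = g (0 + t *s z)" using alg_line[OF g] by blast
      have "poly (P * Q) t = 0" for t
        using fg cone_scale[OF Zp(3) z, of t] by (simp add: P Q)
      then have "P * Q = 0" using poly_all_0_iff_0 by blast
      then have "P = 0 \<or> Q = 0" by simp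
      then have "(\<forall>t. poly P t = 0) \<or> (\<forall>t. poly Q t = 0)" by auto
      then show "z \<in> lines_in f Z \<union> lines_in g Z" using z by (simp add: P Q lines_in_def)
    qed
    have "M \<subseteq> add_span (lines_in f Z) vs \<union> add_span (lines_in g Z) vs"
    proof
      fix x assume "x \<in> M"
      then obtain y where y: "y \<in> Z" "x - y \<in> vec.span (set vs)" using Zp(4) by (auto simp: add_span_iff)
      then have "y \<in> lines_in f Z \<or> y \<in> lines_in g Z" using un by blast
      then show "x \<in> add_span (lines_in f Z) vs \<union> add_span (lines_in g Z) vs"
        unfolding Un_iff add_span_iff using y(2) by (elim disjE) (blast+)
    qed
    then have "M \<subseteq> add_span (lines_in f Z) vs \<or> M \<subseteq> add_span (lines_in g Z) vs"
      using clo[OF f] clo[OF g]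
        subspace_irreducible[OF M(1), of "add_span (lines_in f Z) vs" "add_span (lines_in g Z) vs"] by auto
    then show "(\<forall>z\<in>Z. f z = 0) \<or> (\<forall>z\<in>Z. g z = 0)" using lines f g by blast
  qed
  then show ?thesis using that Zp by blast
qed

text \<open>
  A flag of subspaces between the span of \<open>vs\<close> and \<open>add_span T vs\<close> is lifted from the top, each
  irreducible cone being cut out of the previous one.
\<close>

lemma chain_exists:
  fixes T :: "('k::{alg_closed_field,field_char_0} ^ 'r) set"
  assumes "zclosed T" "is_cone T" "zprime T" "indep_of T vs"
    and "vec.subspace (add_span T vs)" "vec.dim (add_span T vs) = length vs + k + 1"
  shows "\<exists>Z. (\<forall>i\<le>k. zclosed (Z i) \<and> is_cone (Z i) \<and> zprime (Z i) \<and> Z i \<noteq> {0})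
     \<and> (\<forall>i<k. Z i \<subset> Z (Suc i)) \<and> Z k = T"
  using assms
proof (induction k arbitrary: T)
  case (0 T)
  have "T \<noteq> {0}"
  proof
    assume "T = {0}"
    then have "add_span T vs = vec.span (set vs)" by (auto simp: add_span_iff)
    then show False using 0(6) indep_of_length(2)[OF 0(4)] cone_0[OF 0(2)] by simp
  qed
  then show ?case using 0 by (intro exI[of _ "\<lambda>_. T"]) auto
next
  case (Suc k T)
  let ?M = "add_span T vs"
  have T0: "0 \<in> T" by (rule cone_0[OF Suc.prems(2)])
  have ivs: "vec.independent (set vs)" using indep_of_independent[OF Suc.prems(4) T0] by simp
  have vsM: "set vs \<subseteq> ?M" using span_subset_add_span[OF T0] vec.span_superset[of "set vs"] by blast
  obtain B where B: "set vs \<subseteq> B" "B \<subseteq> ?M" "vec.independent B" "?M \<subseteq> vec.span B"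
    using vec.maximal_independent_subset_extend[OF vsM ivs] by blast
  have cB: "card B = length vs + Suc k + 1"
    using vec.dim_eq_card[of B ?M] B Suc.prems(6) vec.span_minimal[OF B(2) Suc.prems(5)]
    by (metis vec.basis_card_eq_dim)
  have "\<not> B \<subseteq> set vs"
    using cB card_mono[of "set vs" B] card_length[of vs] by auto
  then obtain b where b: "b \<in> B" "b \<notin> set vs" by blast
  define M where "M = vec.span (B - {b})"
  have dM: "vec.dim M = length vs + k + 1"
    using vec.dim_eq_card_independent[OF vec.independent_mono[OF B(3), of "B - {b}"]] b cB vec.finiteI_independent[OF B(3)]
    by (simp add: M_def vec.dim_span)
  have MM: "M \<subseteq> ?M" unfolding M_def
    by (rule vec.span_minimal) (use B(2) Suc.prems(5) in auto)
  have vM: "vec.span (set vs) \<subseteq> M" unfolding M_def by (rule vec.span_mono) (use B(1) b in auto)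
  obtain Z' where Z': "Z' \<subseteq> T" "zclosed Z'" "is_cone Z'" "zprime Z'" "add_span Z' vs = M"
    using irreducible_cone_over_subspace[OF Suc.prems(1,2,4) _ vM MM] by (auto simp: M_def)
  have "indep_of Z' vs" by (rule indep_of_mono[OF Z'(1) Suc.prems(4)])
  from Suc.IH[OF Z'(2-4) this] obtain Z where Z:
    "\<forall>i\<le>k. zclosed (Z i) \<and> is_cone (Z i) \<and> zprime (Z i) \<and> Z i \<noteq> {0}"
    "\<forall>i<k. Z i \<subset> Z (Suc i)" "Z k = Z'"
    using Z'(5) dM by (auto simp: M_def)
  have "Z' \<noteq> T" using Z'(5) dM Suc.prems(6) by auto
  moreover have "T \<noteq> {0}" using Z' \<open>Z' \<noteq> T\<close> cone_0[OF Z'(3)] by auto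
  ultimately show ?case
    using Z Z'(1) Suc.prems(1-3)
    by (intro exI[of _ "\<lambda>i. if i = Suc k then T else Z i"]) (auto simp: le_Suc_eq less_Suc_eq)
qed

section \<open>Images of polynomial maps contain open sets\<close>

text \<open>
  The source consists of functions on an arbitrary index type, of which only finitely many values
  matter, because the number of summands of a secant variety is not fixed by a type.
\<close>

definition evals :: "(('i \<Rightarrow> 'k::field) \<Rightarrow> 'k) set" where
  "evals = range (\<lambda>i x. x i)"

text \<open>
  The coordinates on the graph of a map that remain when only the source coordinates in \<open>J\<close> are kept.
\<close>

definition joint_coords :: "'i set \<Rightarrow> (('k::field ^ 'r) \<times> ('i \<Rightarrow> 'k) \<Rightarrow> 'k) set" where
  "joint_coords J = range (\<lambda>k y. fst y $ k) \<union> (\<lambda>j y. snd y j) ` J"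

lemma joint_coords_cases:
  assumes "g \<in> joint_coords J"
  obtains k where "g = (\<lambda>y. fst y $ k)" | j where "j \<in> J" "g = (\<lambda>y. snd y j)"
  using assms by (auto simp: joint_coords_def)

lemma joint_coords_mono: "J \<subseteq> J' \<Longrightarrow> f \<in> alg (joint_coords J) \<Longrightarrow> f \<in> alg (joint_coords J')"
  by (erule alg_mono) (auto simp: joint_coords_def)

lemma alg_joint_fst: "(\<lambda>y. fst y $ k) \<in> alg (joint_coords J)"
  by (rule alg_gen) (auto simp: joint_coords_def)

lemma alg_joint_snd: "j \<in> J \<Longrightarrow> (\<lambda>y. snd y j) \<in> alg (joint_coords J)"
  by (rule alg_gen) (auto simp: joint_coords_def)

lemma alg_evals: "(\<lambda>x. x i) \<in> alg evals"
  by (rule alg_gen) (auto simp: evals_def)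

lemma alg_joint_agree:
  assumes "f \<in> alg (joint_coords J)" "\<And>j. j \<in> J \<Longrightarrow> x j = x' j"
  shows "f (z, x) = f (z, x')"
  using assms(1) by induction (auto elim!: joint_coords_cases simp: assms(2))

lemma alg_joint_expand:
  fixes f :: "('k::field ^ 'r) \<times> ('i \<Rightarrow> 'k) \<Rightarrow> 'k"
  assumes "f \<in> alg (joint_coords (insert j J))" "j \<notin> J"
  shows "\<exists>P\<in>polyover (alg (joint_coords J)). \<forall>y t. poly (P y) t = f (fst y, (snd y)(j := t))"
proof (rule alg_subst_polyover[OF assms(1)])
  fix g :: "('k ^ 'r) \<times> ('i \<Rightarrow> 'k) \<Rightarrow> 'k" assume "g \<in> joint_coords (insert j J)"
  then consider k where "g = (\<lambda>y. fst y $ k)" | l where "l \<in> J" "g = (\<lambda>y. snd y l)" | "g = (\<lambda>y. snd y j)"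
    by (auto elim!: joint_coords_cases)
  then show "\<exists>P\<in>polyover (alg (joint_coords J)). \<forall>x t. poly (P x) t = g (fst x, (snd x)(j := t))"
  proof cases
    case 1
    then show ?thesis
      by (intro bexI[of _ "\<lambda>y. [:fst y $ k:]"]) (auto intro: polyover_coeff_const alg_joint_fst)
  next
    case 2
    then have "l \<noteq> j" using assms(2) by auto
    then show ?thesis using 2
      by (intro bexI[of _ "\<lambda>y. [:snd y l:]"]) (auto intro: polyover_coeff_const alg_joint_snd)
  next
    case 3
    then show ?thesis by (intro bexI[of _ "\<lambda>_. [:0, 1:]"]) (auto intro: polyover_const)
  qed
qed

text \<open>
  Coefficients that vanish on all of \<open>U\<close> are cut off, so that the leading one does not.
\<close>

lemma relation_with_lead:
  fixes P :: "'x \<Rightarrow> 'k::comm_ring_1 poly"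
  assumes P: "P \<in> polyover (alg G)" and y0: "y0 \<in> U" "P y0 \<noteq> 0"
  shows "\<exists>f e. f \<in> polyover (alg G) \<and> (\<forall>y. degree (f y) \<le> e) \<and> (\<forall>y\<in>U. f y = P y) \<and>
    (\<exists>y\<in>U. coeff (f y) e \<noteq> 0)"
proof -
  obtain N where N: "\<And>y. degree (P y) \<le> N" using P unfolding polyover_def by blast
  define E where "E = {i. \<exists>y\<in>U. coeff (P y) i \<noteq> 0}"
  have "E \<subseteq> {..N}" using N by (auto simp: E_def) (meson coeff_eq_0 le_trans not_le)
  then have finE: "finite E" by (rule finite_subset) simp
  obtain i where "coeff (P y0) i \<noteq> 0" using y0(2) by (auto simp: poly_eq_iff)
  then have "E \<noteq> {}" using y0(1) by (auto simp: E_def)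
  define e where "e = Max E"
  define f where "f y = (\<Sum>i\<le>e. monom (coeff (P y) i) i)" for y
  have cf: "coeff (f y) i = (if i \<le> e then coeff (P y) i else 0)" for y i
    by (simp add: f_def coeff_sum)
  have deg: "degree (f y) \<le> e" for y by (rule degree_le) (simp add: cf)
  show ?thesis
  proof (intro exI[of _ f] exI[of _ e] conjI allI ballI)
    show "f \<in> polyover (alg G)"
      unfolding polyover_def
    proof (intro CollectI conjI allI exI)
      show "(\<lambda>y. coeff (f y) i) \<in> alg G" for i
        by (cases "i \<le> e") (auto simp: cf intro: polyover_coeff[OF P] alg_const)
    qed (rule deg)
    show "degree (f y) \<le> e" for y by (rule deg)
    show "f y = P y" if "y \<in> U" for y
    proof (rule poly_eqI)
      fix i
      have "coeff (P y) i = 0" if "i > e"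
        using that \<open>y \<in> U\<close> Max_ge[OF finE, of i] by (force simp: E_def e_def)
      then show "coeff (f y) i = coeff (P y) i" by (simp add: cf)
    qed
    have "e \<in> E" unfolding e_def by (rule Max_in[OF finE \<open>E \<noteq> {}\<close>])
    then show "\<exists>y\<in>U. coeff (f y) e \<noteq> 0" by (auto simp: E_def cf)
  qed
qed

text \<open>
  Chevalley's theorem for the image of an irreducible set.  Call a set \<open>J\<close> of source coordinates free
  if the graph of \<open>s\<close>, with the other coordinates forgotten, is dense in \<open>T \<times> K\<^sup>J\<close>, where \<open>T\<close> is the
  closure of the image.  For a maximal free \<open>J\<close>, every other coordinate satisfies an equation over the
  coordinates in \<open>J\<close> whose leading coefficient is not identically zero.  Where the product \<open>a\<close> of these
  coefficients is nonzero, \<open>elimination\<close> recovers the forgotten coordinates one after the other.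
  Freezing the coordinates in \<open>J\<close> at their values at a suitable point \<open>x1\<close> turns \<open>a\<close> into the function
  \<open>h\<close> on the target.
\<close>

lemma image_contains_open:
  fixes X :: "('i \<Rightarrow> 'k::{alg_closed_field,field_char_0}) set" and s :: "('i \<Rightarrow> 'k) \<Rightarrow> 'k ^ 'r"
  assumes I: "finite I" "\<And>x i. x \<in> X \<Longrightarrow> i \<notin> I \<Longrightarrow> x i = 0"
    and closed: "zero_closed (alg evals) X" and prime: "zero_prime (alg evals) X"
    and s: "\<And>k. (\<lambda>x. s x $ k) \<in> alg evals" "\<And>x x'. (\<And>i. i \<in> I \<Longrightarrow> x i = x' i) \<Longrightarrow> s x = s x'"
  shows "\<exists>h\<in>alg coords. (\<exists>x\<in>X. h (s x) \<noteq> 0) \<and> (\<forall>z\<in>zclosure (s ` X). h z \<noteq> 0 \<longrightarrow> z \<in> s ` X)"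
proof -
  let ?R = "\<lambda>J. alg (joint_coords J) :: (('k ^ 'r) \<times> ('i \<Rightarrow> 'k) \<Rightarrow> 'k) set"
  define T where "T = zclosure (s ` X)"
  define vanishes where "vanishes F \<longleftrightarrow> (\<forall>x\<in>X. F (s x, x) = 0)" for F :: "('k ^ 'r) \<times> ('i \<Rightarrow> 'k) \<Rightarrow> 'k"
  define free where "free J \<longleftrightarrow> (\<forall>F\<in>?R J. vanishes F \<longrightarrow> (\<forall>z\<in>T. \<forall>x. F (z, x) = 0))" for J
  have sT: "s x \<in> T" if "x \<in> X" for x unfolding T_def by (rule zero_closureI) (use that in auto)
  have pull: "(\<lambda>x. F (s x, x)) \<in> alg evals" if "F \<in> ?R J" for F J
    by (rule alg_compose[OF that]) (auto elim!: joint_coords_cases intro: s(1) alg_evals)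
  have "free {}"
    unfolding free_def
  proof (intro ballI impI allI)
    fix F z x assume F: "F \<in> ?R {}" "vanishes F" and z: "z \<in> T"
    have "(\<lambda>z. F (z, x)) \<in> alg coords"
      by (rule alg_compose[OF F(1)]) (auto elim!: joint_coords_cases intro: coords_alg)
    moreover have "F (z', x) = 0" if z': "z' \<in> s ` X" for z'
    proof -
      obtain x' where x': "x' \<in> X" "z' = s x'" using z' by blast
      have "F (z', x) = F (z', x')" by (rule alg_joint_agree[OF F(1)]) simp
      then show ?thesis using F(2) x' by (simp add: vanishes_def)
    qed
    ultimately show "F (z, x) = 0" using zero_closure_vanish[of "\<lambda>z. F (z, x)"] z unfolding T_def by blast
  qed
  define \<J> where "\<J> = {J. J \<subseteq> I \<and> free J}"
  have "finite \<J>" "\<J> \<noteq> {}" using I(1) \<open>free {}\<close> by (auto simp: \<J>_def)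
  then obtain J where JJ: "J \<in> \<J>" "\<And>J'. J' \<in> \<J> \<Longrightarrow> J \<subseteq> J' \<Longrightarrow> J = J'"
    using finite_has_maximal[of \<J>] by metis
  then have J: "J \<subseteq> I" "free J" and max: "\<And>J'. J' \<subseteq> I \<Longrightarrow> free J' \<Longrightarrow> J \<subseteq> J' \<Longrightarrow> J = J'"
    by (auto simp: \<J>_def)
  have "\<exists>f e. f \<in> polyover (?R J) \<and> (\<forall>y. degree (f y) \<le> e) \<and> (\<forall>x\<in>X. poly (f (s x, x)) (x j) = 0)
    \<and> (\<exists>x\<in>X. coeff (f (s x, x)) e \<noteq> 0)" if j: "j \<in> I - J" for j
  proof -
    have "insert j J \<noteq> J" "insert j J \<subseteq> I" using j J(1) by auto
    then have "\<not> free (insert j J)" using max[of "insert j J"] by blast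
    then obtain F z1 x1 where F: "F \<in> ?R (insert j J)" "vanishes F" and zx: "z1 \<in> T" "F (z1, x1) \<noteq> 0"
      unfolding free_def by blast
    obtain P where P: "P \<in> polyover (?R J)" "\<And>y t. poly (P y) t = F (fst y, (snd y)(j := t))"
      using alg_joint_expand[OF F(1)] j by blast
    have "poly (P (z1, x1)) (x1 j) \<noteq> 0" using zx(2) by (simp add: P(2))
    then have nz: "P (z1, x1) \<noteq> 0" by auto
    have "(z1, x1) \<in> T \<times> UNIV" using zx(1) by simp
    from relation_with_lead[OF P(1) this nz]
    obtain f e where f: "f \<in> polyover (?R J)" "\<forall>y. degree (f y) \<le> e"
      "\<forall>y\<in>T \<times> UNIV. f y = P y" "\<exists>y\<in>T \<times> UNIV. coeff (f y) e \<noteq> 0"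
      by (elim exE conjE)
    have 1: "poly (f (s x, x)) (x j) = 0" if "x \<in> X" for x
      using bspec[OF f(3), of "(s x, x)"] sT[OF that] F(2) that by (simp add: P(2) vanishes_def)
    have 2: "\<exists>x\<in>X. coeff (f (s x, x)) e \<noteq> 0"
    proof (rule ccontr)
      assume "\<not> ?thesis"
      then have "vanishes (\<lambda>y. coeff (f y) e)" by (simp add: vanishes_def)
      then show False using J(2) polyover_coeff[OF f(1), of e] f(4) unfolding free_def by fastforce
    qed
    show ?thesis using f(1,2) 1 2 by blast
  qed
  then obtain f e where f: "\<And>j. j \<in> I - J \<Longrightarrow> f j \<in> polyover (?R J)" "\<And>j y. j \<in> I - J \<Longrightarrow> degree (f j y) \<le> e j"
    "\<And>j x. j \<in> I - J \<Longrightarrow> x \<in> X \<Longrightarrow> poly (f j (s x, x)) (x j) = 0"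
    "\<And>j. j \<in> I - J \<Longrightarrow> \<exists>x\<in>X. coeff (f j (s x, x)) (e j) \<noteq> 0"
    by metis
  define a where "a y = (\<Prod>j\<in>I - J. coeff (f j y) (e j))" for y
  have aR: "a \<in> ?R J" unfolding a_def by (intro alg_prod polyover_coeff f(1))
  have "\<exists>x\<in>X. (\<Prod>j\<in>I - J. coeff (f j (s x, x)) (e j)) \<noteq> 0"
  proof (rule zero_prime_prod[OF prime])
    show "(\<lambda>x. coeff (f j (s x, x)) (e j)) \<in> alg evals" if "j \<in> I - J" for j
      by (rule pull[OF polyover_coeff[OF f(1)[OF that]]])
  qed (use I(1) f(4) in auto)
  then obtain x1 where x1: "x1 \<in> X" "a (s x1, x1) \<noteq> 0" by (auto simp: a_def)
  have lift: "z \<in> s ` X"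
    if "finite L" "L \<subseteq> I - J" "\<And>i. i \<notin> I \<Longrightarrow> x i = 0" "a (z, x) \<noteq> 0"
      "\<And>F. F \<in> ?R (I - L) \<Longrightarrow> vanishes F \<Longrightarrow> F (z, x) = 0" for L z x
    using that
  proof (induction L arbitrary: x)
    case empty
    define r where "r x i = (if i \<in> I then x i else 0)" for x :: "'i \<Rightarrow> 'k" and i
    have rX: "r x = x" if "x \<in> X" for x using I(2)[OF that] by (auto simp: r_def fun_eq_iff)
    have rx: "r x = x" using empty.prems(2) by (auto simp: r_def fun_eq_iff)
    have ralg: "(\<lambda>y. g (r (snd y))) \<in> ?R I" if "g \<in> alg evals" for g
    proof (rule alg_compose[OF that])
      fix g :: "('i \<Rightarrow> 'k) \<Rightarrow> 'k" assume "g \<in> evals"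
      then obtain i where "g = (\<lambda>x. x i)" by (auto simp: evals_def)
      then show "(\<lambda>y. g (r (snd y))) \<in> ?R I"
        by (cases "i \<in> I") (auto simp: r_def intro: alg_joint_snd alg_const)
    qed
    have "x \<in> X"
    proof (rule ccontr)
      assume "x \<notin> X"
      then obtain g where g: "g \<in> alg evals" "\<And>x. x \<in> X \<Longrightarrow> g x = 0" "g x \<noteq> 0"
        using zero_closedE[OF closed] by blast
      have "vanishes (\<lambda>y. g (r (snd y)))" by (auto simp: vanishes_def g(2) rX)
      from empty.prems(4)[OF _ this] ralg[OF g(1)] g(3) show False by (simp add: rx)
    qed
    moreover have "z = s x"
    proof -
      have "z $ k = s x $ k" for k
      proof -
        have "(\<lambda>y. fst y $ k - s (r (snd y)) $ k) \<in> ?R I"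
          by (rule alg_diff[OF alg_joint_fst ralg[OF s(1)]])
        moreover have "vanishes (\<lambda>y. fst y $ k - s (r (snd y)) $ k)" by (auto simp: vanishes_def rX)
        ultimately have "z $ k - s (r x) $ k = 0" using empty.prems(4) by force
        then show ?thesis by (simp add: rx)
      qed
      then show ?thesis by (simp add: vec_eq_iff)
    qed
    ultimately show ?case by blast
  next
    case (insert j L)
    have j: "j \<in> I - J" using insert.prems(1) by auto
    let ?K = "I - insert j L"
    have JK: "J \<subseteq> ?K" using insert.prems(1) J(1) by auto
    have fK: "f j \<in> polyover (?R ?K)"
      using f(1)[OF j] joint_coords_mono[OF JK] unfolding polyover_def by blast
    define S where "S = (\<lambda>x. ((s x, x), x j)) ` X"
    have "\<exists>t0. \<forall>P\<in>polyover (?R ?K). (\<forall>(y,t)\<in>S. poly (P y) t = 0) \<longrightarrow> poly (P (z, x)) t0 = 0"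
    proof (rule elimination[OF fK])
      show "degree (f j y) \<le> e j" for y by (rule f(2)[OF j])
      show "poly (f j y) t = 0" if "(y, t) \<in> S" for y t using that f(3)[OF j] by (auto simp: S_def)
      show "coeff (f j (z, x)) (e j) \<noteq> 0" using insert.prems(3) j I(1) by (auto simp: a_def)
      show "h (z, x) = 0" if "h \<in> ?R ?K" "\<And>y t. (y, t) \<in> S \<Longrightarrow> h y = 0" for h
      proof (rule insert.prems(4)[OF that(1)])
        show "vanishes h" using that(2) by (auto simp: vanishes_def S_def)
      qed
    qed
    then obtain t0 where t0: "\<And>P. P \<in> polyover (?R ?K) \<Longrightarrow> (\<And>y t. (y,t)\<in>S \<Longrightarrow> poly (P y) t = 0) \<Longrightarrow> poly (P (z, x)) t0 = 0"
      by blast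
    show ?case
    proof (rule insert.IH[of "x(j := t0)"])
      show "L \<subseteq> I - J" using insert.prems(1) by auto
      show "(x(j := t0)) i = 0" if "i \<notin> I" for i using that insert.prems(2) j by auto
      have "a (z, x(j := t0)) = a (z, x)" by (rule alg_joint_agree[OF aR]) (use j in auto)
      then show "a (z, x(j := t0)) \<noteq> 0" using insert.prems(3) by simp
      fix F assume F: "F \<in> ?R (I - L)" "vanishes F"
      have "I - L = insert j ?K" using j insert.hyps by auto
      then have "F \<in> ?R (insert j ?K)" using F(1) by simp
      then obtain P where P: "P \<in> polyover (?R ?K)" "\<And>y t. poly (P y) t = F (fst y, (snd y)(j := t))"
        using alg_joint_expand[of F j ?K] by blast
      have "poly (P (z, x)) t0 = 0"
        by (rule t0[OF P(1)]) (use F(2) in \<open>auto simp: P(2) S_def vanishes_def\<close>)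
      then show "F (z, x(j := t0)) = 0" by (simp add: P(2))
    qed
  qed
  have "z \<in> s ` X" if z: "z \<in> T" "a (z, x1) \<noteq> 0" for z
  proof (rule lift[of "I - J" x1 z])
    show "F (z, x1) = 0" if "F \<in> ?R (I - (I - J))" "vanishes F" for F
    proof -
      have "I - (I - J) = J" using J(1) by auto
      then show ?thesis using that J(2) z(1) unfolding free_def by simp
    qed
  qed (use I x1 z in auto)
  moreover have "(\<lambda>z. a (z, x1)) \<in> alg coords"
    by (rule alg_compose[OF aR]) (auto elim!: joint_coords_cases intro: coords_alg alg_const)
  ultimately show ?thesis
    using x1 unfolding T_def by (intro bexI[of _ "\<lambda>z. a (z, x1)"]) auto
qed

section \<open>Zariski closed sets as cones\<close>

text \<open>
  The origin is inserted so that the empty set, too, corresponds to a cone.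
\<close>

definition affine_cone :: "('k::field ^ 'r) set set \<Rightarrow> ('k ^ 'r) set" where
  "affine_cone X = insert 0 (\<Union>X)"

lemma proj_space_subspace: "L \<in> proj_space \<Longrightarrow> vec.subspace L"
  by (simp add: proj_space_def)

lemma proj_space_line:
  assumes "L \<in> proj_space" "x \<in> L" "x \<noteq> 0"
  shows "L = vec.span {x}"
proof -
  obtain w where w: "w \<noteq> 0" "L = range (\<lambda>k. k *s w)" using assms(1) by (auto simp: proj_space_iff)
  then obtain k where k: "x = k *s w" using assms(2) by auto
  then have "k \<noteq> 0" using assms(3) by auto
  then have "c *s w = (c / k) *s x" for c by (simp add: k vector_smult_assoc)
  then have "L \<subseteq> vec.span {x}" unfolding w(2) vec.span_singleton by force
  moreover have "vec.span {x} \<subseteq> L"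
    using assms(2) proj_space_subspace[OF assms(1)] by (intro vec.span_minimal) auto
  ultimately show ?thesis by simp
qed

lemma span_singleton_proj_space: "x \<noteq> 0 \<Longrightarrow> vec.span {x} \<in> proj_space"
  unfolding proj_space_iff vec.span_singleton by blast

lemma proj_space_nonzero:
  assumes "L \<in> proj_space" obtains x where "x \<in> L" "x \<noteq> 0" "L = vec.span {x}"
proof -
  obtain w where w: "w \<noteq> 0" "L = vec.span {w}" using assms by (auto simp: proj_space_iff vec.span_singleton)
  then show ?thesis using that[of w] vec.span_base[of w "{w}"] by simp
qed

lemma is_cone_affine_cone:
  assumes "X \<subseteq> proj_space"
  shows "is_cone (affine_cone X)"
  unfolding is_cone_def
proof (intro conjI ballI allI)
  show "0 \<in> affine_cone X" by (simp add: affine_cone_def)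
  fix x c assume "x \<in> affine_cone X"
  then consider "x = 0" | L where "L \<in> X" "x \<in> L" by (auto simp: affine_cone_def)
  then show "c *s x \<in> affine_cone X"
  proof cases
    case 2
    then have "c *s x \<in> L"
      using assms by (intro vec.subspace_scale proj_space_subspace) auto
    then show ?thesis using 2 by (auto simp: affine_cone_def)
  qed (simp add: affine_cone_def)
qed

lemma mem_affine_cone:
  assumes "X \<subseteq> proj_space" "x \<noteq> 0"
  shows "x \<in> affine_cone X \<longleftrightarrow> vec.span {x} \<in> X"
proof
  assume "x \<in> affine_cone X"
  then obtain L where L: "L \<in> X" "x \<in> L" using assms(2) by (auto simp: affine_cone_def)
  then have "L = vec.span {x}" using assms by (intro proj_space_line) auto
  then show "vec.span {x} \<in> X" using L(1) by simp
next
  assume "vec.span {x} \<in> X"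
  then show "x \<in> affine_cone X" using vec.span_base[of x "{x}"] unfolding affine_cone_def by blast
qed

lemma span_singleton_cone: "is_cone T \<Longrightarrow> vec.span {x} \<subseteq> T \<longleftrightarrow> x \<in> T"
  using vec.span_base[of x "{x}"] by (auto simp: vec.span_singleton is_cone_def)

lemma affine_cone_proj_points: "is_cone T \<Longrightarrow> affine_cone (proj_points T) = T"
proof
  assume T: "is_cone T"
  show "affine_cone (proj_points T) \<subseteq> T" using cone_0[OF T] by (auto simp: affine_cone_def proj_points_def)
  show "T \<subseteq> affine_cone (proj_points T)"
  proof
    fix x assume x: "x \<in> T"
    show "x \<in> affine_cone (proj_points T)"
    proof (cases "x = 0")
      case False
      then have "vec.span {x} \<in> proj_points T"
        using x span_singleton_proj_space span_singleton_cone[OF T] by (auto simp: proj_points_def)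
      then show ?thesis using vec.span_base[of x "{x}"] by (auto simp: affine_cone_def)
    qed (simp add: affine_cone_def)
  qed
qed

lemma proj_points_affine_cone:
  assumes "X \<subseteq> proj_space"
  shows "proj_points (affine_cone X) = X"
proof
  show "X \<subseteq> proj_points (affine_cone X)" using assms by (auto simp: affine_cone_def proj_points_def)
  show "proj_points (affine_cone X) \<subseteq> X"
  proof
    fix L assume L: "L \<in> proj_points (affine_cone X)"
    then have "L \<in> proj_space" by (simp add: proj_points_def)
    then obtain x where x: "x \<in> L" "x \<noteq> 0" "L = vec.span {x}" by (rule proj_space_nonzero)
    then show "L \<in> X" using L mem_affine_cone[OF assms x(2)] by (auto simp: proj_points_def)
  qed
qed

lemma proj_points_subset: "proj_points T \<subseteq> proj_space"
  by (auto simp: proj_points_def)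

lemma homogeneous_poly_alg:
  assumes "homogeneous_poly d f"
  shows "f \<in> alg coords"
proof -
  obtain c where "f = (\<lambda>x. \<Sum>a | sum a UNIV = d. c a * (\<Prod>i\<in>UNIV. (x $ i) ^ a i))"
    using assms unfolding homogeneous_poly_def by blast
  then show ?thesis by (auto intro!: alg_sum alg_mult alg_const alg_prod alg_power coords_alg)
qed

lemma form_homogeneous_poly:
  fixes f :: "'k::field ^ 'r \<Rightarrow> 'k"
  assumes "is_form d f"
  shows "homogeneous_poly d f"
  using assms
proof induction
  case (forms_base r)
  have "{a :: 'r \<Rightarrow> nat. sum a UNIV = 0} = {\<lambda>i. 0}" by (auto simp: fun_eq_iff)
  then show ?case
    unfolding homogeneous_poly_def by (intro exI[of _ "\<lambda>a. r 0"]) (auto intro: alg_empty_const[OF forms_base])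
next
  case (forms_gen l)
  then obtain i where l: "l = (\<lambda>x. x $ i)" by (rule coords_cases)
  define e :: "'r \<Rightarrow> nat" where "e = (\<lambda>j. if j = i then 1 else 0)"
  have "sum e UNIV = 1" by (simp add: e_def)
  moreover have "(\<Prod>j\<in>UNIV. (x $ j) ^ e j) = x $ i" for x :: "'k ^ 'r"
    by (simp add: e_def if_distrib cong: if_cong)
  moreover have "(\<Sum>a | sum a UNIV = 1. (if a = e then 1 else 0) * (\<Prod>j\<in>UNIV. (x $ j) ^ a j)) =
     (\<Sum>a | sum a UNIV = 1. if a = e then \<Prod>j\<in>UNIV. (x $ j) ^ a j else 0)" for x :: "'k ^ 'r"
    by (rule sum.cong) auto
  ultimately have "(\<Sum>a | sum a UNIV = 1. (if a = e then 1 else 0) * (\<Prod>j\<in>UNIV. (x $ j) ^ a j)) = x $ i" for x :: "'k ^ 'r"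
    by (simp add: sum.delta[OF finite_exponents])
  then show ?case
    unfolding homogeneous_poly_def l by (intro exI[of _ "\<lambda>a. if a = e then 1 else 0"] ext) (rule sym)
next
  case (forms_zero d)
  show ?case unfolding homogeneous_poly_def by (intro exI[of _ "\<lambda>_. 0"]) simp
next
  case (forms_add d f g)
  then obtain c c' where "f = (\<lambda>x. \<Sum>a | sum a UNIV = d. c a * (\<Prod>i\<in>UNIV. (x $ i) ^ a i))"
    "g = (\<lambda>x. \<Sum>a | sum a UNIV = d. c' a * (\<Prod>i\<in>UNIV. (x $ i) ^ a i))"
    unfolding homogeneous_poly_def by blast
  then show ?case
    unfolding homogeneous_poly_def by (intro exI[of _ "\<lambda>a. c a + c' a"]) (simp add: sum.distrib algebra_simps)
next
  case (forms_mult d f e g)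
  then show ?case using homogeneous_poly_mult by blast
qed

text \<open>
  Homogeneous equations of \<open>X\<close> may include nonzero constants, which do not vanish at the origin.
  Multiplying an equation by each coordinate repairs this.
\<close>

lemma closedin_zariski_iff:
  fixes X :: "('k::field_char_0 ^ 'r) set set"
  shows "closedin zariski X \<longleftrightarrow> X \<subseteq> proj_space \<and> zclosed (affine_cone X)"
proof safe
  assume "closedin zariski X"
  then obtain F where F: "\<forall>f\<in>F. \<exists>d. homogeneous_poly d f" "X = {L \<in> proj_space. \<forall>f\<in>F. \<forall>x\<in>L. f x = 0}"
    unfolding closedin_zariski by blast
  then have X: "X \<subseteq> proj_space" by auto
  show "L \<in> proj_space" if "L \<in> X" for L using X that by auto
  show "zclosed (affine_cone X)"
  proof (rule zero_closedI)
    fix x assume x: "x \<notin> affine_cone X"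
    then have x0: "x \<noteq> 0" by (auto simp: affine_cone_def)
    then have "vec.span {x} \<notin> X" using x mem_affine_cone[OF X] by blast
    then obtain f y where f: "f \<in> F" "y \<in> vec.span {x}" "f y \<noteq> 0"
      using F(2) span_singleton_proj_space[OF x0] by blast
    obtain d where d: "homogeneous_poly d f" using F(1) f(1) by blast
    have fx: "f x \<noteq> 0" using f(2,3) homogeneous_poly_scale[OF d] by (auto simp: vec.span_singleton)
    obtain i where i: "x $ i \<noteq> 0" using x0 by (auto simp: vec_eq_iff)
    have "(\<lambda>x. x $ i * f x) \<in> alg coords" by (intro alg_mult coords_alg homogeneous_poly_alg[OF d])
    moreover have "z $ i * f z = 0" if "z \<in> affine_cone X" for z using that F(2) f(1) by (auto simp: affine_cone_def)
    ultimately show "\<exists>f\<in>alg coords. (\<forall>z\<in>affine_cone X. f z = 0) \<and> f x \<noteq> 0"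
      using fx i by (intro bexI[of _ "\<lambda>x. x $ i * f x"]) auto
  qed
next
  assume X: "X \<subseteq> proj_space" and cl: "zclosed (affine_cone X)"
  define F where "F = {f. (\<exists>d. is_form d f) \<and> (\<forall>x\<in>affine_cone X. f x = 0)}"
  have "X = {L \<in> proj_space. \<forall>f\<in>F. \<forall>x\<in>L. f x = 0}"
  proof (intro equalityI subsetI)
    fix L assume "L \<in> {L \<in> proj_space. \<forall>f\<in>F. \<forall>x\<in>L. f x = 0}"
    then have L: "L \<in> proj_space" and z: "\<forall>f\<in>F. \<forall>x\<in>L. f x = 0" by auto
    obtain x where x: "x \<in> L" "x \<noteq> 0" "L = vec.span {x}" using proj_space_nonzero[OF L] by blast
    have "x \<in> affine_cone X"
    proof (rule ccontr)
      assume nx: "x \<notin> affine_cone X"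
      obtain d f where f: "is_form d f" "\<And>y. y \<in> affine_cone X \<Longrightarrow> f y = 0" "f x \<noteq> 0"
        using cone_separating_form[OF cl is_cone_affine_cone[OF X] nx] by blast
      then have "f \<in> F" unfolding F_def by blast
      then show False using z x(1) f(3) by blast
    qed
    then show "L \<in> X" using mem_affine_cone[OF X x(2)] x(3) by simp
  next
    fix L assume L: "L \<in> X"
    then have "L \<subseteq> affine_cone X" by (auto simp: affine_cone_def)
    then show "L \<in> {L \<in> proj_space. \<forall>f\<in>F. \<forall>x\<in>L. f x = 0}" using L X by (auto simp: F_def)
  qed
  moreover have "\<forall>f\<in>F. \<exists>d. homogeneous_poly d f" using form_homogeneous_poly by (auto simp: F_def)
  ultimately show "closedin zariski X" unfolding closedin_zariski by blast
qed

lemma closedin_proj_points: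
  fixes T :: "('k::field_char_0 ^ 'r) set"
  assumes "is_cone T" "zclosed T"
  shows "closedin zariski (proj_points T)"
  unfolding closedin_zariski_iff affine_cone_proj_points[OF assms(1)]
  by (intro conjI proj_points_subset assms(2))

text \<open>
  Homogeneous equations suffice to test irreducibility.  If \<open>f * g\<close> vanishes on the cone, then on each
  line of it one of the two polynomials \<open>f\<close> and \<open>g\<close> vanishes identically, and the lines of either kind
  form a closed set.
\<close>

lemma irreducible_zariski_iff:
  fixes X :: "('k::field_char_0 ^ 'r) set set"
  shows "irreducible_in zariski X \<longleftrightarrow> X \<subseteq> proj_space \<and> X \<noteq> {} \<and> zprime (affine_cone X)"
proof (intro iffI)
  assume irr: "irreducible_in zariski X"
  then have X: "X \<subseteq> proj_space" "X \<noteq> {}" by (auto simp: irreducible_in_def topspace_zariski)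
  have "zprime (affine_cone X)"
    unfolding zero_prime_def
  proof (intro conjI ballI impI)
    show "affine_cone X \<noteq> {}" by (simp add: affine_cone_def)
    fix f g :: "'k ^ 'r \<Rightarrow> 'k" assume f: "f \<in> alg coords" and g: "g \<in> alg coords" and fg: "\<forall>z\<in>affine_cone X. f z * g z = 0"
    define V where "V f = {L \<in> proj_space. \<forall>x\<in>L. f x = 0}" for f :: "'k ^ 'r \<Rightarrow> 'k"
    have clV: "closedin zariski (V f)" if f: "f \<in> alg coords" for f
    proof (cases "V f = {}")
      case False
      then obtain L where "L \<in> proj_space" "\<forall>x\<in>L. f x = 0" by (auto simp: V_def)
      then have "f 0 = 0" using vec.subspace_0[OF proj_space_subspace] by blast
      then have "0 \<in> lines_in f UNIV" by (simp add: lines_in_def)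
      then have c: "is_cone (lines_in f UNIV)" by (intro is_cone_lines_in) (auto simp: is_cone_def)
      have "(\<forall>x\<in>L. f x = 0) \<longleftrightarrow> (\<forall>x\<in>L. \<forall>c. f (c *s x) = 0)" if L: "L \<in> proj_space" for L
      proof
        show "\<forall>x\<in>L. \<forall>c. f (c *s x) = 0" if "\<forall>x\<in>L. f x = 0"
          using that vec.subspace_scale[OF proj_space_subspace[OF L]] by simp
        show "\<forall>x\<in>L. f x = 0" if a: "\<forall>x\<in>L. \<forall>c. f (c *s x) = 0"
        proof
          fix x assume "x \<in> L"
          then have "f (1 *s x) = 0" using a by blast
          then show "f x = 0" by simp
        qed
      qed
      then have "V f = proj_points (lines_in f UNIV)"
        by (auto simp: V_def proj_points_def lines_in_def)
      moreover have "zclosed (lines_in f UNIV)"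
        by (rule zero_closed_lines_in[OF zero_closedI f]) simp
      ultimately show ?thesis using closedin_proj_points[OF c] by simp
    qed simp
    have "X \<subseteq> V f \<union> V g"
    proof
      fix L assume L: "L \<in> X"
      then have Lp: "L \<in> proj_space" using X by auto
      then obtain z where z: "z \<in> L" "L = vec.span {z}" by (rule proj_space_nonzero)
      obtain P where P: "\<And>t. poly P t = f (0 + t *s z)" using alg_line[OF f] by blast
      obtain Q where Q: "\<And>t. poly Q t = g (0 + t *s z)" using alg_line[OF g] by blast
      have "poly (P * Q) t = 0" for t
      proof -
        have "t *s z \<in> L" using z(1) proj_space_subspace[OF Lp] by (intro vec.subspace_scale)
        then have "t *s z \<in> affine_cone X" using L by (auto simp: affine_cone_def)
        then show ?thesis using fg by (simp add: P Q)
      qed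
      then have "P * Q = 0" using poly_all_0_iff_0 by blast
      then have "P = 0 \<or> Q = 0" by simp
      then have "(\<forall>t. f (t *s z) = 0) \<or> (\<forall>t. g (t *s z) = 0)" using P Q by (metis add_0 poly_0)
      then show "L \<in> V f \<union> V g" using Lp z(2) by (auto simp: V_def vec.span_singleton)
    qed
    then have "X \<subseteq> V f \<or> X \<subseteq> V g" using irr clV[OF f] clV[OF g] by (simp add: irreducible_in_def)
    moreover have "\<forall>z\<in>affine_cone X. f z = 0" if "X \<subseteq> V f" for f
    proof -
      obtain L where "L \<in> X" using X by auto
      then have "0 \<in> L" using X(1) vec.subspace_0[OF proj_space_subspace] by blast
      then show ?thesis using that \<open>L \<in> X\<close> by (auto simp: affine_cone_def V_def)
    qed
    ultimately show "(\<forall>z\<in>affine_cone X. f z = 0) \<or> (\<forall>z\<in>affine_cone X. g z = 0)" by blast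
  qed
  then show "X \<subseteq> proj_space \<and> X \<noteq> {} \<and> zprime (affine_cone X)" using X by simp
next
  assume "X \<subseteq> proj_space \<and> X \<noteq> {} \<and> zprime (affine_cone X)"
  then have X: "X \<subseteq> proj_space" "X \<noteq> {}" and pr: "zprime (affine_cone X)" by auto
  show "irreducible_in zariski X"
    unfolding irreducible_in_def topspace_zariski
  proof (intro conjI allI impI)
    fix C D assume C: "closedin zariski C" and D: "closedin zariski D" and CD: "X \<subseteq> C \<union> D"
    have sep: "\<exists>f\<in>alg coords. (\<forall>z\<in>affine_cone C. f z = 0) \<and> (\<exists>x\<in>affine_cone X. f x \<noteq> 0)" if C: "closedin zariski C" and "\<not> X \<subseteq> C" for C
    proof -
      obtain L where L: "L \<in> X" "L \<notin> C" using \<open>\<not> X \<subseteq> C\<close> by auto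
      then obtain x where x: "x \<in> L" "x \<noteq> 0" "L = vec.span {x}" using X(1) proj_space_nonzero by blast
      have nx: "x \<notin> affine_cone C" using C L(2) mem_affine_cone[of C x] x by (simp add: closedin_zariski_iff)
      have "zclosed (affine_cone C)" using C by (simp add: closedin_zariski_iff)
      then obtain f where "f \<in> alg coords" "\<And>z. z \<in> affine_cone C \<Longrightarrow> f z = 0" "f x \<noteq> 0"
        using zero_closedE[OF _ nx] by blast
      moreover have "x \<in> affine_cone X" using L(1) x(1) by (auto simp: affine_cone_def)
      ultimately show ?thesis by blast
    qed
    show "X \<subseteq> C \<or> X \<subseteq> D"
    proof (rule ccontr)
      assume "\<not> ?thesis"
      then obtain f g where f: "f \<in> alg coords" "\<forall>z\<in>affine_cone C. f z = 0" "\<exists>x\<in>affine_cone X. f x \<noteq> 0"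
        and g: "g \<in> alg coords" "\<forall>z\<in>affine_cone D. g z = 0" "\<exists>x\<in>affine_cone X. g x \<noteq> 0"
        using sep[OF C] sep[OF D] by blast
      have "f z * g z = 0" if "z \<in> affine_cone X" for z
        using that CD f(2) g(2) by (auto simp: affine_cone_def)
      from zero_primeD[OF pr f(1) g(1) this] f(3) g(3) show False by blast
    qed
  qed (use X in auto)
qed

lemma zariski_closure_of:
  fixes A :: "('k::field_char_0 ^ 'r) set set"
  assumes "A \<subseteq> proj_space"
  shows "zariski closure_of A = proj_points (zclosure (affine_cone A))"
proof
  let ?T = "zclosure (affine_cone A)"
  have T: "is_cone ?T" by (rule cone_closure[OF is_cone_affine_cone[OF assms]])
  show "zariski closure_of A \<subseteq> proj_points ?T"
  proof (rule closure_of_minimal[OF _ closedin_proj_points[OF T zero_closed_closure]])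
    show "A \<subseteq> proj_points ?T"
    proof
      fix L assume "L \<in> A"
      then have "L \<subseteq> ?T" using zero_closure_superset[of "affine_cone A" "alg coords"] by (auto simp: affine_cone_def)
      then show "L \<in> proj_points ?T" using assms \<open>L \<in> A\<close> by (auto simp: proj_points_def)
    qed
  qed
  let ?C = "zariski closure_of A"
  have C: "closedin zariski ?C" by simp
  have "A \<subseteq> ?C" using assms by (intro closure_of_subset) (simp add: topspace_zariski)
  then have "affine_cone A \<subseteq> affine_cone ?C" by (auto simp: affine_cone_def)
  then have "?T \<subseteq> affine_cone ?C"
    using iffD1[OF closedin_zariski_iff C] by (intro zero_closure_minimal) auto
  then have "proj_points ?T \<subseteq> proj_points (affine_cone ?C)" by (auto simp: proj_points_def)
  then show "proj_points ?T \<subseteq> ?C"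
    using proj_points_affine_cone[of ?C] iffD1[OF closedin_zariski_iff C] by simp
qed

lemma irreducible_in_closed_subtopology:
  assumes "closedin T X" "Z \<subseteq> X"
  shows "irreducible_in (subtopology T X) Z \<longleftrightarrow> irreducible_in T Z"
proof -
  have cl: "closedin (subtopology T X) C \<longleftrightarrow> closedin T C \<and> C \<subseteq> X" for C
    by (rule closedin_closed_subtopology[OF assms(1)])
  have X: "X \<subseteq> topspace T" by (rule closedin_subset[OF assms(1)])
  show ?thesis
  proof
    assume i: "irreducible_in (subtopology T X) Z"
    show "irreducible_in T Z"
      unfolding irreducible_in_def
    proof (intro conjI allI impI)
      show "Z \<subseteq> topspace T" "Z \<noteq> {}" using X i assms(2) by (auto simp: irreducible_in_def)
      fix C D assume "closedin T C" "closedin T D" "Z \<subseteq> C \<union> D"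
      then have "closedin (subtopology T X) (C \<inter> X)" "closedin (subtopology T X) (D \<inter> X)" "Z \<subseteq> (C \<inter> X) \<union> (D \<inter> X)"
        using assms by (auto simp: cl)
      then have "Z \<subseteq> C \<inter> X \<or> Z \<subseteq> D \<inter> X" using i unfolding irreducible_in_def by blast
      then show "Z \<subseteq> C \<or> Z \<subseteq> D" by blast
    qed
  next
    assume "irreducible_in T Z"
    then show "irreducible_in (subtopology T X) Z"
      using assms(2) X by (auto simp: irreducible_in_def cl)
  qed
qed

lemma affine_cone_eq_0_iff: "X \<subseteq> proj_space \<Longrightarrow> affine_cone X = {0} \<longleftrightarrow> X = {}"
proof
  assume X: "X \<subseteq> proj_space" "affine_cone X = {0}"
  show "X = {}"
  proof (rule ccontr)
    assume "X \<noteq> {}"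
    then obtain L where "L \<in> X" by auto
    then have "L \<in> proj_space" using X(1) by auto
    then obtain x where "x \<in> L" "x \<noteq> 0" by (rule proj_space_nonzero)
    then show False using X(2) \<open>L \<in> X\<close> by (auto simp: affine_cone_def)
  qed
qed (simp add: affine_cone_def)

lemma affine_cone_strict_mono:
  assumes "X \<subseteq> proj_space" "Y \<subseteq> proj_space" "X \<subset> Y"
  shows "affine_cone X \<subset> affine_cone Y"
proof -
  have "affine_cone X \<subseteq> affine_cone Y" using assms(3) by (auto simp: affine_cone_def)
  moreover have "affine_cone X \<noteq> affine_cone Y"
  proof
    assume "affine_cone X = affine_cone Y"
    then have "proj_points (affine_cone X) = proj_points (affine_cone Y)" by simp
    then show False unfolding proj_points_affine_cone[OF assms(1)] proj_points_affine_cone[OF assms(2)] using assms(3) by simp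
  qed
  ultimately show ?thesis by (rule psubsetI)
qed

text \<open>
  The projective dimension is one less than the dimension of the cone because the cone \<open>{0}\<close>, which
  starts a maximal chain of irreducible closed cones, has no projective points.
\<close>

lemma proj_dim_has_dim:
  fixes X :: "('k::{alg_closed_field,field_char_0} ^ 'r) set set"
  assumes X: "integral_variety X" and D: "has_dim (affine_cone X) D"
  shows "1 \<le> D \<and> proj_dim X = enat (D - 1)"
proof -
  have cl: "closedin zariski X" and irr: "irreducible_in zariski X" using X by (auto simp: integral_variety_def)
  have XP: "X \<subseteq> proj_space" "X \<noteq> {}" and T: "zclosed (affine_cone X)" "is_cone (affine_cone X)" "zprime (affine_cone X)"
    using cl irr is_cone_affine_cone[of X] by (auto simp: closedin_zariski_iff irreducible_zariski_iff)
  obtain vs where vs: "indep_of (affine_cone X) vs" "add_span (affine_cone X) vs = UNIV" "length vs + D = CARD('r)"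
    using D by (auto simp: has_dim_def)
  have bound: "k + 1 \<le> D" if ch: "\<And>i. i \<le> k \<Longrightarrow> closedin zariski (Z i) \<and> Z i \<subseteq> X \<and> irreducible_in zariski (Z i)"
    "\<And>i. i < k \<Longrightarrow> Z i \<subset> Z (Suc i)" for k and Z :: "nat \<Rightarrow> ('k ^ 'r) set set"
  proof -
    have ZP: "Z i \<subseteq> proj_space" if "i \<le> k" for i using ch(1)[OF that] by (simp add: closedin_zariski_iff)
    have "k + 1 + length vs \<le> CARD('r)"
    proof (rule chain_length_bound[of k "\<lambda>i. affine_cone (Z i)"])
      show "zclosed (affine_cone (Z i)) \<and> is_cone (affine_cone (Z i)) \<and> zprime (affine_cone (Z i))" if "i \<le> k" for i
        using ch(1)[OF that] is_cone_affine_cone by (auto simp: closedin_zariski_iff irreducible_zariski_iff)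
      show "affine_cone (Z i) \<subset> affine_cone (Z (Suc i))" if "i < k" for i
        using affine_cone_strict_mono[OF ZP ZP ch(2)] that by simp
      show "affine_cone (Z 0) \<noteq> {0}"
        using ch(1)[of 0] affine_cone_eq_0_iff[of "Z 0"] by (auto simp: irreducible_zariski_iff)
      show "indep_of (affine_cone (Z k)) vs"
        by (rule indep_of_mono[OF _ vs(1)]) (use ch(1)[of k] in \<open>auto simp: affine_cone_def\<close>)
    qed
    then show ?thesis using vs(3) by simp
  qed
  \<comment> \<open>The chain that consists of \<open>X\<close> alone.\<close>
  have D1: "1 \<le> D" using bound[of 0 "\<lambda>_. X"] cl irr by simp
  let ?S = "{enat k | k. \<exists>Z :: nat \<Rightarrow> ('k ^ 'r) set set.
     (\<forall>i\<le>k. closedin (subtopology zariski X) (Z i) \<and> irreducible_in (subtopology zariski X) (Z i)) \<and>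
       (\<forall>i<k. Z i \<subset> Z (Suc i))}"
  have clsub: "closedin (subtopology zariski X) C \<longleftrightarrow> closedin zariski C \<and> C \<subseteq> X" for C
    by (rule closedin_closed_subtopology[OF cl])
  have "Sup ?S \<le> enat (D - 1)"
  proof (rule Sup_least)
    fix y assume "y \<in> ?S"
    then obtain k and Z :: "nat \<Rightarrow> ('k ^ 'r) set set" where y: "y = enat k"
      and Z: "\<forall>i\<le>k. closedin (subtopology zariski X) (Z i) \<and> irreducible_in (subtopology zariski X) (Z i)"
       "\<forall>i<k. Z i \<subset> Z (Suc i)" by blast
    have "k + 1 \<le> D"
    proof (rule bound)
      show "closedin zariski (Z i) \<and> Z i \<subseteq> X \<and> irreducible_in zariski (Z i)" if "i \<le> k" for i
        using Z(1) that irreducible_in_closed_subtopology[OF cl, of "Z i"] by (simp add: clsub)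
    qed (use Z(2) in blast)
    then show "y \<le> enat (D - 1)" by (simp add: y)
  qed
  moreover have "enat (D - 1) \<le> Sup ?S"
  proof (rule Sup_upper)
    have "\<exists>Z. (\<forall>i\<le>D - 1. zclosed (Z i) \<and> is_cone (Z i) \<and> zprime (Z i) \<and> Z i \<noteq> {0})
     \<and> (\<forall>i<D - 1. Z i \<subset> Z (Suc i)) \<and> Z (D - 1) = affine_cone X"
      by (rule chain_exists[OF T vs(1)])
        (use D1 vs in \<open>auto simp: vec.dim_UNIV vec.dimension_def card_cart_basis\<close>)
    then obtain Z where Z: "\<And>i. i \<le> D - 1 \<Longrightarrow> zclosed (Z i) \<and> is_cone (Z i) \<and> zprime (Z i) \<and> Z i \<noteq> {0}"
      "\<And>i. i < D - 1 \<Longrightarrow> Z i \<subset> Z (Suc i)" "Z (D - 1) = affine_cone X" by blast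
    have af: "affine_cone (proj_points (Z i)) = Z i" if "i \<le> D - 1" for i using affine_cone_proj_points Z(1)[OF that] by blast
    have sub: "Z i \<subseteq> affine_cone X" if "i \<le> D - 1" for i
      using that
    proof (induction "D - 1 - i" arbitrary: i)
      case 0
      then have "i = D - 1" by simp
      then show ?case using Z(3) by simp
    next
      case (Suc n)
      then have "Z (Suc i) \<subseteq> affine_cone X" "Z i \<subset> Z (Suc i)" using Z(2)[of i] Suc.hyps(1)[of "Suc i"] by auto
      then show ?case by blast
    qed
    have 1: "closedin zariski (proj_points (Z i)) \<and> proj_points (Z i) \<subseteq> X \<and> irreducible_in zariski (proj_points (Z i))"
      if "i \<le> D - 1" for i
    proof (intro conjI)
      show "closedin zariski (proj_points (Z i))" using closedin_proj_points Z(1)[OF that] by blast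
      show "proj_points (Z i) \<subseteq> X" using sub[OF that] proj_points_affine_cone[OF XP(1)] by (auto simp: proj_points_def)
      show "irreducible_in zariski (proj_points (Z i))"
        unfolding irreducible_zariski_iff af[OF that]
        using Z(1)[OF that] proj_points_subset af[OF that] affine_cone_eq_0_iff[OF proj_points_subset, of "Z i"] by auto
    qed
    have 2: "proj_points (Z i) \<subset> proj_points (Z (Suc i))" if "i < D - 1" for i
    proof -
      have "proj_points (Z i) \<subseteq> proj_points (Z (Suc i))" using Z(2)[OF that] by (auto simp: proj_points_def)
      moreover have "proj_points (Z i) \<noteq> proj_points (Z (Suc i))"
      proof
        assume "proj_points (Z i) = proj_points (Z (Suc i))"
        then have "affine_cone (proj_points (Z i)) = affine_cone (proj_points (Z (Suc i)))" by simp
        moreover have "i \<le> D - 1" "Suc i \<le> D - 1" using that by auto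
        ultimately have "Z i = Z (Suc i)" unfolding af[OF \<open>i \<le> D - 1\<close>] af[OF \<open>Suc i \<le> D - 1\<close>] by simp
        then show False using Z(2)[OF that] by simp
      qed
      ultimately show ?thesis by (rule psubsetI)
    qed
    have 3: "closedin (subtopology zariski X) (proj_points (Z i)) \<and> irreducible_in (subtopology zariski X) (proj_points (Z i))"
      if "i \<le> D - 1" for i
      using 1[OF that] irreducible_in_closed_subtopology[OF cl, of "proj_points (Z i)"] by (simp add: clsub)
    show "enat (D - 1) \<in> ?S"
      by (intro CollectI exI[of _ "D - 1"] conjI exI[of _ "\<lambda>i. proj_points (Z i)"] allI impI refl 2 3)
  qed
  ultimately have "Sup ?S = enat (D - 1)" by (rule antisym)
  then show ?thesis using D1 unfolding proj_dim_def krull_dim_def by simp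
qed

section \<open>Secant varieties as closures of sums\<close>

definition sumset :: "nat \<Rightarrow> ('k::field ^ 'r) set \<Rightarrow> ('k ^ 'r) set" where
  "sumset b C = {(\<Sum>i<b. c i) | c. \<forall>i<b. c i \<in> C}"

lemma sumsetI: "(\<And>i. i < b \<Longrightarrow> c i \<in> C) \<Longrightarrow> x = (\<Sum>i<b. c i) \<Longrightarrow> x \<in> sumset b C"
  unfolding sumset_def by blast

lemma sumsetE:
  assumes "x \<in> sumset b C"
  obtains c where "\<And>i. i < b \<Longrightarrow> c i \<in> C" "x = (\<Sum>i<b. c i)"
  using assms unfolding sumset_def by blast

lemma sumset_0: "sumset 0 C = {0}"
  by (auto simp: sumset_def)

lemma sumset_Suc: "sumset (Suc b) C = {x + y | x y. x \<in> sumset b C \<and> y \<in> C}"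
proof (intro equalityI subsetI)
  fix z assume "z \<in> sumset (Suc b) C"
  then obtain c where c: "\<And>i. i < Suc b \<Longrightarrow> c i \<in> C" "z = (\<Sum>i<Suc b. c i)" by (rule sumsetE) blast
  then have "(\<Sum>i<b. c i) \<in> sumset b C" by (intro sumsetI[where c = c]) auto
  then show "z \<in> {x + y | x y. x \<in> sumset b C \<and> y \<in> C}" using c by auto
next
  fix z assume "z \<in> {x + y | x y. x \<in> sumset b C \<and> y \<in> C}"
  then obtain x y where z: "z = x + y" "x \<in> sumset b C" "y \<in> C" by blast
  obtain c where c: "\<And>i. i < b \<Longrightarrow> c i \<in> C" "x = (\<Sum>i<b. c i)" using z(2) by (rule sumsetE) blast
  have "(\<Sum>i<b. (c(b := y)) i) = (\<Sum>i<b. c i)" by (rule sum.cong) auto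
  then show "z \<in> sumset (Suc b) C"
    using c z by (intro sumsetI[where c = "c(b := y)"]) (auto simp: less_Suc_eq)
qed

lemma is_cone_sumset: "is_cone C \<Longrightarrow> is_cone (sumset b C)"
proof (induction b)
  case (Suc b)
  then have s: "is_cone (sumset b C)" by simp
  show ?case
    unfolding is_cone_def sumset_Suc
  proof (intro conjI ballI allI)
    show "0 \<in> {x + y | x y. x \<in> sumset b C \<and> y \<in> C}"
      using cone_0[OF s] cone_0[OF Suc(2)] by force
    fix z c assume "z \<in> {x + y | x y. x \<in> sumset b C \<and> y \<in> C}"
    then obtain x y where "z = x + y" "x \<in> sumset b C" "y \<in> C" by blast
    then have "c *s z = c *s x + c *s y" "c *s x \<in> sumset b C" "c *s y \<in> C"
      using cone_scale[OF s] cone_scale[OF Suc(2)] by (auto simp: vec.scale_right_distrib)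
    then show "c *s z \<in> {x + y | x y. x \<in> sumset b C \<and> y \<in> C}" by blast
  qed
qed (simp add: sumset_0 is_cone_singleton_0)

lemma span_lines_subset_sumset:
  assumes "Y \<subseteq> proj_space" "set ps \<subseteq> Y"
  shows "vec.span (\<Union>(set ps)) \<subseteq> sumset (length ps) (affine_cone Y)"
  using assms(2)
proof (induction ps)
  case Nil
  then show ?case by (simp add: sumset_0)
next
  case (Cons L ps)
  have L: "L \<in> Y" "vec.subspace L" using Cons.prems assms(1) by (auto intro: proj_space_subspace)
  show ?case
  proof
    fix x assume "x \<in> vec.span (\<Union>(set (L # ps)))"
    then have "x \<in> vec.span (\<Union>(set ps) \<union> L)" by (simp add: Un_commute)
    then obtain y z where xyz: "x = y + z" "y \<in> vec.span (\<Union>(set ps))" "z \<in> vec.span L"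
      unfolding vec.span_Un by blast
    have "vec.span L \<subseteq> L" by (rule vec.span_minimal[OF order_refl L(2)])
    then have "z \<in> L" using xyz(3) by blast
    then have "z \<in> affine_cone Y" using L(1) by (auto simp: affine_cone_def)
    then show "x \<in> sumset (length (L # ps)) (affine_cone Y)"
      using xyz Cons by (auto simp: sumset_Suc)
  qed
qed

lemma affine_cone_secant_spans:
  assumes Y: "Y \<subseteq> proj_space" "Y \<noteq> {}"
  shows "affine_cone (\<Union>ps \<in> {ps. length ps = b \<and> set ps \<subseteq> Y}. proj_span (set ps)) = sumset b (affine_cone Y)"
    (is "affine_cone ?U = _")
proof
  have c: "is_cone (sumset b (affine_cone Y))" by (rule is_cone_sumset[OF is_cone_affine_cone[OF Y(1)]])
  show "affine_cone ?U \<subseteq> sumset b (affine_cone Y)"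
    using span_lines_subset_sumset[OF Y(1)] cone_0[OF c] by (fastforce simp: affine_cone_def proj_span_def proj_points_def)
  show "sumset b (affine_cone Y) \<subseteq> affine_cone ?U"
  proof
    fix x assume "x \<in> sumset b (affine_cone Y)"
    then obtain c where c: "\<And>i. i < b \<Longrightarrow> c i \<in> affine_cone Y" "x = (\<Sum>i<b. c i)" by (rule sumsetE) blast
    have "\<forall>i. \<exists>L. i < b \<longrightarrow> L \<in> Y \<and> c i \<in> L"
    proof
      fix i
      show "\<exists>L. i < b \<longrightarrow> L \<in> Y \<and> c i \<in> L"
      proof (cases "i < b \<and> c i \<noteq> 0")
        case True
        then show ?thesis using c(1)[of i] by (auto simp: affine_cone_def)
      next
        case False
        obtain L where "L \<in> Y" using Y(2) by auto
        moreover have "0 \<in> L" using \<open>L \<in> Y\<close> Y(1) by (intro vec.subspace_0 proj_space_subspace) auto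
        ultimately show ?thesis using False by auto
      qed
    qed
    then obtain L where L: "\<And>i. i < b \<Longrightarrow> L i \<in> Y \<and> c i \<in> L i" by metis
    define ps where "ps = map L [0..<b]"
    have ps: "length ps = b" "set ps \<subseteq> Y" using L by (auto simp: ps_def)
    have "c i \<in> \<Union>(set ps)" if "i < b" for i
      using L[OF that] that by (auto simp: ps_def intro!: bexI[of _ i])
    then have xs: "x \<in> vec.span (\<Union>(set ps))"
      unfolding c(2) by (intro vec.span_sum vec.span_base) simp
    show "x \<in> affine_cone ?U"
    proof (cases "x = 0")
      case False
      have "vec.span {x} \<subseteq> vec.span (\<Union>(set ps))"
        using xs by (intro vec.span_minimal) auto
      then have "vec.span {x} \<in> proj_span (set ps)"
        using span_singleton_proj_space[OF False] by (simp add: proj_span_def proj_points_def)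
      then show ?thesis using ps vec.span_base[of x "{x}"] by (auto simp: affine_cone_def)
    qed (simp add: affine_cone_def)
  qed
qed

lemma secant_variety_eq:
  fixes Y :: "('k::field_char_0 ^ 'r) set set"
  assumes "Y \<subseteq> proj_space" "Y \<noteq> {}"
  shows "secant_variety b Y = proj_points (zclosure (sumset b (affine_cone Y)))"
proof -
  have "(\<Union>ps \<in> {ps. length ps = b \<and> set ps \<subseteq> Y}. proj_span (set ps)) \<subseteq> proj_space"
    by (auto simp: proj_span_def proj_points_def)
  from zariski_closure_of[OF this] show ?thesis
    unfolding secant_variety_def affine_cone_secant_spans[OF assms] .
qed

text \<open>
  The image of a product of irreducible sets is irreducible.  For fixed \<open>y\<close> one of the two factors
  vanishes on all of \<open>X\<close>; if neither vanished everywhere, irreducibility of \<open>C\<close> would give a \<open>y\<close> for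
  which both are nonzero somewhere.
\<close>

lemma zero_prime_image2:
  assumes X: "zero_prime (alg G) X" and C: "zero_prime (alg H) C"
    and Z: "Z = {\<phi> x y | x y. x \<in> X \<and> y \<in> C}"
    and G: "\<And>f y. f \<in> R \<Longrightarrow> y \<in> C \<Longrightarrow> (\<lambda>x. f (\<phi> x y)) \<in> alg G"
    and H: "\<And>f x. f \<in> R \<Longrightarrow> x \<in> X \<Longrightarrow> (\<lambda>y. f (\<phi> x y)) \<in> alg H"
  shows "zero_prime R Z"
  unfolding zero_prime_def
proof (intro conjI ballI impI)
  show "Z \<noteq> {}" using X C unfolding Z zero_prime_def by auto
  fix f g assume f: "f \<in> R" and g: "g \<in> R" and fg: "\<forall>z\<in>Z. f z * g z = 0"
  have *: "(\<forall>x\<in>X. f (\<phi> x y) = 0) \<or> (\<forall>x\<in>X. g (\<phi> x y) = 0)" if y: "y \<in> C" for y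
    by (rule zero_primeD[OF X G[OF f y] G[OF g y]]) (use fg y in \<open>auto simp: Z\<close>)
  show "(\<forall>z\<in>Z. f z = 0) \<or> (\<forall>z\<in>Z. g z = 0)"
  proof (rule ccontr)
    assume "\<not> ?thesis"
    then obtain x1 y1 x2 y2 where x: "x1 \<in> X" "y1 \<in> C" "f (\<phi> x1 y1) \<noteq> 0" "x2 \<in> X" "y2 \<in> C" "g (\<phi> x2 y2) \<noteq> 0"
      unfolding Z by blast
    have "f (\<phi> x1 y) * g (\<phi> x2 y) = 0" if "y \<in> C" for y
      using *[OF that] x by auto
    from zero_primeD[OF C H[OF f x(1)] H[OF g x(4)] this] x show False by blast
  qed
qed

text \<open>
  The \<open>b\<close>-fold power of \<open>C\<close>, as functions that vanish on all further blocks.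
\<close>

definition blocks :: "nat \<Rightarrow> ('k::field ^ 'r) set \<Rightarrow> (nat \<times> 'r \<Rightarrow> 'k) set" where
  "blocks b C = {x. (\<forall>i<b. (\<chi> j. x (i, j)) \<in> C) \<and> (\<forall>i j. b \<le> i \<longrightarrow> x (i, j) = 0)}"

lemma zero_closed_blocks:
  fixes C :: "('k::field ^ 'r) set"
  assumes "zclosed C"
  shows "zero_closed (alg evals) (blocks b C)"
proof (rule zero_closedI)
  fix x :: "nat \<times> 'r \<Rightarrow> 'k" assume "x \<notin> blocks b C"
  then consider i where "i < b" "(\<chi> j. x (i, j)) \<notin> C" | i j where "b \<le> i" "x (i, j) \<noteq> 0"
    by (auto simp: blocks_def)
  then show "\<exists>f\<in>alg evals. (\<forall>z\<in>blocks b C. f z = 0) \<and> f x \<noteq> 0"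
  proof cases
    case 1
    obtain f where f: "f \<in> alg coords" "\<And>z. z \<in> C \<Longrightarrow> f z = 0" "f (\<chi> j. x (i, j)) \<noteq> 0"
      by (rule zero_closedE[OF assms 1(2)]) blast
    have "(\<lambda>x. f (\<chi> j. x (i, j))) \<in> alg evals"
      by (rule alg_compose[OF f(1)]) (auto elim!: coords_cases intro: alg_evals)
    then show ?thesis using f 1 by (intro bexI[of _ "\<lambda>x. f (\<chi> j. x (i, j))"]) (auto simp: blocks_def)
  next
    case 2
    then show ?thesis by (intro bexI[of _ "\<lambda>x. x (i, j)"]) (auto simp: blocks_def intro: alg_evals)
  qed
qed

lemma zero_prime_blocks:
  fixes C :: "('k::field ^ 'r) set"
  assumes "zprime C"
  shows "zero_prime (alg evals) (blocks b C)"
proof (induction b)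
  case 0
  have "blocks 0 C = {\<lambda>_. 0}" by (auto simp: blocks_def fun_eq_iff)
  then show ?case by (simp add: zero_prime_def)
next
  case (Suc b)
  define \<phi> where "\<phi> x y = (\<lambda>(i, j). if i = b then y $ j else x (i, j))" for x :: "nat \<times> 'r \<Rightarrow> 'k" and y :: "'k ^ 'r"
  have \<phi>b: "(\<chi> j. \<phi> x y (b, j)) = y" for x y by (simp add: \<phi>_def)
  have \<phi>i: "\<phi> x y (i, j) = x (i, j)" if "i \<noteq> b" for x y i j using that by (simp add: \<phi>_def)
  show ?case
  proof (rule zero_prime_image2[OF Suc.IH assms])
    show "blocks (Suc b) C = {\<phi> x y | x y. x \<in> blocks b C \<and> y \<in> C}"
    proof (intro equalityI subsetI)
      fix z assume z: "z \<in> blocks (Suc b) C"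
      define x where "x = (\<lambda>(i, j). if i = b then 0 else z (i, j))"
      have "z = \<phi> x (\<chi> j. z (b, j))" by (auto simp: \<phi>_def x_def fun_eq_iff)
      moreover have "x \<in> blocks b C" "(\<chi> j. z (b, j)) \<in> C" using z by (auto simp: blocks_def x_def)
      ultimately show "z \<in> {\<phi> x y | x y. x \<in> blocks b C \<and> y \<in> C}" by blast
    next
      fix z assume "z \<in> {\<phi> x y | x y. x \<in> blocks b C \<and> y \<in> C}"
      then obtain x y where z: "z = \<phi> x y" "x \<in> blocks b C" "y \<in> C" by blast
      then show "z \<in> blocks (Suc b) C"
        by (auto simp: blocks_def \<phi>b \<phi>i less_Suc_eq)
    qed
    fix f :: "(nat \<times> 'r \<Rightarrow> 'k) \<Rightarrow> 'k" assume f: "f \<in> alg evals"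
    show "(\<lambda>x. f (\<phi> x y)) \<in> alg evals" for y
    proof (rule alg_compose[OF f])
      fix g :: "(nat \<times> 'r \<Rightarrow> 'k) \<Rightarrow> 'k" assume "g \<in> evals"
      then obtain i j where "g = (\<lambda>x. x (i, j))" by (auto simp: evals_def)
      then show "(\<lambda>x. g (\<phi> x y)) \<in> alg evals"
        by (cases "i = b") (auto simp: \<phi>_def intro: alg_const alg_evals)
    qed
    show "(\<lambda>y. f (\<phi> x y)) \<in> alg coords" for x
    proof (rule alg_compose[OF f])
      fix g :: "(nat \<times> 'r \<Rightarrow> 'k) \<Rightarrow> 'k" assume "g \<in> evals"
      then obtain i j where "g = (\<lambda>x. x (i, j))" by (auto simp: evals_def)
      then show "(\<lambda>y. g (\<phi> x y)) \<in> alg coords"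
        by (cases "i = b") (auto simp: \<phi>_def intro: alg_const coords_alg)
    qed
  qed
qed

lemma sumset_eq_image_blocks: "sumset b C = (\<lambda>x. \<Sum>i<b. \<chi> j. x (i, j)) ` blocks b C"
proof (intro equalityI subsetI)
  fix z assume "z \<in> sumset b C"
  then obtain c where c: "\<And>i. i < b \<Longrightarrow> c i \<in> C" "z = (\<Sum>i<b. c i)" by (rule sumsetE) blast
  define x where "x = (\<lambda>(i, j). if i < b then c i $ j else 0)"
  have "(\<chi> j. x (i, j)) = c i" if "i < b" for i using that by (simp add: x_def)
  then have "x \<in> blocks b C" "z = (\<Sum>i<b. \<chi> j. x (i, j))"
    using c by (auto simp: blocks_def x_def)
  then show "z \<in> (\<lambda>x. \<Sum>i<b. \<chi> j. x (i, j)) ` blocks b C" by blast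
next
  fix z assume "z \<in> (\<lambda>x. \<Sum>i<b. \<chi> j. x (i, j)) ` blocks b C"
  then obtain x where x: "x \<in> blocks b C" "z = (\<Sum>i<b. \<chi> j. x (i, j))" by blast
  show "z \<in> sumset b C"
    by (rule sumsetI[where c = "\<lambda>i. \<chi> j. x (i, j)"]) (use x in \<open>auto simp: blocks_def\<close>)
qed

lemma block_sum_alg: "(\<lambda>x. (\<Sum>i<b. \<chi> j. x (i, j)) $ k) \<in> alg evals"
  by (simp add: sum_component) (intro alg_sum alg_evals)

lemma zero_prime_sumset:
  fixes C :: "('k::field ^ 'r) set"
  assumes "zprime C"
  shows "zprime (sumset b C)"
  unfolding zero_prime_def
proof (intro conjI ballI impI)
  note pr = zero_prime_blocks[OF assms, of b]
  let ?s = "\<lambda>x. \<Sum>i<b. \<chi> j. x (i, j)"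
  show "sumset b C \<noteq> {}" using pr unfolding sumset_eq_image_blocks zero_prime_def by simp
  fix f g :: "'k ^ 'r \<Rightarrow> 'k" assume f: "f \<in> alg coords" and g: "g \<in> alg coords" and fg: "\<forall>z\<in>sumset b C. f z * g z = 0"
  have pull: "(\<lambda>x. f (?s x)) \<in> alg evals" if "f \<in> alg coords" for f :: "'k ^ 'r \<Rightarrow> 'k"
    by (rule alg_compose[OF that]) (auto elim!: coords_cases intro: block_sum_alg simp del: sum_component)
  have "f (?s x) * g (?s x) = 0" if "x \<in> blocks b C" for x
    using fg that by (simp add: sumset_eq_image_blocks)
  from zero_primeD[OF pr pull[OF f] pull[OF g] this]
  show "(\<forall>z\<in>sumset b C. f z = 0) \<or> (\<forall>z\<in>sumset b C. g z = 0)" by (simp add: sumset_eq_image_blocks)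
qed

text \<open>
  Chevalley's theorem for the sum map on the power of \<open>C\<close>.  As everything is invariant under scaling,
  the open set may be given by one homogeneous component of the polynomial found there.  The form is
  multiplied by a coordinate to make its degree positive, so that its zeros form a cone.
\<close>

lemma sumset_contains_open:
  fixes C :: "('k::{alg_closed_field,field_char_0} ^ 'r) set"
  assumes C: "zclosed C" "zprime C" "is_cone C" and ne: "sumset b C \<noteq> {0}"
  shows "\<exists>d F. is_form d F \<and> d > 0 \<and> (\<exists>x\<in>sumset b C. F x \<noteq> 0) \<and>
    (\<forall>z\<in>zclosure (sumset b C). F z \<noteq> 0 \<longrightarrow> z \<in> sumset b C)"
proof -
  let ?T = "zclosure (sumset b C)"
  have cs: "is_cone (sumset b C)" by (rule is_cone_sumset[OF C(3)])
  have cT: "is_cone ?T" by (rule cone_closure[OF cs])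
  have "\<exists>h\<in>alg coords. (\<exists>x\<in>blocks b C. h (\<Sum>i<b. \<chi> j. x (i, j)) \<noteq> 0) \<and>
    (\<forall>z\<in>zclosure ((\<lambda>x. \<Sum>i<b. \<chi> j. x (i, j)) ` blocks b C). h z \<noteq> 0 \<longrightarrow>
      z \<in> (\<lambda>x. \<Sum>i<b. \<chi> j. x (i, j)) ` blocks b C)"
  proof (rule image_contains_open[where I = "{..<b} \<times> UNIV"])
    show "(\<Sum>i<b. \<chi> j. x (i, j)) = (\<Sum>i<b. \<chi> j. x' (i, j))" if "\<And>i. i \<in> {..<b} \<times> UNIV \<Longrightarrow> x i = x' i" for x x' :: "nat \<times> 'r \<Rightarrow> 'k"
      by (rule sum.cong) (use that in auto)
    show "x i = 0" if "x \<in> blocks b C" "i \<notin> {..<b} \<times> UNIV" for x i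
      using that by (cases i) (auto simp: blocks_def)
  qed (auto intro: zero_closed_blocks zero_prime_blocks C block_sum_alg simp del: sum_component)
  then obtain h x where h: "h \<in> alg coords" "x \<in> sumset b C" "h x \<noteq> 0" "\<And>z. z \<in> ?T \<Longrightarrow> h z \<noteq> 0 \<Longrightarrow> z \<in> sumset b C"
    unfolding sumset_eq_image_blocks[symmetric] by (auto simp: sumset_eq_image_blocks)
  from h(1) have "h \<in> alg ({} \<union> coords)" by simp
  then obtain N H where H: "\<And>d. is_form d (H d)" "\<And>x. h x = (\<Sum>d\<le>N. H d x)"
    using alg_graded[of h "{}" coords] by metis
  obtain d where d: "d \<le> N" "H d x \<noteq> 0" using h(3) H(2)[of x] by (metis atMost_iff sum.neutral)
  have in_sumset: "z \<in> sumset b C" if z: "z \<in> ?T" "H d z \<noteq> 0" for z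
  proof -
    obtain P where P: "\<And>t. poly P t = h (0 + t *s z)" using alg_line[OF h(1)] by blast
    have "P \<noteq> 0"
    proof
      assume "P = 0"
      then have "h (s *s z) = 0" for s using P[of s] by simp
      then have "(\<Sum>d\<le>N. s ^ d * H d z) = 0" for s
        by (simp add: H(2) form_scale[OF H(1)])
      from polynomial_coeffs_zero[where N = N and c = "\<lambda>d. H d z", OF this d(1)] z(2) show False by simp
    qed
    \<comment> \<open>The factor excludes the root \<open>0\<close>, as one has to divide by \<open>t\<close>.\<close>
    then have "P * [:0, 1:] \<noteq> 0" by simp
    then obtain t where "poly (P * [:0, 1:]) t \<noteq> 0" by (rule poly_nonroot)
    then have t: "t \<noteq> 0" "h (t *s z) \<noteq> 0" by (auto simp: P)
    have "t *s z \<in> sumset b C" by (rule h(4)[OF cone_scale[OF cT z(1)] t(2)])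
    from cone_scale[OF cs this, of "inverse t"] show ?thesis using t(1) by (simp add: vector_smult_assoc)
  qed
  obtain x' where x': "x' \<in> sumset b C" "x' \<noteq> 0" "H d x' \<noteq> 0"
  proof (cases "d = 0")
    case True
    obtain x' where "x' \<in> sumset b C" "x' \<noteq> 0" using ne cone_0[OF cs] by auto
    moreover have "H d x' = H d x"
      using form_scale[OF H(1), of d 0 x'] form_scale[OF H(1), of d 0 x] True by simp
    ultimately show ?thesis using that d(2) by simp
  next
    case False
    then have "H d 0 = 0" using form_scale[OF H(1), of d 0 0] by (simp add: power_0_left)
    then show ?thesis using that[of x] h(2) d(2) by auto
  qed
  obtain i where i: "x' $ i \<noteq> 0" using x'(2) by (auto simp: vec_eq_iff)
  have "is_form (1 + d) (\<lambda>x. x $ i * H d x)"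
    by (rule forms_mult[OF forms_gen H(1)]) (simp add: coords_def)
  moreover have "\<exists>x\<in>sumset b C. x $ i * H d x \<noteq> 0" using x' i by (intro bexI[of _ x']) auto
  moreover have "\<forall>z\<in>?T. z $ i * H d z \<noteq> 0 \<longrightarrow> z \<in> sumset b C" using in_sumset by auto
  ultimately show ?thesis
    by (intro exI[of _ "1 + d"] exI[of _ "\<lambda>x. x $ i * H d x"] conjI) simp_all
qed

text \<open>
  Replacing the set of sums by its closure before adding another vector does not change the closure, as
  polynomials in \<open>x + y\<close> are polynomials in \<open>x\<close> for fixed \<open>y\<close>.
\<close>

lemma closure_sumset_Suc:
  "zclosure {x + y | x y. x \<in> zclosure (sumset b C) \<and> y \<in> C} =
    zclosure (sumset (Suc b) C)" (is "zero_closure _ ?A = ?B")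
proof
  have "?A \<subseteq> ?B"
  proof
    fix z assume "z \<in> ?A"
    then obtain x y where z: "z = x + y" "x \<in> zclosure (sumset b C)" "y \<in> C" by blast
    show "z \<in> ?B"
      unfolding zero_closure_def
    proof (intro CollectI ballI impI)
      fix f assume f: "f \<in> alg coords" "\<forall>z\<in>sumset (Suc b) C. f z = 0"
      have "(\<lambda>x. f (x + y)) \<in> alg coords"
        by (rule alg_compose[OF f(1)]) (auto elim!: coords_cases intro!: alg_add alg_const coords_alg)
      moreover have "f (x + y) = 0" if "x \<in> sumset b C" for x using f(2) z(3) that by (auto simp: sumset_Suc)
      ultimately show "f z = 0"
        unfolding z(1) using zero_closure_vanish[OF _ _ z(2), of "\<lambda>x. f (x + y)"] by simp
    qed
  qed
  then show "zclosure ?A \<subseteq> ?B" by (rule zero_closure_minimal[OF zero_closed_closure])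
  have "sumset (Suc b) C \<subseteq> ?A" unfolding sumset_Suc by (auto intro: zero_closureI)
  also have "?A \<subseteq> zclosure ?A" by (rule zero_closure_superset)
  finally show "?B \<subseteq> zclosure ?A" by (rule zero_closure_minimal[OF zero_closed_closure])
qed

lemma has_dim_sumset_Suc:
  fixes C :: "('k::{alg_closed_field,field_char_0} ^ 'r) set"
  assumes "zclosed C" "is_cone C" "has_dim C m"
    and "has_dim (zclosure (sumset b C)) d" "has_dim (zclosure (sumset (Suc b) C)) e"
  shows "e \<le> d + m"
proof (rule has_dim_sum_le[OF zero_closed_closure cone_closure[OF is_cone_sumset[OF assms(2)]] assms(4) assms(1-3)])
  let ?T = "zclosure (sumset b C)"
  have T: "is_cone ?T" by (rule cone_closure[OF is_cone_sumset[OF assms(2)]])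
  show "is_cone {x + y | x y. x \<in> ?T \<and> y \<in> C}"
    unfolding is_cone_def
  proof (intro conjI ballI allI)
    show "0 \<in> {x + y | x y. x \<in> ?T \<and> y \<in> C}" using cone_0[OF T] cone_0[OF assms(2)] by force
    fix z c assume "z \<in> {x + y | x y. x \<in> ?T \<and> y \<in> C}"
    then obtain x y where "z = x + y" "x \<in> ?T" "y \<in> C" by blast
    then have "c *s z = c *s x + c *s y" "c *s x \<in> ?T" "c *s y \<in> C"
      using cone_scale[OF T] cone_scale[OF assms(2)] by (auto simp: vec.scale_right_distrib)
    then show "c *s z \<in> {x + y | x y. x \<in> ?T \<and> y \<in> C}" by blast
  qed
  show "has_dim (zclosure {x + y | x y. x \<in> ?T \<and> y \<in> C}) e"
    using assms(5) by (simp add: closure_sumset_Suc)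
qed

section \<open>Vectors of a subspace from its Pluecker coordinates\<close>

text \<open>
  Cramer's rule: for the maximal minors \<open>p\<close> of a matrix with columns \<open>\<sigma>\<close> selected as a reference, the
  vectors \<open>minor_row \<sigma> i p\<close> are, up to the factor \<open>p $ \<sigma>\<close>, the rows of the echelon form of the matrix
  with respect to these columns.
\<close>

definition minor_row :: "('v \<Rightarrow> 'n) \<Rightarrow> 'v \<Rightarrow> 'k::field ^ ('v::finite \<Rightarrow> 'n::finite) \<Rightarrow> 'k ^ 'n" where
  "minor_row \<sigma> i p = (\<chi> j. p $ (\<sigma>(i := j)))"

lemma minor_row_maximal_minors:
  fixes B :: "'k::field ^ 'n ^ 'v"
  shows "minor_row \<sigma> i (maximal_minors B) $ j = det (\<chi> a b. if b = i then B $ a $ j else B $ a $ \<sigma> b)"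
  by (simp add: minor_row_def maximal_minors_def if_distrib[of "\<lambda>u. B $ _ $ u"] fun_upd_def cong: if_cong)

text \<open>
  Expanding the minor along the replaced column \<open>i\<close> gives cofactors that do not depend on the
  replacing column \<open>j\<close>.
\<close>

lemma minor_row_in_row_span:
  fixes B :: "'k::field ^ 'n ^ 'v"
  shows "minor_row \<sigma> i (maximal_minors B) \<in> vec.span (rows B)"
proof -
  define M :: "'v \<Rightarrow> 'k ^ 'v" where "M b = (\<chi> a. B $ a $ \<sigma> b)" for b
  define \<phi> where "\<phi> a = det (\<chi> b. if b = i then axis a 1 else M b)" for a
  have "minor_row \<sigma> i (maximal_minors B) $ j = (\<Sum>a\<in>UNIV. \<phi> a * B $ a $ j)" for j
  proof -
    have "minor_row \<sigma> i (maximal_minors B) $ j = det (transpose (\<chi> a b. if b = i then B $ a $ j else B $ a $ \<sigma> b))"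
      by (simp add: minor_row_maximal_minors det_transpose)
    also have "transpose (\<chi> a b. if b = i then B $ a $ j else B $ a $ \<sigma> b) =
        (\<chi> b. if b = i then (\<Sum>a\<in>UNIV. B $ a $ j *s axis a 1) else M b)"
      by (simp add: vec_eq_iff transpose_def M_def axis_def if_distrib cong: if_cong)
    also have "det \<dots> = (\<Sum>a\<in>UNIV. det (\<chi> b. if b = i then B $ a $ j *s axis a 1 else M b))"
      by (rule det_linear_row_sum) simp
    also have "\<dots> = (\<Sum>a\<in>UNIV. \<phi> a * B $ a $ j)"
      by (simp add: det_row_mul \<phi>_def mult.commute)
    finally show ?thesis .
  qed
  then have "minor_row \<sigma> i (maximal_minors B) = (\<Sum>a\<in>UNIV. \<phi> a *s row a B)"
    by (simp add: vec_eq_iff row_def sum_component)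
  moreover have "row a B \<in> rows B" for a by (auto simp: rows_def)
  ultimately show ?thesis
    by (simp add: vec.span_sum vec.span_scale vec.span_base)
qed

lemma cramer_rows:
  fixes B :: "'k::field ^ 'n ^ 'v"
  assumes "maximal_minors B $ \<sigma> \<noteq> 0"
  shows "maximal_minors B $ \<sigma> *s row k B = (\<Sum>i\<in>UNIV. B $ k $ \<sigma> i *s minor_row \<sigma> i (maximal_minors B))"
proof -
  define M :: "'k ^ 'v ^ 'v" where "M = (\<chi> a b. B $ a $ \<sigma> b)"
  have M: "det M = maximal_minors B $ \<sigma>" by (simp add: maximal_minors_def M_def)
  have "det M * B $ k $ j = (\<Sum>i\<in>UNIV. B $ k $ \<sigma> i * minor_row \<sigma> i (maximal_minors B) $ j)" for j
  proof -
    define y :: "'k ^ 'v" where "y = (\<chi> a. B $ a $ j)"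
    define x where "x = (\<chi> i. det (\<chi> a b. if b = i then y $ a else M $ a $ b) / det M)"
    have "M *v x = y" using cramer[of M x y] assms by (simp add: M x_def)
    then have "(\<Sum>i\<in>UNIV. M $ k $ i * x $ i) = y $ k" by (auto simp: matrix_vector_mult_def vec_eq_iff)
    then have "det M * B $ k $ j = (\<Sum>i\<in>UNIV. det M * (M $ k $ i * x $ i))"
      by (simp add: y_def sum_distrib_left[symmetric])
    also have "\<dots> = (\<Sum>i\<in>UNIV. B $ k $ \<sigma> i * minor_row \<sigma> i (maximal_minors B) $ j)"
    proof (rule sum.cong[OF refl])
      fix i
      have "(\<chi> a b. if b = i then y $ a else M $ a $ b) = (\<chi> a b. if b = i then B $ a $ j else B $ a $ \<sigma> b)"
        by (simp add: vec_eq_iff y_def M_def)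
      then have "det M * x $ i = minor_row \<sigma> i (maximal_minors B) $ j"
        using assms by (simp add: x_def minor_row_maximal_minors M)
      then show "det M * (M $ k $ i * x $ i) = B $ k $ \<sigma> i * minor_row \<sigma> i (maximal_minors B) $ j"
        by (simp add: M_def mult_ac)
    qed
    finally show ?thesis .
  qed
  then show ?thesis by (simp add: vec_eq_iff M row_def sum_component)
qed

text \<open>
  Every vector of one subspace extends to a family of vectors, one in each subspace of the
  Grassmannian, that is linear in the Pluecker coordinates: write it in the basis of minor rows and keep
  the coefficients.
\<close>

lemma vector_from_minors:
  fixes B0 :: "'k::field ^ 'n ^ 'v"
  assumes "vec.dim (rows B0) = CARD('v)" "u \<in> vec.span (rows B0)"
  obtains g :: "'k ^ ('v \<Rightarrow> 'n) \<Rightarrow> 'k ^ 'n" where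
    "\<And>j. (\<lambda>p. g p $ j) \<in> alg coords" "g (maximal_minors B0) = u"
    "\<And>W p. vec.subspace W \<Longrightarrow> p \<in> pluecker W \<Longrightarrow> g p \<in> W"
proof -
  obtain \<sigma> where \<sigma>: "maximal_minors B0 $ \<sigma> \<noteq> 0"
    using maximal_minors_nonzero[OF assms(1)] by (auto simp: vec_eq_iff)
  let ?m = "\<lambda>i. minor_row \<sigma> i (maximal_minors B0)"
  have "rows B0 \<subseteq> {\<Sum>i\<in>UNIV. c i *s ?m i | c. True}"
  proof
    fix x assume "x \<in> rows B0"
    then obtain k where "x = row k B0" by (auto simp: rows_def)
    then have "x = inverse (maximal_minors B0 $ \<sigma>) *s (maximal_minors B0 $ \<sigma> *s row k B0)"
      using \<sigma> by (simp add: vector_smult_assoc)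
    also have "\<dots> = (\<Sum>i\<in>UNIV. (inverse (maximal_minors B0 $ \<sigma>) * B0 $ k $ \<sigma> i) *s ?m i)"
      unfolding cramer_rows[OF \<sigma>] by (simp add: vec.scale_sum_right vector_smult_assoc)
    finally show "x \<in> {\<Sum>i\<in>UNIV. c i *s ?m i | c. True}"
      by (intro CollectI exI[of _ "\<lambda>i. inverse (maximal_minors B0 $ \<sigma>) * B0 $ k $ \<sigma> i"]) simp
  qed
  moreover have "vec.subspace {\<Sum>i\<in>UNIV. c i *s ?m i | c. True}"
    unfolding vec.subspace_def
  proof (intro conjI ballI allI)
    show "0 \<in> {\<Sum>i\<in>UNIV. c i *s ?m i | c. True}" by (intro CollectI exI[of _ "\<lambda>_. 0"]) simp
    fix x assume "x \<in> {\<Sum>i\<in>UNIV. c i *s ?m i | c. True}"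
    then obtain c where c: "x = (\<Sum>i\<in>UNIV. c i *s ?m i)" by blast
    show "t *s x \<in> {\<Sum>i\<in>UNIV. c i *s ?m i | c. True}" for t
      by (intro CollectI exI[of _ "\<lambda>i. t * c i"]) (simp add: c vec.scale_sum_right vector_smult_assoc)
    fix y assume "y \<in> {\<Sum>i\<in>UNIV. c i *s ?m i | c. True}"
    then obtain d where d: "y = (\<Sum>i\<in>UNIV. d i *s ?m i)" by blast
    show "x + y \<in> {\<Sum>i\<in>UNIV. c i *s ?m i | c. True}"
      by (intro CollectI exI[of _ "\<lambda>i. c i + d i"]) (simp add: c d sum.distrib vec.scale_left_distrib)
  qed
  ultimately have "vec.span (rows B0) \<subseteq> {\<Sum>i\<in>UNIV. c i *s ?m i | c. True}" by (rule vec.span_minimal)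
  then obtain c where c: "u = (\<Sum>i\<in>UNIV. c i *s ?m i)" using assms(2) by blast
  define g where "g p = (\<Sum>i\<in>UNIV. c i *s minor_row \<sigma> i p)" for p
  show ?thesis
  proof (rule that[of g])
    show "(\<lambda>p. g p $ j) \<in> alg coords" for j
      by (simp add: g_def sum_component minor_row_def) (intro alg_sum alg_mult alg_const coords_alg)
    show "g (maximal_minors B0) = u" by (simp add: g_def c)
    fix W :: "('k ^ 'n) set" and p :: "'k ^ ('v \<Rightarrow> 'n)"
    assume W: "vec.subspace W" and p: "p \<in> pluecker W"
    have g0: "g 0 = 0" by (simp add: g_def minor_row_def vec_eq_iff sum_component)
    have gadd: "g (c *s x + y) = c *s g x + g y" for c x y
      by (simp add: g_def minor_row_def vec_eq_iff sum_component sum.distrib sum_distrib_left algebra_simps)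
    from p show "g p \<in> W"
      unfolding pluecker_def
    proof (induction rule: vec.span_induct_alt)
      case base
      then show ?case using g0 vec.subspace_0[OF W] by simp
    next
      case (step c x y)
      then obtain B :: "'k ^ 'n ^ 'v" where B: "x = maximal_minors B" "vec.span (rows B) = W" by blast
      have "g x \<in> W"
        unfolding g_def B(1) using minor_row_in_row_span[of \<sigma> _ B] B(2)
        by (intro vec.subspace_sum[OF W] vec.subspace_scale[OF W]) simp
      then show ?case
        using step.IH W by (simp add: gadd vec.subspace_add vec.subspace_scale)
    qed
  qed
qed

text \<open>
  A homogeneous component that is nonzero on a line forces the inhomogeneous function to be nonzero
  somewhere on that line.
\<close>

lemma open_nonvanishing:
  fixes a :: "'k::field_char_0 ^ 'r \<Rightarrow> 'k"
  assumes "a \<in> alg coords" "a p0 \<noteq> 0" "p0 \<noteq> 0"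
  obtains D where "openin zariski D" "vec.span {p0} \<in> D" "\<And>L. L \<in> D \<Longrightarrow> \<exists>p\<in>L. a p \<noteq> 0"
proof -
  from assms(1) have "a \<in> alg ({} \<union> coords)" by simp
  then obtain N H where H: "\<And>d. is_form d (H d)" "\<And>x. a x = (\<Sum>d\<le>N. H d x)"
    using alg_graded[of a "{}" coords] by metis
  obtain d where d: "d \<le> N" "H d p0 \<noteq> 0" using assms(2) H(2)[of p0] by (metis atMost_iff sum.neutral)
  show ?thesis
  proof (rule that[of "nonvanishing {H d}"])
    show "openin zariski (nonvanishing {H d})"
      unfolding openin_zariski using form_homogeneous_poly[OF H(1)] by blast
    show "vec.span {p0} \<in> nonvanishing {H d}"
      using span_singleton_proj_space[OF assms(3)] d(2) vec.span_base[of p0 "{p0}"] by (auto simp: nonvanishing_def)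
    fix L assume "L \<in> nonvanishing {H d}"
    then obtain x where x: "L \<in> proj_space" "x \<in> L" "H d x \<noteq> 0" by (auto simp: nonvanishing_def)
    show "\<exists>p\<in>L. a p \<noteq> 0"
    proof (rule ccontr)
      assume no: "\<not> ?thesis"
      have "(\<Sum>d\<le>N. s ^ d * H d x) = 0" for s
      proof -
        have "s *s x \<in> L" using x(1,2) by (intro vec.subspace_scale proj_space_subspace)
        then have "a (s *s x) = 0" using no by blast
        then show ?thesis by (simp add: H(2) form_scale[OF H(1)])
      qed
      from polynomial_coeffs_zero[where N = N and c = "\<lambda>d. H d x", OF this d(1)] x(3) show False by simp
    qed
  qed
qed

section \<open>Ranks with respect to projections\<close>

lemma linear_add_scale:
  assumes "Vector_Spaces.linear (*s) (*s) l"
  shows "l (x + y) = l x + l y" "l (c *s x) = c *s l x"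
  using assms by (simp_all add: Vector_Spaces.linear_iff)

lemma linear_sum_list:
  fixes l :: "'k::field ^ 'n \<Rightarrow> 'k ^ 'm"
  assumes "Vector_Spaces.linear (*s) (*s) l"
  shows "l (\<Sum>i<(b::nat). c i) = (\<Sum>i<b. l (c i))"
proof (induction b)
  case 0
  show ?case using linear_add_scale(2)[OF assms, of 0 0] by simp
next
  case (Suc b)
  then show ?case by (simp add: linear_add_scale(1)[OF assms])
qed

text \<open>
  The images of the summands of \<open>z\<close> span \<open>P\<close>.  Summands equal to \<open>0\<close> are left out, as they determine no
  point of \<open>Y\<close>.
\<close>

lemma X_rank_le:
  fixes l :: "'k::field ^ 'r \<Rightarrow> 'k ^ 's"
  assumes l: "Vector_Spaces.linear (*s) (*s) l" and Y: "Y \<subseteq> proj_space"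
    and z: "z \<in> sumset b (affine_cone Y)" and P: "P \<in> proj_space" "l z \<in> P" "l z \<noteq> 0"
  shows "X_rank (proj_image l Y) P \<le> enat b"
proof -
  obtain c where c: "\<And>i. i < b \<Longrightarrow> c i \<in> affine_cone Y" "z = (\<Sum>i<b. c i)" using z by (rule sumsetE) blast
  define J where "J = {i. i < b \<and> c i \<noteq> 0}"
  define S where "S = (\<lambda>i. l ` vec.span {c i}) ` J"
  have finJ: "finite J" by (simp add: J_def)
  have "S \<subseteq> proj_image l Y"
    using c(1) mem_affine_cone[OF Y] by (auto simp: S_def J_def proj_image_def)
  moreover have "finite S" using finJ by (simp add: S_def)
  moreover have "P \<in> proj_span S"
  proof -
    have "l z = (\<Sum>i<b. l (c i))" unfolding c(2) by (rule linear_sum_list[OF l])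
    moreover have "l (c i) \<in> vec.span (\<Union>S)" if "i < b" for i
    proof (cases "c i = 0")
      case True
      then show ?thesis using linear_add_scale(2)[OF l, of 0 0] vec.span_zero by simp
    next
      case False
      then have "l (c i) \<in> \<Union>S" using that vec.span_base[of "c i" "{c i}"] by (auto simp: S_def J_def)
      then show ?thesis by (rule vec.span_base)
    qed
    ultimately have "l z \<in> vec.span (\<Union>S)" by (auto intro: vec.span_sum)
    moreover have "P = vec.span {l z}" by (rule proj_space_line[OF P])
    ultimately have "P \<subseteq> vec.span (\<Union>S)" using vec.span_minimal[of "{l z}" "vec.span (\<Union>S)"] by simp
    then show ?thesis using P(1) by (simp add: proj_span_def proj_points_def)
  qed
  ultimately have "X_rank (proj_image l Y) P \<le> enat (card S)"
    unfolding X_rank_def by (intro Inf_lower) blast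
  also have "card S \<le> b"
  proof -
    have "card S \<le> card J" unfolding S_def by (rule card_image_le[OF finJ])
    also have "\<dots> \<le> card {..<b}" by (rule card_mono) (auto simp: J_def)
    finally show ?thesis by simp
  qed
  finally show ?thesis by simp
qed

text \<open>
  A general \<open>V\<close> contains vectors \<open>N\<close> along which \<open>T\<close> projects onto the whole quotient and one further
  vector \<open>\<nu>\<close> outside \<open>add_span B N\<close>, where \<open>B\<close> is the set of zeros of \<open>F\<close> in \<open>T\<close>.  Such vectors exist
  for one \<open>V\<close> by \<open>proper_zero_set_projection\<close>, and for all nearby ones by \<open>param_projection\<close> applied to
  \<open>T\<close> and to \<open>B\<close>.  The line \<open>w - t \<nu>\<close> leaves the closed cone \<open>add_span B N\<close>, and a point of \<open>T\<close> over a
  point of the line outside that cone is not in \<open>B\<close>.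
\<close>

lemma general_centers:
  fixes T :: "('k::{alg_closed_field,field_char_0} ^ 'r) set"
  assumes T: "zclosed T" "is_cone T" "zprime T" and D: "has_dim T D"
    and F: "is_form d F" "d > 0" "\<exists>x\<in>T. F x \<noteq> 0"
    and v: "CARD('r) + 1 \<le> D + CARD('v::finite)" "CARD('v) \<le> CARD('r)"
  obtains U where "openin (grassmannian TYPE('v)) U" "U \<noteq> {}"
    "\<And>V w. V \<in> U \<Longrightarrow> w \<notin> V \<Longrightarrow> \<exists>x\<in>T. F x \<noteq> 0 \<and> x - w \<in> V"
proof -
  obtain vs where vs: "indep_of T vs" "add_span T vs = UNIV" "length vs + D = CARD('r)"
    using D by (auto simp: has_dim_def)
  define B where "B = {x \<in> T. F x = 0}"
  have Falg: "F \<in> alg coords" by (rule forms_alg[OF F(1)]) (auto intro: alg_mono alg_gen)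
  have F0: "F 0 = 0" using form_scale[OF F(1), of 0 0] F(2) by (simp add: power_0_left)
  have coneB: "is_cone B"
    using T(2) F0 by (auto simp: is_cone_def B_def form_scale[OF F(1)])
  have closedB: "zclosed B"
  proof (rule zero_closedI)
    fix x assume "x \<notin> B"
    then consider "x \<notin> T" | "F x \<noteq> 0" by (auto simp: B_def)
    then show "\<exists>f\<in>alg coords. (\<forall>z\<in>B. f z = 0) \<and> f x \<noteq> 0"
    proof cases
      case 1
      obtain f where "f \<in> alg coords" "\<And>z. z \<in> T \<Longrightarrow> f z = 0" "f x \<noteq> 0"
        by (rule zero_closedE[OF T(1) 1]) blast
      then show ?thesis by (intro bexI[of _ f]) (auto simp: B_def)
    next
      case 2
      then show ?thesis using Falg by (intro bexI[of _ F]) (auto simp: B_def)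
    qed
  qed
  have "add_span B vs \<noteq> UNIV"
    unfolding B_def by (rule proper_zero_set_projection[OF T vs(1) Falg F(3)])
  then obtain \<nu> where \<nu>: "\<nu> \<notin> add_span B vs" by auto
  have "indep_of B vs" by (rule indep_of_mono[OF _ vs(1)]) (auto simp: B_def)
  then have iB: "indep_of B (\<nu> # vs)" using \<nu> by simp
  define S where "S = set (\<nu> # vs)"
  have indS: "vec.independent S" and "distinct (\<nu> # vs)"
    using indep_of_independent[OF iB cone_0[OF coneB]] unfolding S_def by blast+
  then have cS: "card S = length vs + 1" unfolding S_def by (metis distinct_card length_Cons Suc_eq_plus1)
  \<comment> \<open>Any subspace of the right dimension that contains \<open>\<nu> # vs\<close> will do as a first example; it is spanned by part of a basis.\<close>
  obtain A where A: "S \<subseteq> A" "vec.independent A" "UNIV \<subseteq> vec.span A"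
    using vec.maximal_independent_subset_extend[of S UNIV] indS by auto
  have finA: "finite A" by (rule vec.finiteI_independent[OF A(2)])
  have "vec.span A = UNIV" using A(3) by blast
  then have "vec.dim (vec.span A) = CARD('r)" by (simp only: vec_dim_card)
  then have "card A = CARD('r)"
    using vec.dim_eq_card_independent[OF A(2)] by (simp only: vec.dim_span)
  then obtain S' where S': "S \<subseteq> S'" "S' \<subseteq> A" "card S' = CARD('v)"
    using exists_subset_between[of S "CARD('v)" A] cS vs(3) v A(1) finA by auto
  have finS': "finite S'" using S'(2) finA by (rule finite_subset)
  have indS': "vec.independent S'" by (rule vec.independent_mono[OF A(2) S'(2)])
  obtain h where h: "bij_betw h (UNIV :: 'v set) S'"
    using finite_same_card_bij[of "UNIV :: 'v set" S'] S'(3) finS' by auto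
  define B0 :: "'k ^ 'r ^ 'v" where "B0 = (\<chi> i. h i)"
  have "row i B0 = h i" for i by (simp add: row_def B0_def vec_eq_iff)
  then have rB0: "rows B0 = S'" using h by (auto simp: rows_def bij_betw_def)
  have dB0: "vec.dim (rows B0) = CARD('v)"
    unfolding rB0 using vec.dim_eq_card_independent[OF indS'] S'(3) by simp
  define p0 where "p0 = maximal_minors B0"
  have p00: "p0 \<noteq> 0" unfolding p0_def by (rule maximal_minors_nonzero[OF dB0])
  have "\<exists>g :: 'k ^ ('v \<Rightarrow> 'r) \<Rightarrow> 'k ^ 'r. (\<forall>j. (\<lambda>p. g p $ j) \<in> alg coords) \<and> g p0 = u \<and>
     (\<forall>W p. vec.subspace W \<longrightarrow> p \<in> pluecker W \<longrightarrow> g p \<in> W)" if "u \<in> S" for u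
  proof -
    have "u \<in> vec.span (rows B0)" using that S'(1) by (auto simp: rB0 intro: vec.span_base)
    then obtain g :: "'k ^ ('v \<Rightarrow> 'r) \<Rightarrow> 'k ^ 'r" where "\<And>j. (\<lambda>p. g p $ j) \<in> alg coords" "g (maximal_minors B0) = u"
      "\<And>W p. vec.subspace W \<Longrightarrow> p \<in> pluecker W \<Longrightarrow> g p \<in> W"
      by (rule vector_from_minors[OF dB0]) blast
    then show ?thesis unfolding p0_def by blast
  qed
  then obtain G :: "'k ^ 'r \<Rightarrow> 'k ^ ('v \<Rightarrow> 'r) \<Rightarrow> 'k ^ 'r" where G:
    "\<And>u j. u \<in> S \<Longrightarrow> (\<lambda>p. G u p $ j) \<in> alg coords" "\<And>u. u \<in> S \<Longrightarrow> G u p0 = u"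
    "\<And>u W p. u \<in> S \<Longrightarrow> vec.subspace W \<Longrightarrow> p \<in> pluecker W \<Longrightarrow> G u p \<in> W"
    by metis
  define N where "N p = map (\<lambda>u. G u p) vs" for p
  have N0: "N p0 = vs" unfolding N_def by (rule map_idI) (use G(2) in \<open>auto simp: S_def\<close>)
  have N_map: "map (\<lambda>g. g p) (map G vs) = N p" "map (\<lambda>g. g p) (map G (\<nu> # vs)) = G \<nu> p # N p" for p
    by (simp_all add: N_def o_def)
  have \<nu>S: "\<nu> \<in> S" by (simp add: S_def)
  obtain a1 where a1: "a1 \<in> alg coords" "a1 p0 \<noteq> 0" "\<And>p. a1 p \<noteq> 0 \<Longrightarrow> indep_of T (N p)"
  proof -
    have "\<exists>a\<in>alg coords. \<exists>Z. zero_closed (alg (base_coords \<union> fibre_coords)) Z \<and> a p0 \<noteq> 0 \<and>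
      (\<forall>p. a p \<noteq> 0 \<longrightarrow> indep_of T (map (\<lambda>g. g p) (map G vs)) \<and>
        (\<forall>x. (p, x) \<in> Z \<longleftrightarrow> x \<in> add_span T (map (\<lambda>g. g p) (map G vs))))"
      by (rule param_projection[OF T(1,2)]) (use G(1) vs(1) in \<open>auto simp: N_map N0 S_def simp del: map_map\<close>)
    then show ?thesis using that unfolding N_map by blast
  qed
  obtain a2 where a2: "a2 \<in> alg coords" "a2 p0 \<noteq> 0" "\<And>p. a2 p \<noteq> 0 \<Longrightarrow> indep_of B (G \<nu> p # N p)"
  proof -
    have "\<exists>a\<in>alg coords. \<exists>Z. zero_closed (alg (base_coords \<union> fibre_coords)) Z \<and> a p0 \<noteq> 0 \<and>
      (\<forall>p. a p \<noteq> 0 \<longrightarrow> indep_of B (map (\<lambda>g. g p) (map G (\<nu> # vs))) \<and>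
        (\<forall>x. (p, x) \<in> Z \<longleftrightarrow> x \<in> add_span B (map (\<lambda>g. g p) (map G (\<nu> # vs)))))"
    proof (rule param_projection[OF closedB coneB])
      show "(\<lambda>p. g p $ j) \<in> alg coords" if "g \<in> set (map G (\<nu> # vs))" for g j
        using that G(1) by (auto simp: S_def)
      show "indep_of B (map (\<lambda>g. g p0) (map G (\<nu> # vs)))"
        unfolding N_map N0 G(2)[OF \<nu>S] by (rule iB)
    qed
    then show ?thesis using that unfolding N_map by blast
  qed
  have "(\<lambda>p. a1 p * a2 p) \<in> alg coords" by (rule alg_mult[OF a1(1) a2(1)])
  moreover have "a1 p0 * a2 p0 \<noteq> 0" using a1(2) a2(2) by simp
  ultimately obtain E where E: "openin zariski E" "vec.span {p0} \<in> E" "\<And>L. L \<in> E \<Longrightarrow> \<exists>p\<in>L. a1 p * a2 p \<noteq> 0"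
    using open_nonvanishing[of "\<lambda>p. a1 p * a2 p" p0] p00 by blast
  define U where "U = {W :: ('k ^ 'r) set. vec.subspace W \<and> vec.dim W = CARD('v) \<and> pluecker W \<in> E}"
  show ?thesis
  proof (rule that[of U])
    show "openin (grassmannian TYPE('v)) U"
      unfolding openin_grassmannian U_def using E(1) by blast
    have dV0: "vec.dim (vec.span (rows B0)) = CARD('v)" using dB0 by (simp add: vec.dim_span)
    have "p0 \<in> pluecker (vec.span (rows B0))"
      unfolding pluecker_def p0_def by (intro vec.span_base) blast
    moreover have "(pluecker (vec.span (rows B0)) :: ('k ^ ('v \<Rightarrow> 'r)) set) \<in> proj_space"
      by (rule pluecker_in_proj_space[OF vec.subspace_span dV0])
    ultimately have "pluecker (vec.span (rows B0)) = vec.span {p0}"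
      using proj_space_line p00 by blast
    then have "vec.span (rows B0) \<in> U" unfolding U_def using E(2) dV0 by simp
    then show "U \<noteq> {}" by blast
    fix V w assume V: "V \<in> U" and w: "w \<notin> V"
    have Vs: "vec.subspace V" using V by (simp add: U_def)
    obtain p where p: "p \<in> pluecker V" "a1 p \<noteq> 0" "a2 p \<noteq> 0"
      using V E(3) unfolding U_def by fastforce
    have NV: "set (N p) \<subseteq> V" using G(3)[OF _ Vs p(1)] by (auto simp: N_def S_def)
    have \<nu>V: "G \<nu> p \<in> V" by (rule G(3)[OF \<nu>S Vs p(1)])
    have iT: "indep_of T (N p)" by (rule a1(3)[OF p(2)])
    \<comment> \<open>Vectors along which \<open>T\<close> can be projected further would contradict the uniqueness of the dimension.\<close>
    obtain us where us: "indep_of T (us @ N p)" "add_span T (us @ N p) = UNIV"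
      using indep_of_extend[OF iT cone_0[OF T(2)]] by blast
    have "has_dim T (CARD('r) - length (us @ N p))"
      unfolding has_dim_def using us indep_of_length(1)[OF us(1) cone_0[OF T(2)]]
      by (intro exI[of _ "us @ N p"]) auto
    then have "CARD('r) - length (us @ N p) = D" by (rule has_dim_unique[OF T(1,2) _ D])
    moreover have "length (us @ N p) = length us + length vs" by (simp add: N_def)
    ultimately have "length us = 0"
      using vs(3) indep_of_length(1)[OF us(1) cone_0[OF T(2)]] by linarith
    then have full: "add_span T (N p) = UNIV" using us(2) by simp
    define W where "W = add_span B (N p)"
    have iB': "\<nu>' \<notin> W" "indep_of B (N p)" if "\<nu>' = G \<nu> p" for \<nu>'
      using a2(3)[OF p(3)] that by (auto simp: W_def)
    have "zclosed W" "is_cone W"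
      unfolding W_def using zero_closed_add_span[OF closedB coneB] iB'(2) cone_add_span[OF coneB] by auto
    then have "finite {t. w - t *s G \<nu> p \<in> W}" by (rule finite_line_cone[OF _ _ iB'(1)[OF refl]])
    then obtain t where t: "w - t *s G \<nu> p \<notin> W"
      using infinite_UNIV_char_0[where 'a = 'k] by (metis (mono_tags) UNIV_I finite_subset mem_Collect_eq subsetI)
    obtain x where x: "x \<in> T" "(w - t *s G \<nu> p) - x \<in> vec.span (set (N p))"
      using full by (metis UNIV_I add_span_iff)
    have "x \<notin> B" using t x(2) unfolding W_def add_span_iff by blast
    then have "F x \<noteq> 0" using x(1) by (simp add: B_def)
    moreover have "x - w \<in> V"
    proof -
      have "(w - t *s G \<nu> p) - x \<in> V" using x(2) vec.span_minimal[OF NV Vs] by blast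
      from vec.subspace_diff[OF Vs vec.subspace_neg[OF Vs this] vec.subspace_scale[OF Vs \<nu>V, of t]]
      show ?thesis by simp
    qed
    ultimately show "\<exists>x\<in>T. F x \<noteq> 0 \<and> x - w \<in> V" using x(1) by blast
  qed
qed

lemma subset_sumset:
  assumes "0 \<in> C" "1 \<le> b"
  shows "C \<subseteq> sumset b C"
proof
  fix x assume "x \<in> C"
  then show "x \<in> sumset b C"
    using assms by (intro sumsetI[where c = "\<lambda>i. if i = 0 then x else 0"]) auto
qed

lemma sumset_eventually_UNIV:
  fixes C :: "('k::field ^ 'r) set"
  assumes "is_cone C" "vec.span C = UNIV"
  obtains s where "sumset s C = UNIV"
proof -
  obtain B where B: "B \<subseteq> C" "vec.independent B" "C \<subseteq> vec.span B"
    using vec.maximal_independent_subset[of C] by blast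
  have fin: "finite B" by (rule vec.finiteI_independent[OF B(2)])
  have "vec.span B = UNIV" using assms(2) vec.span_minimal[OF B(3)] by auto
  obtain h where h: "bij_betw h {..<card B} B" using ex_bij_betw_nat_finite[OF fin] by (auto simp: atLeast0LessThan)
  have "x \<in> sumset (card B) C" for x
  proof -
    have "x \<in> range (\<lambda>u. \<Sum>v\<in>B. u v *s v)" using \<open>vec.span B = UNIV\<close> vec.span_finite[OF fin] by simp
    then obtain u where "x = (\<Sum>v\<in>B. u v *s v)" by blast
    also have "\<dots> = (\<Sum>i<card B. u (h i) *s h i)" by (rule sum.reindex_bij_betw[OF h, symmetric])
    finally have x: "x = (\<Sum>i<card B. u (h i) *s h i)" .
    have "u (h i) *s h i \<in> C" if "i < card B" for i
    proof -
      have "h i \<in> C" using that h B(1) by (auto simp: bij_betw_def)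
      then show ?thesis by (rule cone_scale[OF assms(1)])
    qed
    then show ?thesis using x by (rule sumsetI)
  qed
  then show ?thesis using that by blast
qed

lemma proj_dim_empty: "proj_dim {} = 0"
proof -
  have "{enat k | k. \<exists>Z :: nat \<Rightarrow> ('a ^ 'b) set set. (\<forall>i\<le>k. closedin (subtopology zariski {}) (Z i) \<and>
     irreducible_in (subtopology zariski {}) (Z i)) \<and> (\<forall>i<k. Z i \<subset> Z (Suc i))} = {}"
    by (auto simp: irreducible_in_def)
  then show ?thesis unfolding proj_dim_def krull_dim_def by (simp only: Sup_empty bot_enat_def)
qed

text \<open>
  The hypotheses on \<open>Y\<close> alone, for stating properties of its secant varieties.
\<close>

locale projected_variety =
  fixes Y :: "('k::{alg_closed_field,field_char_0} ^ 'r) set set"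
  assumes integral: "integral_variety Y" and nondeg: "nondegenerate Y"
begin

definition secant_cone :: "nat \<Rightarrow> ('k ^ 'r) set" where
  "secant_cone s = zclosure (sumset s (affine_cone Y))"

definition secant_dim :: "nat \<Rightarrow> nat" where
  "secant_dim s = (SOME d. has_dim (secant_cone s) d)"

lemma Y_points: "Y \<subseteq> proj_space" "Y \<noteq> {}"
  and cone_Y: "is_cone (affine_cone Y)" and zclosed_Y: "zclosed (affine_cone Y)"
  and zprime_Y: "zprime (affine_cone Y)"
proof -
  have "closedin zariski Y" "irreducible_in zariski Y" using integral by (auto simp: integral_variety_def)
  then show "Y \<subseteq> proj_space" "Y \<noteq> {}" "is_cone (affine_cone Y)" "zclosed (affine_cone Y)"
    "zprime (affine_cone Y)"
    using is_cone_affine_cone[of Y] unfolding closedin_zariski_iff irreducible_zariski_iff by auto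
qed

lemma is_cone_secant_cone: "is_cone (secant_cone s)" and zclosed_secant_cone: "zclosed (secant_cone s)"
  and zprime_secant_cone: "zprime (secant_cone s)"
  unfolding secant_cone_def
  by (rule cone_closure[OF is_cone_sumset[OF cone_Y]], rule zero_closed_closure,
      rule zero_prime_closure[OF zero_prime_sumset[OF zprime_Y]], rule alg_mult)

lemma has_dim_secant_cone: "has_dim (secant_cone s) (secant_dim s)"
  unfolding secant_dim_def using has_dim_exists[OF is_cone_secant_cone[of s]] by (metis someI)

lemma secant_variety_cone: "secant_variety s Y = proj_points (secant_cone s)"
  unfolding secant_cone_def by (rule secant_variety_eq[OF Y_points])

lemma sumset_nonzero:
  assumes "1 \<le> s" shows "sumset s (affine_cone Y) \<noteq> {0}"
proof
  assume "sumset s (affine_cone Y) = {0}"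
  then have "affine_cone Y \<subseteq> {0}" using subset_sumset[OF cone_0[OF cone_Y] assms] by simp
  then have "affine_cone Y = {0}" using cone_0[OF cone_Y] by auto
  then show False using affine_cone_eq_0_iff[OF Y_points(1)] Y_points(2) by simp
qed

lemma proj_dim_secant:
  assumes "1 \<le> s"
  shows "1 \<le> secant_dim s" "proj_dim (secant_variety s Y) = enat (secant_dim s - 1)"
proof -
  have af: "affine_cone (secant_variety s Y) = secant_cone s" unfolding secant_variety_cone by (rule affine_cone_proj_points[OF is_cone_secant_cone])
  have sub: "secant_variety s Y \<subseteq> proj_space" unfolding secant_variety_cone by (rule proj_points_subset)
  have "sumset s (affine_cone Y) \<subseteq> secant_cone s" unfolding secant_cone_def by (rule zero_closure_superset)
  then have "secant_cone s \<noteq> {0}" using sumset_nonzero[OF assms] cone_0[OF is_cone_sumset[OF cone_Y, of s]] by blast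
  then have "secant_variety s Y \<noteq> {}" using affine_cone_eq_0_iff[OF sub] af by simp
  then have "integral_variety (secant_variety s Y)"
    unfolding integral_variety_def closedin_zariski_iff irreducible_zariski_iff af
    using sub zclosed_secant_cone zprime_secant_cone by simp
  from proj_dim_has_dim[OF this, of "secant_dim s"] has_dim_secant_cone[of s]
  show "1 \<le> secant_dim s" "proj_dim (secant_variety s Y) = enat (secant_dim s - 1)" by (simp_all add: af)
qed

lemma secant_variety_0: "secant_variety 0 Y = {}"
proof -
  have "secant_cone 0 = {0}" unfolding secant_cone_def sumset_0 by (rule zero_closure_eq[OF zero_closed_singleton_0])
  then have "affine_cone (secant_variety 0 Y) = {0}" unfolding secant_variety_cone by (simp add: affine_cone_proj_points[OF is_cone_singleton_0])
  moreover have "secant_variety 0 Y \<subseteq> proj_space" unfolding secant_variety_cone by (rule proj_points_subset)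
  ultimately show ?thesis by (simp only: affine_cone_eq_0_iff)
qed

lemma secant_cone_1: "secant_cone 1 = affine_cone Y"
proof -
  have "sumset 1 (affine_cone Y) = affine_cone Y" by (simp add: sumset_Suc sumset_0)
  then show ?thesis unfolding secant_cone_def using zero_closure_eq[OF zclosed_Y] by simp
qed

lemma secant_dim_1:
  assumes "proj_dim Y = enat m" shows "secant_dim 1 = m + 1"
proof -
  have "secant_cone 1 = affine_cone Y" by (rule secant_cone_1)
  then have "1 \<le> secant_dim 1 \<and> proj_dim Y = enat (secant_dim 1 - 1)"
    using proj_dim_has_dim[OF integral, of "secant_dim 1"] has_dim_secant_cone[of 1] by simp
  then show ?thesis using assms by auto
qed

text \<open>
  Each further summand raises the dimension by at most that of the cone over \<open>Y\<close>.
\<close>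

lemma secant_dim_add_le:
  assumes "proj_dim Y = enat m" shows "secant_dim (s + k) \<le> secant_dim s + k * (m + 1)"
proof (induction k)
  case (Suc k)
  have "secant_cone 1 = affine_cone Y" by (rule secant_cone_1)
  then have "has_dim (affine_cone Y) (m + 1)" using has_dim_secant_cone[of 1] secant_dim_1[OF assms] by simp
  from has_dim_sumset_Suc[OF zclosed_Y cone_Y this, of "s + k"] has_dim_secant_cone[of "s + k"] has_dim_secant_cone[of "Suc (s + k)"]
  have "secant_dim (Suc (s + k)) \<le> secant_dim (s + k) + (m + 1)" unfolding secant_cone_def by blast
  then show ?case using Suc by simp
qed simp

lemma secant_generic_rank: "secant_cone (generic_rank Y) = UNIV" "1 \<le> generic_rank Y" "secant_dim (generic_rank Y) = CARD('r)"
proof -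
  have full: "vec.span (affine_cone Y) = UNIV"
  proof -
    have "x \<in> vec.span (affine_cone Y)" for x :: "'k ^ 'r"
    proof (cases "x = 0")
      case False
      have "vec.span {x} \<in> proj_span Y" using span_singleton_proj_space[OF False] nondeg by (simp add: nondegenerate_def)
      then have "vec.span {x} \<subseteq> vec.span (\<Union>Y)" by (simp add: proj_span_def proj_points_def)
      then have "x \<in> vec.span (\<Union>Y)" using vec.span_base[of x "{x}"] by blast
      moreover have "vec.span (\<Union>Y) \<subseteq> vec.span (affine_cone Y)" by (rule vec.span_mono) (auto simp: affine_cone_def)
      ultimately show ?thesis by blast
    qed (simp add: vec.span_zero)
    then show ?thesis by blast
  qed
  obtain s where "sumset s (affine_cone Y) = UNIV" using sumset_eventually_UNIV[OF cone_Y full] by blast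
  then have "secant_cone s = UNIV" unfolding secant_cone_def using zero_closure_superset[of UNIV "alg coords :: ('k ^ 'r \<Rightarrow> 'k) set"] by auto
  then have "secant_variety s Y = proj_space" unfolding secant_variety_cone by (simp add: proj_points_def)
  then have g: "secant_variety (generic_rank Y) Y = proj_space" unfolding generic_rank_def by (rule LeastI)
  have cU: "is_cone (UNIV :: ('k ^ 'r) set)" by (simp add: is_cone_def)
  have "secant_cone (generic_rank Y) = affine_cone proj_space"
    using g affine_cone_proj_points[OF is_cone_secant_cone[of "generic_rank Y"]] by (simp add: secant_variety_cone)
  also have "proj_space = proj_points (UNIV :: ('k ^ 'r) set)" by (simp add: proj_points_def)
  finally show TU: "secant_cone (generic_rank Y) = UNIV" by (simp add: affine_cone_proj_points[OF cU])
  show "1 \<le> generic_rank Y"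
  proof (rule ccontr)
    assume "\<not> ?thesis"
    then have "proj_space = ({} :: ('k ^ 'r) set set)" using g secant_variety_0 by (simp add: not_le)
    then show False using Y_points by auto
  qed
  have "has_dim (UNIV :: ('k ^ 'r) set) (CARD('r))" unfolding has_dim_def by (intro exI[of _ "[]"]) simp
  then show "secant_dim (generic_rank Y) = CARD('r)"
    using has_dim_unique[OF zclosed_secant_cone is_cone_secant_cone has_dim_secant_cone, of "generic_rank Y"] TU by simp
qed

lemma sumset_open:
  assumes "1 \<le> s"
  shows "\<exists>d F. is_form d F \<and> d > 0 \<and> (\<exists>x\<in>sumset s (affine_cone Y). F x \<noteq> 0) \<and>
    (\<forall>z\<in>secant_cone s. F z \<noteq> 0 \<longrightarrow> z \<in> sumset s (affine_cone Y))"
  unfolding secant_cone_def by (rule sumset_contains_open[OF zclosed_Y zprime_Y cone_Y sumset_nonzero[OF assms]])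

text \<open>
  The cone over the secant variety is the whole space, so \<open>F u \<noteq> 0\<close> for one \<open>u \<in> V\<close> is enough: \<open>F\<close> is
  not identically zero on the line \<open>u + t w\<close>, and a value \<open>t \<noteq> 0\<close> is needed for this point to
  project onto \<open>P\<close>.
\<close>

lemma rank_general_point:
  "\<exists>U. openin zariski U \<and> U \<noteq> {} \<and>
        (\<forall>V (l :: 'k ^ 'r \<Rightarrow> 'k ^ 's). vec.subspace V \<and> proj_points V \<inter> U \<noteq> {} \<and> is_projection_from V l \<longrightarrow>
           (\<forall>P\<in>proj_space. X_rank (proj_image l Y) P \<le> enat (generic_rank Y)))"
proof -
  obtain d F where F: "is_form d F" "d > 0" "\<exists>x\<in>sumset (generic_rank Y) (affine_cone Y). F x \<noteq> 0"
    "\<forall>z\<in>secant_cone (generic_rank Y). F z \<noteq> 0 \<longrightarrow> z \<in> sumset (generic_rank Y) (affine_cone Y)"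
    using sumset_open[OF secant_generic_rank(2)] by (elim exE conjE)
  have Falg: "F \<in> alg coords" by (rule forms_alg[OF F(1)]) (auto intro: alg_mono alg_gen)
  obtain x where x: "F x \<noteq> 0" using F(3) by blast
  have "F 0 = 0" using form_scale[OF F(1), of 0 0] F(2) by (simp add: power_0_left)
  then have x0: "x \<noteq> 0" using x by auto
  let ?U = "nonvanishing {F}"
  show ?thesis
  proof (intro exI[of _ ?U] conjI allI impI ballI)
    show "openin zariski ?U" unfolding openin_zariski using form_homogeneous_poly[OF F(1)] by blast
    have "vec.span {x} \<in> ?U"
      using span_singleton_proj_space[OF x0] x vec.span_base[of x "{x}"] by (auto simp: nonvanishing_def)
    then show "?U \<noteq> {}" by blast
    fix V and l :: "'k ^ 'r \<Rightarrow> 'k ^ 's" and P :: "('k ^ 's) set"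
    assume V: "vec.subspace V \<and> proj_points V \<inter> ?U \<noteq> {} \<and> is_projection_from V l" and P: "P \<in> proj_space"
    have l: "Vector_Spaces.linear (*s) (*s) l" "surj l" "{x. l x = 0} = V" using V by (auto simp: is_projection_from_def)
    obtain u where u: "u \<in> V" "F u \<noteq> 0" using V by (auto simp: proj_points_def nonvanishing_def)
    obtain p where p: "p \<in> P" "p \<noteq> 0" using P by (rule proj_space_nonzero)
    obtain w where w: "l w = p" using l(2) by (metis surjD)
    obtain Q where Q: "\<And>t. poly Q t = F (u + t *s w)" using alg_line[OF Falg] by blast
    have "poly Q 0 \<noteq> 0" using u(2) by (simp add: Q)
    \<comment> \<open>The factor excludes the root \<open>0\<close>.\<close>
    then have "Q * [:0, 1:] \<noteq> 0" by auto
    then obtain t where "poly (Q * [:0, 1:]) t \<noteq> 0" by (rule poly_nonroot)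
    then have t: "t \<noteq> 0" "F (u + t *s w) \<noteq> 0" by (auto simp: Q)
    have z: "u + t *s w \<in> sumset (generic_rank Y) (affine_cone Y)"
      using F(4) t(2) by (simp add: secant_generic_rank(1))
    have "l u = 0" using u(1) l(3) by blast
    then have lz: "l (u + t *s w) = t *s p" by (simp add: linear_add_scale[OF l(1)] w)
    show "X_rank (proj_image l Y) P \<le> enat (generic_rank Y)"
    proof (rule X_rank_le[OF l(1) Y_points(1) z P])
      show "l (u + t *s w) \<in> P" unfolding lz using p(1) P by (intro vec.subspace_scale proj_space_subspace)
      show "l (u + t *s w) \<noteq> 0" unfolding lz using t(1) p(2) by simp
    qed
  qed
qed

lemma secant_index_attained:
  assumes "n + 1 < CARD('r)"
  shows "1 \<le> secant_index n Y" "n + 2 \<le> secant_dim (secant_index n Y)" "secant_index n Y \<le> generic_rank Y"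
    "\<And>s. 1 \<le> s \<Longrightarrow> s < secant_index n Y \<Longrightarrow> secant_dim s \<le> n + 1"
proof -
  let ?P = "\<lambda>s. enat (n + 1) \<le> proj_dim (secant_variety s Y)"
  have "?P (generic_rank Y)"
    using proj_dim_secant(2)[OF secant_generic_rank(2)] secant_generic_rank(3) assms by simp
  then have P: "?P (secant_index n Y)" and le: "secant_index n Y \<le> generic_rank Y"
    unfolding secant_index_def by (rule LeastI, rule Least_le)
  show "secant_index n Y \<le> generic_rank Y" by (rule le)
  show s1: "1 \<le> secant_index n Y"
  proof (rule ccontr)
    assume "\<not> ?thesis"
    then have "secant_index n Y = 0" by simp
    then show False using P by (simp add: secant_variety_0 proj_dim_empty zero_enat_def)
  qed
  show "n + 2 \<le> secant_dim (secant_index n Y)" using P proj_dim_secant[OF s1] by simp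
  fix s assume "1 \<le> s" "s < secant_index n Y"
  then have "\<not> ?P s" unfolding secant_index_def by (intro not_less_Least)
  then show "secant_dim s \<le> n + 1" using proj_dim_secant[OF \<open>1 \<le> s\<close>] by simp
qed

lemma rank_general_center:
  assumes "CARD('r) = n + CARD('v) + 1" and "1 \<le> CARD('v)"
  shows "\<exists>U. openin (grassmannian TYPE('v::finite)) U \<and> U \<noteq> {} \<and>
        (\<forall>V\<in>U. \<forall>l :: 'k ^ 'r \<Rightarrow> 'k ^ 's. is_projection_from V l \<longrightarrow>
           (\<forall>P\<in>proj_space. X_rank (proj_image l Y) P \<le> enat (secant_index n Y)))"
proof -
  have "n + 1 < CARD('r)" using assms by simp
  note s = secant_index_attained[OF this]
  let ?s = "secant_index n Y"
  obtain d F where F: "is_form d F" "d > 0" "\<exists>x\<in>sumset ?s (affine_cone Y). F x \<noteq> 0"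
    "\<forall>z\<in>secant_cone ?s. F z \<noteq> 0 \<longrightarrow> z \<in> sumset ?s (affine_cone Y)"
    using sumset_open[OF s(1)] by (elim exE conjE)
  obtain y where "y \<in> sumset ?s (affine_cone Y)" "F y \<noteq> 0" using F(3) by (elim bexE)
  then have Fy: "\<exists>x\<in>secant_cone ?s. F x \<noteq> 0" unfolding secant_cone_def by (intro bexI[of _ y] zero_closureI)
  have dims: "CARD('r) + 1 \<le> secant_dim ?s + CARD('v)" "CARD('v) \<le> CARD('r)" using s(2) assms by simp_all
  obtain U where U: "openin (grassmannian TYPE('v)) U" "U \<noteq> {}"
    "\<And>V w. V \<in> U \<Longrightarrow> w \<notin> V \<Longrightarrow> \<exists>x\<in>secant_cone ?s. F x \<noteq> 0 \<and> x - w \<in> V"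
    by (rule general_centers[OF zclosed_secant_cone is_cone_secant_cone zprime_secant_cone has_dim_secant_cone F(1,2) Fy dims]) blast
  show ?thesis
  proof (intro exI[of _ U] conjI ballI allI impI)
    fix V and l :: "'k ^ 'r \<Rightarrow> 'k ^ 's" and P :: "('k ^ 's) set"
    assume V: "V \<in> U" and l: "is_projection_from V l" and P: "P \<in> proj_space"
    have l: "Vector_Spaces.linear (*s) (*s) l" "surj l" "{x. l x = 0} = V" using l by (auto simp: is_projection_from_def)
    obtain p where p: "p \<in> P" "p \<noteq> 0" using P by (rule proj_space_nonzero)
    obtain w where w: "l w = p" using l(2) by (metis surjD)
    have "w \<notin> V" using l(3) w p(2) by blast
    then obtain x where x: "x \<in> secant_cone ?s" "F x \<noteq> 0" "x - w \<in> V" using U(3)[OF V] by blast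
    have "l (x - w) = 0" using x(3) l(3) by blast
    then have lx: "l x = p" using linear_add_scale(1)[OF l(1), of "x - w" w] w by simp
    have "x \<in> sumset ?s (affine_cone Y)" using F(4) x(1,2) by blast
    then show "X_rank (proj_image l Y) P \<le> enat ?s"
      by (rule X_rank_le[OF l(1) Y_points(1) _ P]) (use lx p in auto)
  qed (use U in auto)
qed

text \<open>
  The first bound compares \<open>n + 2\<close> with \<open>s\<close> summands of dimension \<open>m + 1\<close>.  For the second, the secant
  variety just before the index has a cone of dimension at most \<open>n + 1\<close>, and the remaining steps up to
  the generic rank have to reach \<open>n + v + 1\<close>.
\<close>

lemma secant_index_bounds:
  assumes "CARD('r) = n + v + 1" "1 \<le> v" "proj_dim Y = enat m"
  shows "n + 1 \<le> secant_index n Y * (m + 1)"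
    and "v \<le> (generic_rank Y - secant_index n Y + 1) * (m + 1)"
    and "secant_index n Y \<le> generic_rank Y"
proof -
  have "n + 1 < CARD('r)" using assms by simp
  note s = secant_index_attained[OF this]
  let ?s = "secant_index n Y" and ?a = "generic_rank Y"
  have bound: "secant_dim s \<le> s * (m + 1)" if "1 \<le> s" for s
    using secant_dim_add_le[OF assms(3), of 1 "s - 1"] secant_dim_1[OF assms(3)] that
    by (cases s) (auto simp: algebra_simps)
  show "n + 1 \<le> ?s * (m + 1)" using bound[OF s(1)] s(2) by simp
  show "?s \<le> ?a" by (rule s(3))
  show "v \<le> (?a - ?s + 1) * (m + 1)"
  proof (cases "?s = 1")
    \<comment> \<open>Here the secant variety before the index is empty, and its cone is not covered by the dimension formula.\<close>
    case True
    then show ?thesis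
      using bound[OF secant_generic_rank(2)] secant_generic_rank(2,3) assms(1) by simp
  next
    case False
    then have "secant_dim (?s - 1) \<le> n + 1" using s(1) by (intro s(4)) auto
    moreover have "(?s - 1) + (?a - ?s + 1) = ?a" using s(1,3) by simp
    ultimately show ?thesis
      using secant_dim_add_le[OF assms(3), of "?s - 1" "?a - ?s + 1"] secant_generic_rank(3) assms(1) by simp
  qed
qed

end

theorem theorem1:
  fixes Y :: "('k::{alg_closed_field, field_char_0} ^ 'r) set set"
    and n v m :: nat
  assumes "1 \<le> v"
    and "CARD('r) = n + v + 1" and "CARD('s) = n + 1" and "CARD('v) = v"
    and "integral_variety Y" and "nondegenerate Y" and "proj_dim Y = enat m"
  shows
    "(\<exists>U. openin (zariski :: ('k ^ 'r) set topology) U \<and> U \<noteq> {} \<and>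
        (\<forall>V (l :: 'k ^ 'r \<Rightarrow> 'k ^ 's).
           vec.subspace V \<and> vec.dim V = v \<and> proj_points V \<inter> Y = {} \<and>
           proj_points V \<inter> U \<noteq> {} \<and> is_projection_from V l \<longrightarrow>
           (\<forall>P\<in>proj_space. X_rank (proj_image l Y) P \<le> enat (generic_rank Y)))) \<and>
     (\<lceil>real (n + 1) / real (m + 1)\<rceil> \<le> int (secant_index n Y) \<and>
      int (secant_index n Y) \<le>
        int (generic_rank Y) - \<lceil>(real v - real m - 1) / real (m + 1)\<rceil> \<and>
      (\<exists>U. openin (grassmannian TYPE('v::finite) :: ('k ^ 'r) set topology) U \<and> U \<noteq> {} \<and>
        (\<forall>V\<in>U. \<forall>l :: 'k ^ 'r \<Rightarrow> 'k ^ 's.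
           proj_points V \<inter> Y = {} \<and> is_projection_from V l \<longrightarrow>
           (\<forall>P\<in>proj_space. X_rank (proj_image l Y) P \<le> enat (secant_index n Y)))))"
proof -
  interpret projected_variety Y by unfold_locales (rule assms(5), rule assms(6))
  let ?s = "secant_index n Y" and ?a = "generic_rank Y"
  note b = secant_index_bounds[OF assms(2,1,7)]
  have "real (n + 1) \<le> real ?s * real (m + 1)"
    using b(1) by (simp only: of_nat_mult[symmetric] of_nat_le_iff)
  then have lower: "\<lceil>real (n + 1) / real (m + 1)\<rceil> \<le> int ?s"
    by (simp add: ceiling_le_iff divide_le_eq)
  have "real v \<le> real (?a - ?s + 1) * real (m + 1)"
    using b(2) by (simp only: of_nat_mult[symmetric] of_nat_le_iff)
  then have "real v - real m - 1 \<le> (real ?a - real ?s) * real (m + 1)"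
    using b(3) by (simp add: of_nat_diff algebra_simps)
  then have "(real v - real m - 1) / real (m + 1) \<le> real ?a - real ?s"
    by (simp add: divide_le_eq)
  then have "\<lceil>(real v - real m - 1) / real (m + 1)\<rceil> \<le> int ?a - int ?s"
    by (simp add: ceiling_le_iff)
  then have upper: "int ?s \<le> int ?a - \<lceil>(real v - real m - 1) / real (m + 1)\<rceil>" by simp
  have card: "CARD('r) = n + CARD('v) + 1" "1 \<le> CARD('v)" using assms by simp_all
  obtain U where U: "openin (zariski :: ('k ^ 'r) set topology) U" "U \<noteq> {}"
    "\<forall>V (l :: 'k ^ 'r \<Rightarrow> 'k ^ 's). vec.subspace V \<and> proj_points V \<inter> U \<noteq> {} \<and> is_projection_from V l \<longrightarrow>
           (\<forall>P\<in>proj_space. X_rank (proj_image l Y) P \<le> enat (generic_rank Y))"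
    using rank_general_point by blast
  obtain U' where U': "openin (grassmannian TYPE('v) :: ('k ^ 'r) set topology) U'" "U' \<noteq> {}"
    "\<forall>V\<in>U'. \<forall>l :: 'k ^ 'r \<Rightarrow> 'k ^ 's. is_projection_from V l \<longrightarrow>
           (\<forall>P\<in>proj_space. X_rank (proj_image l Y) P \<le> enat (secant_index n Y))"
    using rank_general_center[OF card] by blast
  show ?thesis
    by (intro conjI lower upper exI[of _ U] exI[of _ U'] U(1,2) U'(1,2)) (use U(3) U'(3) in blast)+
qed

end
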